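(* The following two problems are NP-hard, even when all preference lists are strict, only posts have classifications (applicants have no classifications), and each applicant has quota one: (i) the CRMM decision problem: given a bipartite graph $G=(A\cup P,E)$ with applicant preference lists, quotas and (not necessarily laminar) classifications, and a vector $\sigma=(\sigma_1,\dots,\sigma_r)$, decide whether there is a feasible matching whose signature is lexicographically at least $\sigma$; (ii) the CPM problem: given such an instance (applicants of quota one, posts with quotas and not necessarily laminar classifications), decide whether it admits a matching that is popular among all feasible matchings.
   Context: Instance: bipartite graph $G=(A\cup P,E)$; each applicant $a\in A$ ranks its neighbours (edge $(a,p)$ has rank $k$ if $p$ is a $k$-th choice of $a$; $r$ is the largest rank). Each vertex $u$ has a quota $q(u)$ and a classification $\mathcal{C}_u$, a family of subsets (classes) of its neighbourhood $N(u)$, each class $C$ with quota $q(C)$. A matching $M\subseteq E$ is feasible if for every vertex $u$, $|M(u)|\le q(u)$ and $|M(u)\cap C|\le q(C)$ for all $C\in\mathcal{C}_u$, where $M(u)$ is the set of partners of $u$. The signature of $M$ is $(x_1,\dots,x_r)$ with $x_k$ the number of rank-$k$ edges of $M$, compared lexicographically. For feasible $M,M'$, applicant $a$ prefers $M$ to $M'$ if it ranks $M(a)$ strictly better than $M'(a)$ (being matched beats being unmatched); $M$ is more popular than $M'$ if more applicants prefer $M$ to $M'$ than vice versa; $M$ is popular among feasible matchings if no feasible matching is more popular. *)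

theory Defs
  imports "HOL-Computational_Algebra.Polynomial"
begin

section \<open>Turing machines\<close>

text \<open>
  Machines have finitely many two-way infinite tapes; a tape consists of its contents and its head
  position. States and tape symbols are natural numbers below the bounds \<open>tm_states\<close> and
  \<open>tm_symbols\<close>. Symbol 0 is the blank, symbols 1 and 2 are the bits; state 0 is the initial state.
  The transition relation maps a state and the list of scanned symbols to a set of possible
  successor states, each with one (written symbol, head displacement) pair per tape.
\<close>

type_synonym tape = "(int \<Rightarrow> nat) \<times> int"
type_synonym config = "nat \<times> tape list"

record tm =
  tm_tapes :: nat
  tm_states :: nat
  tm_symbols :: nat
  tm_accept :: nat
  tm_delta :: "nat \<Rightarrow> nat list \<Rightarrow> (nat \<times> (nat \<times> int) list) set"

definition wf_tm :: "tm \<Rightarrow> bool" where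
  "wf_tm M \<longleftrightarrow> tm_tapes M \<ge> 1 \<and> tm_states M \<ge> 1 \<and> tm_symbols M \<ge> 3 \<and> tm_accept M < tm_states M \<and>
     (\<forall>q ss. q < tm_states M \<and> length ss = tm_tapes M \<and> (\<forall>s\<in>set ss. s < tm_symbols M) \<longrightarrow>
       (\<forall>(q', as) \<in> tm_delta M q ss. q' < tm_states M \<and> length as = tm_tapes M \<and>
         (\<forall>(s, d) \<in> set as. s < tm_symbols M \<and> d \<in> {-1, 0, 1})))"

definition deterministic :: "tm \<Rightarrow> bool" where
  "deterministic M \<longleftrightarrow> (\<forall>q ss. \<forall>a \<in> tm_delta M q ss. \<forall>b \<in> tm_delta M q ss. a = b)"

definition tape_read :: "tape \<Rightarrow> nat" where
  "tape_read t = fst t (snd t)"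

definition tape_act :: "nat \<times> int \<Rightarrow> tape \<Rightarrow> tape" where
  "tape_act a t = ((fst t)(snd t := fst a), snd t + snd a)"

definition tm_step :: "tm \<Rightarrow> config \<Rightarrow> config \<Rightarrow> bool" where
  "tm_step M c c' \<longleftrightarrow>
     (\<exists>as. (fst c', as) \<in> tm_delta M (fst c) (map tape_read (snd c)) \<and>
           snd c' = map2 tape_act as (snd c))"

definition tm_halted :: "tm \<Rightarrow> config \<Rightarrow> bool" where
  "tm_halted M c \<longleftrightarrow> (\<nexists>c'. tm_step M c c')"

definition word_contents :: "bool list \<Rightarrow> int \<Rightarrow> nat" where
  "word_contents x i =
     (if 0 \<le> i \<and> i < int (length x) then (if x ! nat i then 2 else 1) else 0)"

definition tm_init :: "tm \<Rightarrow> bool list \<Rightarrow> config" where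
  "tm_init M x = (0, (word_contents x, 0) # replicate (tm_tapes M - 1) (word_contents [], 0))"

text \<open>The output is read off the last tape, which is also the input tape of a one-tape machine.\<close>

definition tm_outputs :: "config \<Rightarrow> bool list \<Rightarrow> bool" where
  "tm_outputs c y \<longleftrightarrow> fst (last (snd c)) = word_contents y"


section \<open>NP-hardness\<close>

definition polytime_computable :: "(bool list \<Rightarrow> bool list) \<Rightarrow> bool" where
  "polytime_computable f \<longleftrightarrow>
     (\<exists>M (p :: nat poly). wf_tm M \<and> deterministic M \<and>
       (\<forall>x. \<exists>n c. n \<le> poly p (length x) \<and> (tm_step M ^^ n) (tm_init M x) c \<and>
                  tm_halted M c \<and> tm_outputs c (f x)))"

text \<open>Every computation path has to respect the time bound, accepting or not.\<close>

definition NP :: "bool list set set" where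
  "NP = {L. \<exists>M (p :: nat poly). wf_tm M \<and>
     (\<forall>x. (\<forall>n c. (tm_step M ^^ n) (tm_init M x) c \<longrightarrow> n \<le> poly p (length x)) \<and>
          (x \<in> L \<longleftrightarrow> (\<exists>c. (tm_step M)\<^sup>*\<^sup>* (tm_init M x) c \<and> tm_halted M c \<and> fst c = tm_accept M)))}"

text \<open>
  A decision problem is given by a set \<open>D\<close> of instances, an encoding of instances as words, and the
  property \<open>Y\<close> to be decided. Hardness is under polynomial-time many-one reductions, whose
  values are required to encode members of \<open>D\<close>; hence hardness for a restricted set of
  instances cannot be obtained by mapping words to instances violating the restriction.
\<close>

definition NP_hard :: "('i \<Rightarrow> bool list) \<Rightarrow> 'i set \<Rightarrow> ('i \<Rightarrow> bool) \<Rightarrow> bool" where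
  "NP_hard enc D Y \<longleftrightarrow>
     (\<forall>L \<in> NP. \<exists>f. polytime_computable f \<and> (\<forall>x. \<exists>i \<in> D. f x = enc i \<and> (x \<in> L \<longleftrightarrow> Y i)))"

lemma NP_hard_mono: "NP_hard enc D Y \<Longrightarrow> D \<subseteq> D' \<Longrightarrow> NP_hard enc D' Y"
  unfolding NP_hard_def by (meson subsetD)


section \<open>Matchings with classifications\<close>

text \<open>
  The applicants and the posts of an instance are numbered by their positions in the two lists.
  A preference list is a list of tie classes, best first: the posts in the entry at index \<open>i\<close> are the
  applicant's choices of rank \<open>i + 1\<close>. A classification is a list of classes with their quotas.
\<close>

type_synonym classification = "(nat list \<times> nat) list"

record applicant =
  app_prefs :: "nat list list"
  app_quota :: nat
  app_classes :: classification

record post =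
  post_quota :: nat
  post_classes :: classification

record inst =
  applicants :: "applicant list"
  posts :: "post list"

definition edges :: "inst \<Rightarrow> (nat \<times> nat) set" where
  "edges I = {(a, p). a < length (applicants I) \<and>
                      (\<exists>g \<in> set (app_prefs (applicants I ! a)). p \<in> set g)}"

definition edge_rank :: "inst \<Rightarrow> nat \<Rightarrow> nat \<Rightarrow> nat" where
  "edge_rank I a p = (THE k. 1 \<le> k \<and> k \<le> length (app_prefs (applicants I ! a)) \<and>
                             p \<in> set (app_prefs (applicants I ! a) ! (k - 1)))"

definition max_rank :: "inst \<Rightarrow> nat" where
  "max_rank I = Max (insert 0 {edge_rank I a p | a p. (a, p) \<in> edges I})"

definition posts_of :: "(nat \<times> nat) set \<Rightarrow> nat \<Rightarrow> nat set" where
  "posts_of M a = {p. (a, p) \<in> M}"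

definition applicants_of :: "(nat \<times> nat) set \<Rightarrow> nat \<Rightarrow> nat set" where
  "applicants_of M p = {a. (a, p) \<in> M}"

definition valid_classification :: "nat set \<Rightarrow> classification \<Rightarrow> bool" where
  "valid_classification N cs \<longleftrightarrow>
     (\<forall>(C, q) \<in> set cs. distinct C \<and> set C \<subseteq> N) \<and> distinct (map (set \<circ> fst) cs)"

definition valid_inst :: "inst \<Rightarrow> bool" where
  "valid_inst I \<longleftrightarrow>
     (\<forall>a < length (applicants I). let A = applicants I ! a in
        [] \<notin> set (app_prefs A) \<and> distinct (concat (app_prefs A)) \<and>
        set (concat (app_prefs A)) \<subseteq> {..<length (posts I)} \<and>
        valid_classification (posts_of (edges I) a) (app_classes A)) \<and>
     (\<forall>p < length (posts I).
        valid_classification (applicants_of (edges I) p) (post_classes (posts I ! p)))"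

definition within_quotas :: "nat \<Rightarrow> classification \<Rightarrow> nat set \<Rightarrow> bool" where
  "within_quotas q cs S \<longleftrightarrow> card S \<le> q \<and> (\<forall>(C, qC) \<in> set cs. card (S \<inter> set C) \<le> qC)"

definition feasible :: "inst \<Rightarrow> (nat \<times> nat) set \<Rightarrow> bool" where
  "feasible I M \<longleftrightarrow> M \<subseteq> edges I \<and>
     (\<forall>a < length (applicants I).
        within_quotas (app_quota (applicants I ! a)) (app_classes (applicants I ! a)) (posts_of M a)) \<and>
     (\<forall>p < length (posts I).
        within_quotas (post_quota (posts I ! p)) (post_classes (posts I ! p)) (applicants_of M p))"

definition signature :: "inst \<Rightarrow> (nat \<times> nat) set \<Rightarrow> nat list" where
  "signature I M =
     map (\<lambda>k. card {(a, p). (a, p) \<in> M \<and> edge_rank I a p = k}) [1..<Suc (max_rank I)]"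

text \<open>Preferences between matchings are only used when every applicant has quota one.\<close>

definition prefers :: "inst \<Rightarrow> nat \<Rightarrow> (nat \<times> nat) set \<Rightarrow> (nat \<times> nat) set \<Rightarrow> bool" where
  "prefers I a M M' \<longleftrightarrow>
     (\<exists>p \<in> posts_of M a. \<forall>p' \<in> posts_of M' a. edge_rank I a p < edge_rank I a p')"

definition more_popular :: "inst \<Rightarrow> (nat \<times> nat) set \<Rightarrow> (nat \<times> nat) set \<Rightarrow> bool" where
  "more_popular I M M' \<longleftrightarrow>
     card {a. a < length (applicants I) \<and> prefers I a M M'} >
     card {a. a < length (applicants I) \<and> prefers I a M' M}"

definition popular :: "inst \<Rightarrow> (nat \<times> nat) set \<Rightarrow> bool" where
  "popular I M \<longleftrightarrow> feasible I M \<and> (\<nexists>M'. feasible I M' \<and> more_popular I M' M)"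

definition strict_prefs :: "inst \<Rightarrow> bool" where
  "strict_prefs I \<longleftrightarrow> (\<forall>A \<in> set (applicants I). \<forall>g \<in> set (app_prefs A). length g = 1)"

definition only_posts_classified :: "inst \<Rightarrow> bool" where
  "only_posts_classified I \<longleftrightarrow> (\<forall>A \<in> set (applicants I). app_classes A = [])"

definition unit_app_quotas :: "inst \<Rightarrow> bool" where
  "unit_app_quotas I \<longleftrightarrow> (\<forall>A \<in> set (applicants I). app_quota A = 1)"


section \<open>Encodings\<close>

text \<open>Self-delimiting codes; numbers are written in binary, least significant bit first.\<close>

fun bits_of_nat :: "nat \<Rightarrow> bool list" where
  "bits_of_nat n = (if n = 0 then [] else odd n # bits_of_nat (n div 2))"

declare bits_of_nat.simps [simp del]

fun enc_list :: "('a \<Rightarrow> bool list) \<Rightarrow> 'a list \<Rightarrow> bool list" where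
  "enc_list e [] = [False]"
| "enc_list e (x # xs) = True # e x @ enc_list e xs"

definition enc_nat :: "nat \<Rightarrow> bool list" where
  "enc_nat n = enc_list (\<lambda>b. [b]) (bits_of_nat n)"

definition enc_class :: "nat list \<times> nat \<Rightarrow> bool list" where
  "enc_class C = enc_list enc_nat (fst C) @ enc_nat (snd C)"

definition enc_applicant :: "applicant \<Rightarrow> bool list" where
  "enc_applicant A = enc_list (enc_list enc_nat) (app_prefs A) @ enc_nat (app_quota A) @
     enc_list enc_class (app_classes A)"

definition enc_post :: "post \<Rightarrow> bool list" where
  "enc_post P = enc_nat (post_quota P) @ enc_list enc_class (post_classes P)"

definition enc_inst :: "inst \<Rightarrow> bool list" where
  "enc_inst I = enc_list enc_applicant (applicants I) @ enc_list enc_post (posts I)"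

definition enc_inst_vec :: "inst \<times> nat list \<Rightarrow> bool list" where
  "enc_inst_vec J = enc_inst (fst J) @ enc_list enc_nat (snd J)"

definition prefix_free :: "('a \<Rightarrow> bool list) \<Rightarrow> bool" where
  "prefix_free e \<longleftrightarrow> (\<forall>x y u v. e x @ u = e y @ v \<longrightarrow> x = y \<and> u = v)"

lemma prefix_free_inj: "prefix_free e \<Longrightarrow> inj e"
  unfolding prefix_free_def inj_def by blast

lemma prefix_free_list:
  assumes "prefix_free e" shows "prefix_free (enc_list e)"
proof -
  have "enc_list e xs @ u = enc_list e ys @ v \<Longrightarrow> xs = ys \<and> u = v" for xs ys u v
  proof (induction xs arbitrary: ys)
    case Nil
    then show ?case by (cases ys) auto
  next
    case (Cons x xs)
    show ?case
    proof (cases ys)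
      case Nil
      then show ?thesis using Cons.prems by simp
    next
      case ys: (Cons y ys')
      have "e x @ (enc_list e xs @ u) = e y @ (enc_list e ys' @ v)"
        using Cons.prems ys by simp
      then have "x = y \<and> enc_list e xs @ u = enc_list e ys' @ v"
        using assms unfolding prefix_free_def by blast
      then show ?thesis using Cons.IH[of ys'] ys by simp
    qed
  qed
  then show ?thesis unfolding prefix_free_def by blast
qed

lemma prefix_free_nat: "prefix_free enc_nat"
proof -
  have bits: "bits_of_nat m = bits_of_nat n \<Longrightarrow> m = n" for m n
  proof (induction m arbitrary: n rule: less_induct)
    case (less m)
    show ?case
    proof (cases "m = 0 \<or> n = 0")
      case True
      then show ?thesis
        using less.prems by (auto simp: bits_of_nat.simps[of m] bits_of_nat.simps[of n] split: if_splits)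
    next
      case False
      then have "odd m = odd n" "bits_of_nat (m div 2) = bits_of_nat (n div 2)"
        using less.prems by (simp_all add: bits_of_nat.simps[of m] bits_of_nat.simps[of n])
      moreover have "m div 2 = n div 2"
        using less.IH[of "m div 2" "n div 2"] False calculation(2) by simp
      ultimately show ?thesis by presburger
    qed
  qed
  have "prefix_free (enc_list (\<lambda>b. [b]))"
    by (rule prefix_free_list) (simp add: prefix_free_def)
  then show ?thesis
    unfolding prefix_free_def enc_nat_def using bits by blast
qed

lemma prefix_free_class: "prefix_free enc_class"
  using prefix_free_list[OF prefix_free_nat] prefix_free_nat
  unfolding prefix_free_def enc_class_def append_assoc by (metis prod.expand)

lemma prefix_free_applicant: "prefix_free enc_applicant"
  using prefix_free_list[OF prefix_free_list[OF prefix_free_nat]] prefix_free_nat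
    prefix_free_list[OF prefix_free_class]
  unfolding prefix_free_def enc_applicant_def append_assoc by (metis applicant.equality unit.exhaust)

lemma prefix_free_post: "prefix_free enc_post"
  using prefix_free_nat prefix_free_list[OF prefix_free_class]
  unfolding prefix_free_def enc_post_def append_assoc by (metis post.equality unit.exhaust)

lemma prefix_free_inst: "prefix_free enc_inst"
  using prefix_free_list[OF prefix_free_applicant] prefix_free_list[OF prefix_free_post]
  unfolding prefix_free_def enc_inst_def append_assoc by (metis inst.equality unit.exhaust)

lemma inj_enc_inst: "inj enc_inst"
  by (rule prefix_free_inj[OF prefix_free_inst])

lemma inj_enc_inst_vec: "inj enc_inst_vec"
proof (rule prefix_free_inj)
  show "prefix_free enc_inst_vec"
    using prefix_free_inst prefix_free_list[OF prefix_free_nat]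
    unfolding prefix_free_def enc_inst_vec_def append_assoc by (metis prod.expand)
qed


section \<open>The decision problems\<close>

definition CRMM_instances :: "(inst \<times> nat list) set" where
  "CRMM_instances = {(I, \<sigma>). valid_inst I \<and> length \<sigma> = max_rank I}"

definition CRMM :: "inst \<times> nat list \<Rightarrow> bool" where
  "CRMM = (\<lambda>(I, \<sigma>). \<exists>M. feasible I M \<and> ord_class.lexordp_eq \<sigma> (signature I M))"

definition CPM_instances :: "inst set" where
  "CPM_instances = {I. valid_inst I \<and> unit_app_quotas I}"

definition CPM :: "inst \<Rightarrow> bool" where
  "CPM I \<longleftrightarrow> (\<exists>M. popular I M)"

end

theory Submission
  imports Defs
begin

text \<open>
  An accepting computation of a nondeterministic machine is described by a tableau: a constraint
  satisfaction problem whose variables are the tape cells, shown relative to the heads, and the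
  transitions taken. A matching picks applicants for a single post, one for each variable and its
  value; a class with \<open>n\<close> members and quota \<open>n - 1\<close> forbids a combination of values, and the size of
  the matching ensures that every variable gets a value. For popularity, three further applicants
  compete for a second post: they form a Condorcet cycle unless the first post is filled up.

  That the reduction is computable in polynomial time is shown for a small language of word
  generators, with nested loops over polynomially bounded numbers. The generators are compiled to
  counter programs, and these to Turing machines.
\<close>

section \<open>Structured programs for Turing machines\<close>

text \<open>The machine is fixed, so its transitions, the domain bound \<open>Z\<close> and the list
  of rules are constants; an input enters only through its length and its bits. Hence generators
  with polynomial loop bounds and passes over the input suffice. Showing the tapes relative to the
  heads avoids variables for head positions: once the transition is known, every displacement is a
  constant, and a rule has at most three cells. The price is that the window shifts at each step and
  its borders become unreliable, so it must be wide enough for the remaining time. Acceptance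
  requires a halted configuration. It is recorded by idle transitions, which exist only where the
  accepting state has no successor; they also pad computations to a common length. Classes have to
  differ as sets, which forbidden combinations need not do; hence the tagged applicants. The quota
  \<open>K\<close> of the first post counts the variables and the tags together. The same instance
  serves both problems: for signatures the threshold is \<open>[K + 1, 0]\<close>, where the one
  extra first choice is that of a probe.\<close>

datatype com =
    Skip
  | Act "nat list \<Rightarrow> (nat \<times> int) list"
  | Seq com com
  | Cond "nat list \<Rightarrow> bool" com com
  | While "nat list \<Rightarrow> bool" com

definition stay :: "nat list \<Rightarrow> (nat \<times> int) list" where
  "stay ss = map (\<lambda>s. (s, 0)) ss"

text \<open>Every test costs a step in which the tapes stay put, and so does dropping a finished
  first component of \<open>Seq\<close>. Thus a step of the program is a step of a machine whose
  state is the remaining program.\<close>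

fun nxt :: "com \<Rightarrow> nat list \<Rightarrow> com \<times> (nat \<times> int) list" where
  "nxt Skip ss = (Skip, stay ss)"
| "nxt (Act f) ss = (Skip, f ss)"
| "nxt (Seq c d) ss =
     (if c = Skip then (d, stay ss) else (Seq (fst (nxt c ss)) d, snd (nxt c ss)))"
| "nxt (Cond b c d) ss = (if b ss then c else d, stay ss)"
| "nxt (While b c) ss = (if b ss then Seq c (While b c) else Skip, stay ss)"

definition com_step :: "com \<times> tape list \<Rightarrow> com \<times> tape list \<Rightarrow> bool" where
  "com_step C C' \<longleftrightarrow> fst C \<noteq> Skip \<and> fst C' = fst (nxt (fst C) (map tape_read (snd C))) \<and>
     snd C' = map2 tape_act (snd (nxt (fst C) (map tape_read (snd C)))) (snd C)"

definition runs :: "com \<Rightarrow> tape list \<Rightarrow> nat \<Rightarrow> tape list \<Rightarrow> bool" where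
  "runs c ts b ts' \<longleftrightarrow> (\<exists>n\<le>b. (com_step ^^ n) (c, ts) (Skip, ts'))"

lemma stay_act: "map2 tape_act (stay (map tape_read ts)) ts = ts"
  unfolding stay_def by (rule nth_equalityI) (auto simp: tape_act_def tape_read_def prod_eq_iff)

lemma runs_mono: "runs c ts b ts' \<Longrightarrow> b \<le> b' \<Longrightarrow> runs c ts b' ts'"
  unfolding runs_def by (meson le_trans)

lemma runs_Skip: "runs Skip ts b ts"
  unfolding runs_def by (rule exI[of _ 0]) simp

lemma runs_step:
  assumes "c \<noteq> Skip" "nxt c (map tape_read ts) = (c', as)" "runs c' (map2 tape_act as ts) b ts'"
  shows "runs c ts (Suc b) ts'"
proof -
  obtain n where n: "n \<le> b" "(com_step ^^ n) (c', map2 tape_act as ts) (Skip, ts')"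
    using assms(3) unfolding runs_def by blast
  have "com_step (c, ts) (c', map2 tape_act as ts)"
    using assms(1,2) by (simp add: com_step_def)
  with n have "(com_step ^^ Suc n) (c, ts) (Skip, ts')"
    by (intro relpowp_Suc_I2)
  with n(1) show ?thesis unfolding runs_def by (meson Suc_le_mono)
qed

lemma runs_Act: "runs (Act f) ts 1 (map2 tape_act (f (map tape_read ts)) ts)"
  using runs_step[OF _ nxt.simps(2) runs_Skip, of f ts 0] by simp

lemma com_step_Seq:
  "(com_step ^^ n) (c, ts) (c', ts') \<Longrightarrow> (com_step ^^ n) (Seq c d, ts) (Seq c' d, ts')"
proof (induction n arbitrary: c' ts')
  case 0
  then show ?case by simp
next
  case (Suc n)
  then obtain c1 ts1 where "(com_step ^^ n) (c, ts) (c1, ts1)" and s: "com_step (c1, ts1) (c', ts')"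
    by (metis relpowp_Suc_E surj_pair)
  with Suc.IH have "(com_step ^^ n) (Seq c d, ts) (Seq c1 d, ts1)" by blast
  moreover have "com_step (Seq c1 d, ts1) (Seq c' d, ts')"
    using s by (simp add: com_step_def)
  ultimately show ?case by (rule relpowp_Suc_I)
qed

lemma runs_Seq:
  assumes "runs c ts a ts1" "runs d ts1 b ts'"
  shows "runs (Seq c d) ts (a + b + 1) ts'"
proof -
  obtain n where n: "n \<le> a" "(com_step ^^ n) (c, ts) (Skip, ts1)"
    using assms(1) unfolding runs_def by blast
  have "runs (Seq Skip d) ts1 (Suc b) ts'"
    using runs_step[of "Seq Skip d" ts1 d "stay (map tape_read ts1)" b ts'] assms(2)
    by (simp add: stay_act)
  then obtain m where m: "m \<le> Suc b" "(com_step ^^ m) (Seq Skip d, ts1) (Skip, ts')"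
    unfolding runs_def by blast
  have "(com_step ^^ (n + m)) (Seq c d, ts) (Skip, ts')"
    using com_step_Seq[OF n(2)] m(2) by (auto simp: relpowp_add)
  then show ?thesis using n(1) m(1) unfolding runs_def by (intro exI[of _ "n + m"]) auto
qed

lemma runs_Cond:
  assumes "runs (if b (map tape_read ts) then c else d) ts a ts'"
  shows "runs (Cond b c d) ts (Suc a) ts'"
  using runs_step[of "Cond b c d" ts "if b (map tape_read ts) then c else d"
      "stay (map tape_read ts)" a ts'] assms
  by (simp add: stay_act)

lemma runs_While_False: "\<not> b (map tape_read ts) \<Longrightarrow> runs (While b c) ts 1 ts"
  using runs_step[of "While b c" ts Skip "stay (map tape_read ts)" 0 ts]
  by (simp add: stay_act runs_Skip)

lemma runs_While_True:
  assumes "b (map tape_read ts)" "runs c ts n ts1" "runs (While b c) ts1 m ts'"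
  shows "runs (While b c) ts (n + m + 2) ts'"
  using runs_step[of "While b c" ts "Seq c (While b c)" "stay (map tape_read ts)" "n + m + 1" ts']
    runs_Seq[OF assms(2,3)] assms(1)
  by (simp add: stay_act)

text \<open>The states are indexed by the number of remaining rounds: \<open>st L\<close> is the
  start and \<open>st 0\<close> the end.\<close>

lemma runs_While_count:
  assumes "\<And>v. v < L \<Longrightarrow> b (map tape_read (st (Suc v)))"
    and "\<And>v. v < L \<Longrightarrow> runs c (st (Suc v)) m (st v)"
    and "\<not> b (map tape_read (st 0))"
  shows "runs (While b c) (st L) (L * (m + 2) + 1) (st 0)"
  using assms(1,2)
proof (induction L)
  case 0
  then show ?case using runs_While_False assms(3) by simp
next
  case (Suc L)
  have "runs (While b c) (st (Suc L)) (m + (L * (m + 2) + 1) + 2) (st 0)"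
    by (rule runs_While_True[where ?ts1.0 = "st L"]) (use Suc in auto)
  then show ?case by (simp add: algebra_simps)
qed

text \<open>The programs that remain to be executed at some point of a run of a program; they serve as
  the states of the machine.\<close>

fun conts :: "com \<Rightarrow> com set" where
  "conts Skip = {Skip}"
| "conts (Act f) = {Act f, Skip}"
| "conts (Seq c d) = (\<lambda>c'. Seq c' d) ` conts c \<union> conts d"
| "conts (Cond b c d) = {Cond b c d} \<union> conts c \<union> conts d"
| "conts (While b c) = {While b c, Skip} \<union> (\<lambda>c'. Seq c' (While b c)) ` conts c"

lemma finite_conts: "finite (conts c)"
  by (induction c) auto

lemma conts_self: "c \<in> conts c"
  by (induction c) auto

lemma conts_nxt: "c' \<in> conts c \<Longrightarrow> fst (nxt c' ss) \<in> conts c"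
proof (induction c arbitrary: c')
  case (Seq c d)
  then show ?case by (auto simp: conts_self)
next
  case (Cond b c d)
  then show ?case by (auto simp: conts_self)
next
  case (While b c)
  then consider "c' = While b c" | "c' = Skip"
    | c1 where "c1 \<in> conts c" "c' = Seq c1 (While b c)" by auto
  then show ?case
  proof cases
    case 3
    then show ?thesis using While.IH[of c1] by (cases "c1 = Skip") auto
  qed (auto simp: conts_self)
qed auto

definition valid_act :: "nat \<Rightarrow> nat \<Rightarrow> (nat list \<Rightarrow> (nat \<times> int) list) \<Rightarrow> bool" where
  "valid_act k S f \<longleftrightarrow> (\<forall>ss. length ss = k \<and> (\<forall>s\<in>set ss. s < S) \<longrightarrow>
     length (f ss) = k \<and> (\<forall>(s, d) \<in> set (f ss). s < S \<and> d \<in> {-1, 0, 1}))"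

fun wf_com :: "nat \<Rightarrow> nat \<Rightarrow> com \<Rightarrow> bool" where
  "wf_com k S Skip \<longleftrightarrow> True"
| "wf_com k S (Act f) \<longleftrightarrow> valid_act k S f"
| "wf_com k S (Seq c d) \<longleftrightarrow> wf_com k S c \<and> wf_com k S d"
| "wf_com k S (Cond b c d) \<longleftrightarrow> wf_com k S c \<and> wf_com k S d"
| "wf_com k S (While b c) \<longleftrightarrow> wf_com k S c"

lemma wf_com_conts: "wf_com k S c \<Longrightarrow> conts c \<subseteq> {c'. wf_com k S c'}"
proof (induction c)
  case (Seq c d)
  then have "conts c \<subseteq> {c'. wf_com k S c'}" "conts d \<subseteq> {c'. wf_com k S c'}" "wf_com k S d"
    by simp_all
  then show ?case by auto
next
  case (Cond b c d)
  then have "conts c \<subseteq> {c'. wf_com k S c'}" "conts d \<subseteq> {c'. wf_com k S c'}" by simp_all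
  with Cond.prems show ?case by simp
next
  case (While b c)
  then have "conts c \<subseteq> {c'. wf_com k S c'}" by simp
  with While.prems show ?case by auto
qed simp_all

lemma valid_act_stay: "valid_act k S stay"
  by (auto simp: valid_act_def stay_def)

lemma wf_com_nxt: "wf_com k S c \<Longrightarrow> valid_act k S (\<lambda>ss. snd (nxt c ss))"
proof (induction c)
  case (Seq c d)
  have "(\<lambda>ss. snd (nxt (Seq c d) ss)) = (if c = Skip then stay else (\<lambda>ss. snd (nxt c ss)))"
    by (auto simp: fun_eq_iff)
  then show ?case using Seq by (simp add: valid_act_stay)
qed (simp_all add: valid_act_stay)

text \<open>The states are indices of the finitely many remaining programs. \<open>Skip\<close> gets
  no transition, so the machine halts when the program has ended.\<close>

lemma com_machine:
  assumes wf: "wf_com k S c" and k: "k \<ge> 1" and S: "S \<ge> 3"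
  obtains M where "wf_tm M" "deterministic M" "tm_tapes M = k"
    "\<And>ts b ts'. runs c ts b ts' \<Longrightarrow>
       \<exists>n q. n \<le> b \<and> (tm_step M ^^ n) (0, ts) (q, ts') \<and> tm_halted M (q, ts')"
proof -
  obtain xs where xs: "set xs = conts c" using finite_list[OF finite_conts] by blast
  \<comment> \<open>State 0 is the initial one, so the program itself is put at index 0. It occurs
    in \<open>xs\<close> as well, which is why \<open>st\<close> has to prefer index 0
    explicitly.\<close>
  define L where "L = c # xs"
  have setL: "set L = conts c" using xs conts_self by (auto simp: L_def)
  define st where "st c' = (if c' = c then 0 else SOME i. i < length L \<and> L ! i = c')" for c'
  have st: "st c' < length L \<and> L ! st c' = c'" if "c' \<in> conts c" for c'
  proof (cases "c' = c")
    case False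
    have "\<exists>i. i < length L \<and> L ! i = c'" using that setL by (metis in_set_conv_nth)
    from someI_ex[OF this] False show ?thesis by (simp add: st_def)
  qed (simp add: st_def L_def)
  define \<delta> where "\<delta> q ss = (if q < length L \<and> L ! q \<noteq> Skip
      then {(st (fst (nxt (L ! q) ss)), snd (nxt (L ! q) ss))} else {})" for q ss
  define M where "M = \<lparr>tm_tapes = k, tm_states = length L, tm_symbols = S, tm_accept = 0,
    tm_delta = \<delta>\<rparr>"
  have inL: "L ! q \<in> conts c" if "q < length L" for q using that setL nth_mem by blast
  have "wf_tm M"
    unfolding wf_tm_def
  proof (intro conjI allI impI)
    fix q ss
    assume A: "q < tm_states M \<and> length ss = tm_tapes M \<and> (\<forall>s\<in>set ss. s < tm_symbols M)"
    then have q: "q < length L" by (simp add: M_def)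
    have "valid_act k S (\<lambda>ss. snd (nxt (L ! q) ss))"
      using wf_com_nxt wf_com_conts[OF wf] inL[OF q] by blast
    moreover have "st (fst (nxt (L ! q) ss)) < length L"
      using st[OF conts_nxt[OF inL[OF q]]] by blast
    ultimately show "\<forall>(q', as)\<in>tm_delta M q ss. q' < tm_states M \<and> length as = tm_tapes M \<and>
         (\<forall>(s, d) \<in> set as. s < tm_symbols M \<and> d \<in> {-1, 0, 1})"
      using A by (auto simp: M_def \<delta>_def valid_act_def)
  qed (use k S in \<open>auto simp: M_def L_def\<close>)
  moreover have "deterministic M"
    by (auto simp: deterministic_def M_def \<delta>_def)
  moreover have "\<exists>n q. n \<le> b \<and> (tm_step M ^^ n) (0, ts) (q, ts') \<and> tm_halted M (q, ts')"
    if r: "runs c ts b ts'" for ts b ts'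
  proof -
    obtain n where n: "n \<le> b" "(com_step ^^ n) (c, ts) (Skip, ts')"
      using r unfolding runs_def by blast
    have *: "(com_step ^^ n) (c, ts) (c', ts') \<Longrightarrow>
      c' \<in> conts c \<and> (tm_step M ^^ n) (st c, ts) (st c', ts')" for n c' ts'
    proof (induction n arbitrary: c' ts')
      case 0
      then show ?case by (simp add: conts_self)
    next
      case (Suc n)
      then obtain c1 ts1 where 1: "(com_step ^^ n) (c, ts) (c1, ts1)"
        and s: "com_step (c1, ts1) (c', ts')"
        by (metis relpowp_Suc_E surj_pair)
      have IH: "c1 \<in> conts c" "(tm_step M ^^ n) (st c, ts) (st c1, ts1)"
        using Suc.IH[OF 1] by auto
      have "tm_step M (st c1, ts1) (st c', ts')"
        using s st[OF IH(1)] by (auto simp: com_step_def tm_step_def M_def \<delta>_def)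
      then show ?case
        using IH conts_nxt[OF IH(1)] s relpowp_Suc_I[OF IH(2)] by (auto simp: com_step_def)
    qed
    have "Skip \<in> conts c" "(tm_step M ^^ n) (0, ts) (st Skip, ts')"
      using *[OF n(2)] by (auto simp: st_def[of c])
    moreover have "tm_halted M (st Skip, ts')"
      using st[OF calculation(1)] by (auto simp: tm_halted_def tm_step_def M_def \<delta>_def)
    ultimately show ?thesis using n(1) by blast
  qed
  ultimately show ?thesis using that[of M] by (simp add: M_def)
qed

section \<open>Counter programs\<close>

text \<open>Tape 0 holds the input, the last tape the output, and the tapes in between are counters: the
  value of a counter is its head position, and cell 0 is marked.\<close>

type_synonym state = "(nat \<Rightarrow> nat) \<times> int \<times> bool list"

definition counter_tape :: "nat \<Rightarrow> tape" where
  "counter_tape v = ((\<lambda>i. if i = 0 then 1 else 0), int v)"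

definition out_tape :: "bool list \<Rightarrow> tape" where
  "out_tape ys = (word_contents ys, int (length ys))"

definition tapes :: "nat \<Rightarrow> bool list \<Rightarrow> state \<Rightarrow> tape list" where
  "tapes k x = (\<lambda>(R, h, ys).
     (word_contents x, h) # map (\<lambda>j. counter_tape (R j)) [0..<k] @ [out_tape ys])"

definition run :: "nat \<Rightarrow> bool list \<Rightarrow> com \<Rightarrow> state \<Rightarrow> nat \<Rightarrow> state \<Rightarrow> bool" where
  "run k x c s b s' \<longleftrightarrow> runs c (tapes k x s) b (tapes k x s')"

definition move :: "nat \<Rightarrow> int \<Rightarrow> com" where
  "move i d = Act (\<lambda>ss. (stay ss)[i := (ss ! i, d)])"

definition InR :: com where "InR = move 0 1"
definition InL :: com where "InL = move 0 (-1)"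
definition Inc :: "nat \<Rightarrow> com" where "Inc j = move (Suc j) 1"
definition Dec :: "nat \<Rightarrow> com" where "Dec j = move (Suc j) (-1)"

definition Out :: "bool \<Rightarrow> com" where
  "Out b = Act (\<lambda>ss. (stay ss)[length ss - 1 := (if b then 2 else 1, 1)])"

definition pos :: "nat \<Rightarrow> nat list \<Rightarrow> bool" where "pos j ss \<longleftrightarrow> ss ! Suc j = 0"
text \<open>The counter is decremented before the body, so the body sees the values from one below
  the initial value down to 0.\<close>

definition loop :: "nat \<Rightarrow> com \<Rightarrow> com" where "loop j c = While (pos j) (Seq (Dec j) c)"

lemma valid_act_upd:
  assumes "\<And>ss. length ss = k \<Longrightarrow> \<forall>s\<in>set ss. s < 3 \<Longrightarrow> i ss < k \<Longrightarrow>
    fst (a ss) < 3 \<and> snd (a ss) \<in> {-1, 0, 1}"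
  shows "valid_act k 3 (\<lambda>ss. (stay ss)[i ss := a ss])"
  unfolding valid_act_def
proof (intro allI impI conjI)
  fix ss :: "nat list"
  assume ss: "length ss = k \<and> (\<forall>s\<in>set ss. s < 3)"
  show "length ((stay ss)[i ss := a ss]) = k" using ss by (simp add: stay_def)
  have st: "\<forall>(s, d)\<in>set (stay ss). s < 3 \<and> d \<in> {-1, 0, 1}" using ss by (auto simp: stay_def)
  show "\<forall>(s, d)\<in>set ((stay ss)[i ss := a ss]). s < 3 \<and> d \<in> {-1, 0, 1}"
  proof (cases "i ss < k")
    case True
    with assms ss have "fst (a ss) < 3 \<and> snd (a ss) \<in> {-1, 0, 1}" by blast
    moreover have "set ((stay ss)[i ss := a ss]) \<subseteq> insert (a ss) (set (stay ss))"
      by (rule set_update_subset_insert)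
    ultimately show ?thesis using st by (cases "a ss") (auto dest!: subsetD)
  next
    case False
    then have "(stay ss)[i ss := a ss] = stay ss" using ss by (simp add: stay_def list_update_beyond)
    then show ?thesis using st by simp
  qed
qed

lemma wf_move: "d \<in> {-1, 0, 1} \<Longrightarrow> wf_com k 3 (move i d)"
  unfolding move_def wf_com.simps by (rule valid_act_upd) auto

lemma wf_Out: "wf_com k 3 (Out b)"
  unfolding Out_def wf_com.simps by (rule valid_act_upd) auto

lemma wf_basic [simp]:
  "wf_com k 3 InR" "wf_com k 3 InL" "wf_com k 3 (Inc j)" "wf_com k 3 (Dec j)" "wf_com k 3 (Out b)"
  "wf_com k 3 (loop j c) \<longleftrightarrow> wf_com k 3 c"
  by (simp_all add: InR_def InL_def Inc_def Dec_def wf_move wf_Out loop_def)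

lemma upd_act:
  "i < length ts \<Longrightarrow>
   map2 tape_act ((stay (map tape_read ts))[i := a]) ts = ts[i := tape_act a (ts ! i)]"
  by (rule nth_equalityI)
    (auto simp: stay_def tape_act_def tape_read_def nth_list_update prod_eq_iff)

lemma length_tapes [simp]: "length (tapes k x s) = k + 2"
  by (auto simp: tapes_def split: prod.split)

lemma tapes_nth:
  "tapes k x (R, h, ys) ! 0 = (word_contents x, h)"
  "j < k \<Longrightarrow> tapes k x (R, h, ys) ! Suc j = counter_tape (R j)"
  "tapes k x (R, h, ys) ! Suc k = out_tape ys"
  by (auto simp: tapes_def nth_append)

lemma tapes_eqI:
  assumes "length ts = k + 2" "ts ! 0 = (word_contents x, h)"
    "\<And>j. j < k \<Longrightarrow> ts ! Suc j = counter_tape (R j)" "ts ! Suc k = out_tape ys"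
  shows "ts = tapes k x (R, h, ys)"
proof (rule nth_equalityI)
  fix i assume "i < length ts"
  then consider "i = 0" | j where "i = Suc j" "j < k" | "i = Suc k"
    using assms(1) by (cases i) fastforce+
  then show "ts ! i = tapes k x (R, h, ys) ! i"
    by cases (use assms in \<open>simp_all add: tapes_nth\<close>)
qed (use assms in simp)

lemma move_0:
  assumes "s' = (R, h + d, ys)" shows "run k x (move 0 d) (R, h, ys) 1 s'"
proof -
  have "map2 tape_act ((stay ss)[0 := (ss ! 0, d)]) (tapes k x (R, h, ys)) = tapes k x (R, h + d, ys)"
    if "ss = map tape_read (tapes k x (R, h, ys))" for ss
    unfolding that
    by (subst upd_act)
      (auto intro!: tapes_eqI simp: tapes_nth tape_act_def tape_read_def)
  then show ?thesis
    using runs_Act[of "\<lambda>ss. (stay ss)[0 := (ss ! 0, d)]" "tapes k x (R, h, ys)"] assms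
    by (simp add: run_def move_def)
qed

lemma move_Suc:
  assumes "j < k" "int v = int (R j) + d" "s' = (R(j := v), h, ys)"
  shows "run k x (move (Suc j) d) (R, h, ys) 1 s'"
proof -
  have "map2 tape_act ((stay ss)[Suc j := (ss ! Suc j, d)]) (tapes k x (R, h, ys))
      = tapes k x (R(j := v), h, ys)"
    if "ss = map tape_read (tapes k x (R, h, ys))" for ss
    unfolding that
    by (subst upd_act)
      (use assms in \<open>auto intro!: tapes_eqI ext
        simp: tapes_nth tape_act_def tape_read_def counter_tape_def nth_list_update\<close>)
  then show ?thesis
    using runs_Act[of "\<lambda>ss. (stay ss)[Suc j := (ss ! Suc j, d)]" "tapes k x (R, h, ys)"] assms
    by (simp add: run_def move_def)
qed

lemma run_InR: "s' = (R, h + 1, ys) \<Longrightarrow> run k x InR (R, h, ys) 1 s'"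
  unfolding InR_def by (rule move_0)

lemma run_InL: "s' = (R, h - 1, ys) \<Longrightarrow> run k x InL (R, h, ys) 1 s'"
  unfolding InL_def by (rule move_0) simp

lemma run_Inc: "j < k \<Longrightarrow> s' = (R(j := Suc (R j)), h, ys) \<Longrightarrow> run k x (Inc j) (R, h, ys) 1 s'"
  unfolding Inc_def by (rule move_Suc) auto

lemma run_Dec:
  "j < k \<Longrightarrow> R j = Suc v \<Longrightarrow> s' = (R(j := v), h, ys) \<Longrightarrow> run k x (Dec j) (R, h, ys) 1 s'"
  unfolding Dec_def by (rule move_Suc) auto

lemma word_contents_snoc:
  "word_contents (ys @ [b]) = (word_contents ys)(int (length ys) := (if b then 2 else 1))"
  by (rule ext) (auto simp: word_contents_def nth_append nat_less_iff)

lemma run_Out: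
  assumes "s' = (R, h, ys @ [b])" shows "run k x (Out b) (R, h, ys) 1 s'"
proof -
  have "map2 tape_act ((stay (map tape_read (tapes k x (R, h, ys))))[Suc k := (if b then 2 else 1, 1)])
      (tapes k x (R, h, ys)) = tapes k x (R, h, ys @ [b])"
    by (subst upd_act) (auto intro!: tapes_eqI
        simp: tapes_nth tape_act_def out_tape_def word_contents_snoc nth_list_update)
  then show ?thesis
    using runs_Act[of "\<lambda>ss. (stay ss)[length ss - 1 := (if b then 2 else 1, 1)]" "tapes k x (R, h, ys)"]
      assms
    by (simp add: run_def Out_def)
qed

lemma run_mono: "run k x c s a s' \<Longrightarrow> a \<le> b \<Longrightarrow> run k x c s b s'"
  unfolding run_def by (rule runs_mono)

lemma run_Skip: "run k x Skip s b s"
  unfolding run_def by (rule runs_Skip)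

lemma run_Seq:
  "run k x c s a s1 \<Longrightarrow> run k x d s1 b s' \<Longrightarrow> a + b + 1 \<le> n \<Longrightarrow> run k x (Seq c d) s n s'"
  unfolding run_def by (meson runs_Seq runs_mono)

lemma pos_tapes: "j < k \<Longrightarrow> pos j (map tape_read (tapes k x (R, h, ys))) \<longleftrightarrow> R j \<noteq> 0"
  by (simp add: pos_def tapes_nth tape_read_def counter_tape_def)

lemma run_Cond_pos:
  assumes "j < k" "run k x (if R j \<noteq> 0 then c else d) (R, h, ys) a s'" "Suc a \<le> b"
  shows "run k x (Cond (pos j) c d) (R, h, ys) b s'"
  using runs_Cond[of "pos j" "tapes k x (R, h, ys)" c d a "tapes k x s'"] assms
  by (auto simp: run_def pos_tapes intro: runs_mono)

text \<open>Here \<open>st v\<close> is the state in which counter \<open>j\<close> has value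
  \<open>v\<close>. Each round costs 4 steps besides the body: the test, the decrement, and dropping
  two finished components of \<open>Seq\<close>.\<close>

lemma run_loop:
  assumes j: "j < k"
    and body: "\<And>v. v < L \<Longrightarrow> run k x c ((fst (st (Suc v)))(j := v), snd (st (Suc v))) m (st v)"
    and val: "\<And>v. v \<le> L \<Longrightarrow> fst (st v) j = v"
    and s: "s = st L" "s' = st 0" and n: "L * (m + 4) + 1 \<le> n"
  shows "run k x (loop j c) s n s'"
proof -
  have "runs (While (pos j) (Seq (Dec j) c)) (tapes k x (st L)) (L * ((m + 2) + 2) + 1) (tapes k x (st 0))"
  proof (rule runs_While_count)
    fix v assume v: "v < L"
    obtain R h ys where s: "st (Suc v) = (R, h, ys)" by (metis surj_pair)
    have R: "R j = Suc v" using val[of "Suc v"] v s by simp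
    show "pos j (map tape_read (tapes k x (st (Suc v))))" using R j by (simp add: s pos_tapes)
    have "run k x (Dec j) (st (Suc v)) 1 ((fst (st (Suc v)))(j := v), snd (st (Suc v)))"
      unfolding s using R j by (intro run_Dec) auto
    from run_Seq[OF this body[OF v], of "m + 2"]
    show "runs (Seq (Dec j) c) (tapes k x (st (Suc v))) (m + 2) (tapes k x (st v))"
      by (simp add: run_def)
  next
    obtain R h ys where s: "st 0 = (R, h, ys)" by (metis surj_pair)
    show "\<not> pos j (map tape_read (tapes k x (st 0)))"
      using val[of 0] j by (simp add: s pos_tapes)
  qed
  then show ?thesis using n unfolding run_def loop_def s
    by (elim runs_mono) (simp add: algebra_simps)
qed

section \<open>Arithmetic expressions\<close>

datatype expr = Var nat | Const nat | Plus expr expr | Mult expr expr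

fun val :: "expr \<Rightarrow> (nat \<Rightarrow> nat) \<Rightarrow> nat" where
  "val (Var i) R = R i"
| "val (Const c) R = c"
| "val (Plus a b) R = val a R + val b R"
| "val (Mult a b) R = val a R * val b R"

fun below :: "nat \<Rightarrow> expr \<Rightarrow> bool" where
  "below n (Var i) \<longleftrightarrow> i < n"
| "below n (Const c) \<longleftrightarrow> True"
| "below n (Plus a b) \<longleftrightarrow> below n a \<and> below n b"
| "below n (Mult a b) \<longleftrightarrow> below n a \<and> below n b"

lemma val_cong: "below n e \<Longrightarrow> (\<And>i. i < n \<Longrightarrow> R i = R' i) \<Longrightarrow> val e R = val e R'"
  by (induction e) auto

lemma below_mono: "below m e \<Longrightarrow> m \<le> n \<Longrightarrow> below n e"
  by (induction e) auto

lemma val_bound: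
  assumes "below m e"
  shows "\<exists>P. \<forall>R B. (\<forall>j<m. R j \<le> B) \<longrightarrow> val e R \<le> poly P B"
  using assms
proof (induction e)
  case (Var i)
  then show ?case by (intro exI[of _ "[:0, 1:]"]) auto
next
  case (Const c)
  then show ?case by (intro exI[of _ "[:c:]"]) auto
next
  case (Plus a b)
  then obtain P Q where "\<forall>R B. (\<forall>j<m. R j \<le> B) \<longrightarrow> val a R \<le> poly P B"
    "\<forall>R B. (\<forall>j<m. R j \<le> B) \<longrightarrow> val b R \<le> poly Q B" by auto
  then show ?case by (intro exI[of _ "P + Q"]) (simp add: add_mono)
next
  case (Mult a b)
  then obtain P Q where "\<forall>R B. (\<forall>j<m. R j \<le> B) \<longrightarrow> val a R \<le> poly P B"
    "\<forall>R B. (\<forall>j<m. R j \<le> B) \<longrightarrow> val b R \<le> poly Q B" by auto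
  then show ?case by (intro exI[of _ "P * Q"]) (simp add: mult_le_mono)
qed

text \<open>The counters from \<open>m\<close> on are scratch space and have to be zero.\<close>

fun addc :: "expr \<Rightarrow> nat \<Rightarrow> nat \<Rightarrow> com" where
  "addc (Var i) r m = Seq (loop i (Seq (Inc r) (Inc m))) (loop m (Inc i))"
| "addc (Const c) r m = (Seq (Inc r) ^^ c) Skip"
| "addc (Plus a b) r m = Seq (addc a r m) (addc b r m)"
| "addc (Mult a b) r m = Seq (addc a m (Suc m)) (loop m (addc b r (Suc m)))"

lemma wf_addc [simp]: "wf_com k 3 (addc e r m)"
proof (induction e r m rule: addc.induct)
  case (2 c r m)
  show ?case by (induction c) auto
qed auto

text \<open>The number of tapes is fixed only when a whole generator has been compiled, so
  \<open>k\<close> is a parameter and the same \<open>P\<close> has to serve all large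
  \<open>k\<close>. \<open>B\<close> bounds the variables of the expression only; the target
  \<open>r\<close> may already hold a larger value.\<close>

definition adds :: "nat \<Rightarrow> expr \<Rightarrow> nat \<Rightarrow> nat \<Rightarrow> nat poly \<Rightarrow> nat \<Rightarrow> bool" where
  "adds n e r m P k \<longleftrightarrow> (\<forall>x R h ys B. (\<forall>j<n. R j \<le> B) \<longrightarrow> (\<forall>j\<ge>m. R j = 0) \<longrightarrow>
     run k x (addc e r m) (R, h, ys) (poly P B) (R(r := R r + val e R), h, ys))"

lemma addsI:
  "(\<And>x R h ys B. \<forall>j<n. R j \<le> B \<Longrightarrow> \<forall>j\<ge>m. R j = 0 \<Longrightarrow>
     run k x (addc e r m) (R, h, ys) (poly P B) (R(r := R r + val e R), h, ys)) \<Longrightarrow> adds n e r m P k"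
  unfolding adds_def by blast

lemma addsD:
  "adds n e r m P k \<Longrightarrow> \<forall>j<n. R j \<le> B \<Longrightarrow> \<forall>j\<ge>m. R j = 0 \<Longrightarrow>
     run k x (addc e r m) (R, h, ys) (poly P B) (R(r := R r + val e R), h, ys)"
  unfolding adds_def by blast

text \<open>The variables lie below \<open>n\<close>, whereas target and scratch counters do not, so
  a partial result never alters an operand.\<close>

lemma run_addc:
  assumes "below n e" "n \<le> r" "r < m"
  shows "\<exists>k0 P. \<forall>k\<ge>k0. adds n e r m P k"
  using assms
proof (induction e arbitrary: r m)
  case (Var i)
  show ?case
  proof (intro exI[of _ "Suc m"] exI[of _ "[:3, 12:]"] allI impI addsI)
    fix k x and R :: "nat \<Rightarrow> nat" and h ys B
    assume k: "Suc m \<le> k" and A: "\<forall>j<n. R j \<le> B" "\<forall>j\<ge>m. R j = 0"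
    have ne: "i < n" "i \<noteq> r" "i \<noteq> m" "r \<noteq> m" "i < k" "r < k" "m < k"
      using Var k by auto
    let ?L = "R i"
    \<comment> \<open>Reading a counter destroys it: it is emptied into the target and into the
      scratch counter \<open>m\<close>, and then restored from \<open>m\<close>.\<close>
    have 1: "run k x (loop i (Seq (Inc r) (Inc m))) (R, h, ys) (?L * 7 + 1)
      (R(i := 0, r := R r + ?L, m := ?L), h, ys)"
      by (rule run_loop[where st = "\<lambda>v. (R(i := v, r := R r + (?L - v), m := ?L - v), h, ys)"
            and L = ?L and m = 3])
        (use ne A in \<open>auto intro!: run_Seq[OF run_Inc[OF _ refl] run_Inc] simp: fun_eq_iff Suc_diff_Suc\<close>)
    have 2: "run k x (loop m (Inc i)) (R(i := 0, r := R r + ?L, m := ?L), h, ys) (?L * 5 + 1)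
      (R(r := R r + ?L), h, ys)"
      by (rule run_loop[where st = "\<lambda>v. (R(i := ?L - v, r := R r + ?L, m := v), h, ys)"
            and L = ?L and m = 1])
        (use ne A in \<open>auto intro!: run_Inc[unfolded One_nat_def] simp: fun_eq_iff\<close>)
    have "?L \<le> B" using A ne by auto
    then show "run k x (addc (Var i) r m) (R, h, ys) (poly [:3, 12:] B) (R(r := R r + val (Var i) R), h, ys)"
      using run_Seq[OF 1 2, of "poly [:3, 12:] B"] by simp
  qed
next
  case (Const c)
  show ?case
  proof (intro exI[of _ "Suc m"] exI[of _ "[:2 * c:]"] allI impI addsI)
    fix k x and R :: "nat \<Rightarrow> nat" and h ys B
    assume k: "Suc m \<le> k" and A: "\<forall>j<n. R j \<le> B" "\<forall>j\<ge>m. R j = 0"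
    have "run k x ((Seq (Inc r) ^^ c) Skip) (R, h, ys) (2 * c) (R(r := R r + c), h, ys)" for R :: "nat \<Rightarrow> nat"
    proof (induction c arbitrary: R)
      case 0
      then show ?case by (simp add: run_Skip)
    next
      case (Suc c)
      have *: "run k x ((Seq (Inc r) ^^ c) Skip) (R(r := Suc (R r)), h, ys) (2 * c)
          (R(r := R r + Suc c), h, ys)"
        using Suc[of "R(r := Suc (R r))"] by (simp add: fun_upd_def cong: if_cong)
      show ?case
        unfolding funpow.simps o_apply
        by (rule run_Seq[OF run_Inc[OF _ refl] *]) (use k Const in auto)
    qed
    then show "run k x (addc (Const c) r m) (R, h, ys) (poly [:2 * c:] B)
        (R(r := R r + val (Const c) R), h, ys)" by simp
  qed
next
  case (Plus a b)
  then obtain k1 P where 1: "\<And>k. k \<ge> k1 \<Longrightarrow> adds n a r m P k"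
    by (metis below.simps(3))
  from Plus obtain k2 Q where 2: "\<And>k. k \<ge> k2 \<Longrightarrow> adds n b r m Q k"
    by (metis below.simps(3))
  show ?case
  proof (intro exI[of _ "max k1 k2"] exI[of _ "P + Q + [:1:]"] allI impI addsI)
    fix k x and R :: "nat \<Rightarrow> nat" and h ys B
    assume k: "max k1 k2 \<le> k" and A: "\<forall>j<n. R j \<le> B" "\<forall>j\<ge>m. R j = 0"
    let ?R = "R(r := R r + val a R)"
    have b: "val b ?R = val b R" by (rule val_cong[of n]) (use Plus in auto)
    have A': "\<forall>j<n. ?R j \<le> B" "\<forall>j\<ge>m. ?R j = 0" using A Plus.prems by auto
    have "run k x (addc a r m) (R, h, ys) (poly P B) (?R, h, ys)" using addsD[OF 1 A] k by simp
    moreover have "run k x (addc b r m) (?R, h, ys) (poly Q B) (?R(r := ?R r + val b R), h, ys)"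
      by (rule addsD[OF 2 A', unfolded b]) (use k in simp)
    ultimately have "run k x (Seq (addc a r m) (addc b r m)) (R, h, ys) (poly (P + Q + [:1:]) B)
      (?R(r := ?R r + val b R), h, ys)"
      by (rule run_Seq) simp
    then show "run k x (addc (Plus a b) r m) (R, h, ys) (poly (P + Q + [:1:]) B)
        (R(r := R r + val (Plus a b) R), h, ys)" by (simp add: add.assoc)
  qed
next
  case (Mult a b)
  obtain k1 P where 1: "\<And>k. k \<ge> k1 \<Longrightarrow> adds n a m (Suc m) P k"
    using Mult.IH(1)[of m "Suc m"] Mult.prems by auto
  obtain k2 Q where 2: "\<And>k. k \<ge> k2 \<Longrightarrow> adds n b r (Suc m) Q k"
    using Mult.IH(2)[of r "Suc m"] Mult.prems by auto
  obtain V where V: "\<And>R B. (\<forall>j<n. R j \<le> B) \<Longrightarrow> val a R \<le> poly V B"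
    using val_bound[of n a] Mult.prems by auto
  \<comment> \<open>The first factor is computed in \<open>m\<close>; the second one is evaluated
    afresh in each of the at most \<open>poly V B\<close> rounds.\<close>
  let ?T = "P + V * (Q + [:4:]) + [:2:]"
  show ?case
  proof (intro exI[of _ "max (Suc m) (max k1 k2)"] exI[of _ ?T] allI impI addsI)
    fix k x and R :: "nat \<Rightarrow> nat" and h ys B
    assume k: "max (Suc m) (max k1 k2) \<le> k" and A: "\<forall>j<n. R j \<le> B" "\<forall>j\<ge>m. R j = 0"
    let ?L = "val a R"
    have "run k x (addc a m (Suc m)) (R, h, ys) (poly P B) (R(m := ?L), h, ys)"
      using addsD[OF 1 A(1), of k x h ys] k A by simp
    moreover have "run k x (loop m (addc b r (Suc m))) (R(m := ?L), h, ys)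
      (?L * (poly Q B + 4) + 1) (R(r := R r + ?L * val b R), h, ys)"
    proof (rule run_loop[where st = "\<lambda>v. (R(m := v, r := R r + (?L - v) * val b R), h, ys)"
            and L = ?L and m = "poly Q B"])
      fix v assume v: "v < ?L"
      let ?R = "R(m := v, r := R r + (?L - Suc v) * val b R)"
      have b: "val b ?R = val b R" by (rule val_cong[of n]) (use Mult.prems in auto)
      have A': "\<forall>j<n. ?R j \<le> B" "\<forall>j\<ge>Suc m. ?R j = 0" using A Mult.prems by auto
      have e: "R r + (?L - Suc v) * val b R + val b R = R r + (?L - v) * val b R"
        using v Suc_diff_Suc[OF v] by (metis add.assoc add.commute mult_Suc)
      have R: "?R(r := ?R r + val b ?R) = R(m := v, r := R r + (?L - v) * val b R)"
        unfolding b using e by (simp add: fun_eq_iff)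
      have "run k x (addc b r (Suc m)) (?R, h, ys) (poly Q B)
          (R(m := v, r := R r + (?L - v) * val b R), h, ys)"
        by (rule addsD[OF 2 A', unfolded R]) (use k in simp)
      moreover have "R(m := Suc v, r := R r + (?L - Suc v) * val b R, m := v) = ?R"
        using Mult.prems by (simp add: fun_eq_iff)
      ultimately show "run k x (addc b r (Suc m))
         ((fst (R(m := Suc v, r := R r + (val a R - Suc v) * val b R), h, ys))(m := v),
          snd (R(m := Suc v, r := R r + (val a R - Suc v) * val b R), h, ys))
         (poly Q B) (R(m := v, r := R r + (val a R - v) * val b R), h, ys)"
        by simp
    qed (use k A Mult.prems in \<open>auto simp: fun_eq_iff\<close>)
    ultimately show "run k x (addc (Mult a b) r m) (R, h, ys) (poly ?T B)
        (R(r := R r + val (Mult a b) R), h, ys)"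
      unfolding addc.simps val.simps
      by (rule run_Seq) (use V[OF A(1)] in simp)
  qed
qed

section \<open>Binary numerals\<close>

text \<open>While \<open>m\<close> is emptied, \<open>m + 2\<close> alternates between 0 and 1, and
  \<open>m + 1\<close> goes up in every second round. They end as the remainder and the quotient by
  2.\<close>

definition halve :: "nat \<Rightarrow> com" where
  "halve m = loop m (Cond (pos (m + 2)) (Seq (Dec (m + 2)) (Inc (m + 1))) (Inc (m + 2)))"

definition out_bit :: "nat \<Rightarrow> com" where
  "out_bit m = Seq (Cond (pos (m + 2)) (Seq (Dec (m + 2)) (Out True)) (Out False))
     (loop (m + 1) (Inc m))"

definition numc :: "nat \<Rightarrow> com" where
  "numc m = Seq (While (pos m) (Seq (Out True) (Seq (halve m) (out_bit m)))) (Out False)"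

lemma wf_numc [simp]: "wf_com k 3 (numc m)"
  by (simp add: numc_def halve_def out_bit_def)

lemma run_While_False_pos:
  "j < k \<Longrightarrow> R j = 0 \<Longrightarrow> run k x (While (pos j) c) (R, h, ys) 1 (R, h, ys)"
  unfolding run_def by (rule runs_While_False) (simp add: pos_tapes)

lemma run_While_True_pos:
  assumes "j < k" "R j > 0" "run k x c (R, h, ys) a s" "run k x (While (pos j) c) s b s'"
    "a + b + 2 \<le> n"
  shows "run k x (While (pos j) c) (R, h, ys) n s'"
  using runs_While_True[of "pos j" "tapes k x (R, h, ys)" c a "tapes k x s" b "tapes k x s'"] assms
  unfolding run_def by (auto simp: pos_tapes intro: runs_mono)

lemma run_halve:
  assumes "m + 2 < k" "R (m + 1) = 0" "R (m + 2) = 0" "R m = v"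
  shows "run k x (halve m) (R, h, ys) (v * 8 + 1) (R(m := 0, m + 1 := v div 2, m + 2 := v mod 2), h, ys)"
  unfolding halve_def
proof (rule run_loop[where m = 4 and L = v
      and st = "\<lambda>u. (R(m := u, m + 1 := (v - u) div 2, m + 2 := (v - u) mod 2), h, ys)"])
  fix u assume u: "u < v"
  let ?w = "v - Suc u"
  let ?R = "R(m := u, m + 1 := ?w div 2, m + 2 := ?w mod 2)"
  have w: "v - u = Suc ?w" using u by simp
  have "run k x (Cond (pos (m + 2)) (Seq (Dec (m + 2)) (Inc (m + 1))) (Inc (m + 2))) (?R, h, ys) 4
      (R(m := u, m + 1 := (v - u) div 2, m + 2 := (v - u) mod 2), h, ys)"
  proof (cases "even ?w")
    case True
    then have 0: "?w mod 2 = 0" "Suc ?w div 2 = ?w div 2" "Suc ?w mod 2 = 1"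
      by presburger+
    have "run k x (Inc (m + 2)) (?R, h, ys) 1 (R(m := u, m + 1 := (v - u) div 2, m + 2 := (v - u) mod 2), h, ys)"
      by (rule run_Inc) (use assms 0 w in \<open>simp_all add: fun_eq_iff\<close>)
    then show ?thesis
      by (intro run_Cond_pos[where a = 1]) (use assms 0 in simp_all)
  next
    case False
    then have 0: "?w mod 2 = 1" "Suc ?w div 2 = Suc (?w div 2)" "Suc ?w mod 2 = 0"
      by presburger+
    have "run k x (Dec (m + 2)) (?R, h, ys) 1 (?R(m + 2 := 0), h, ys)"
      by (rule run_Dec) (use assms 0 in simp_all)
    moreover have "run k x (Inc (m + 1)) (?R(m + 2 := 0), h, ys) 1
      (R(m := u, m + 1 := (v - u) div 2, m + 2 := (v - u) mod 2), h, ys)"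
      by (rule run_Inc) (use assms 0 w in \<open>simp_all add: fun_eq_iff\<close>)
    ultimately have "run k x (Seq (Dec (m + 2)) (Inc (m + 1))) (?R, h, ys) 3
      (R(m := u, m + 1 := (v - u) div 2, m + 2 := (v - u) mod 2), h, ys)"
      by (rule run_Seq) simp
    then show ?thesis
      by (intro run_Cond_pos[where a = 3]) (use assms 0 in simp_all)
  qed
  moreover have "(R(m := Suc u, m + 1 := ?w div 2, m + 2 := ?w mod 2))(m := u) = ?R"
    by (simp add: fun_eq_iff)
  ultimately show "run k x (Cond (pos (m + 2)) (Seq (Dec (m + 2)) (Inc (m + 1))) (Inc (m + 2)))
    ((fst (R(m := Suc u, m + 1 := (v - Suc u) div 2, m + 2 := (v - Suc u) mod 2), h, ys))(m := u),
     snd (R(m := Suc u, m + 1 := (v - Suc u) div 2, m + 2 := (v - Suc u) mod 2), h, ys)) 4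
    (R(m := u, m + 1 := (v - u) div 2, m + 2 := (v - u) mod 2), h, ys)"
    by simp
qed (use assms in \<open>auto simp: fun_eq_iff\<close>)

lemma run_out_bit:
  assumes "m + 2 < k" "R (m + 1) = 0" "R (m + 2) = 0"
  shows "run k x (out_bit m) (R(m := 0, m + 1 := w, m + 2 := of_bool b), h, ys) (w * 5 + 6)
    (R(m := w), h, ys @ [b])"
proof -
  let ?R = "R(m := 0, m + 1 := w, m + 2 := of_bool b)"
  let ?R' = "R(m := 0, m + 1 := w)"
  have 1: "run k x (Cond (pos (m + 2)) (Seq (Dec (m + 2)) (Out True)) (Out False)) (?R, h, ys) 4
    (?R', h, ys @ [b])"
  proof (cases b)
    case True
    have "run k x (Dec (m + 2)) (?R, h, ys) 1 (?R', h, ys)"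
      by (rule run_Dec) (use assms True in \<open>simp_all add: fun_eq_iff\<close>)
    moreover have "run k x (Out True) (?R', h, ys) 1 (?R', h, ys @ [b])"
      by (rule run_Out) (use True in simp)
    ultimately have "run k x (Seq (Dec (m + 2)) (Out True)) (?R, h, ys) 3 (?R', h, ys @ [b])"
      by (rule run_Seq) simp
    then show ?thesis
      by (intro run_Cond_pos[where a = 3]) (use assms True in simp_all)
  next
    case False
    have "?R = ?R'" using False assms by (simp add: fun_eq_iff)
    then have "run k x (Out False) (?R, h, ys) 1 (?R', h, ys @ [b])"
      by (intro run_Out) (use False in simp)
    then show ?thesis
      by (intro run_Cond_pos[where a = 1]) (use assms False in simp_all)
  qed
  have 2: "run k x (loop (m + 1) (Inc m)) (?R', h, ys @ [b]) (w * 5 + 1) (R(m := w), h, ys @ [b])"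
    by (rule run_loop[where st = "\<lambda>u. (R(m := w - u, m + 1 := u), h, ys @ [b])" and L = w and m = 1])
      (use assms in \<open>auto intro!: run_Inc[unfolded One_nat_def] simp: fun_eq_iff\<close>)
  show ?thesis unfolding out_bit_def by (rule run_Seq[OF 1 2]) simp
qed

lemma enc_nat_0: "enc_nat 0 = [False]"
  by (simp add: enc_nat_def bits_of_nat.simps)

lemma enc_nat_pos: "v > 0 \<Longrightarrow> enc_nat v = True # odd v # enc_nat (v div 2)"
  by (simp add: enc_nat_def bits_of_nat.simps[of v])

lemma run_numc:
  assumes m: "m + 2 < k" and 0: "\<forall>j\<ge>m. R j = 0"
  shows "run k x (numc m) (R(m := v), h, ys) (v * (13 * v + 14) + 3) (R, h, ys @ enc_nat v)"
proof -
  let ?B = "Seq (Out True) (Seq (halve m) (out_bit m))"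
  have R: "R(m := 0) = R" using 0 by (simp add: fun_eq_iff)
  \<comment> \<open>The loop writes the code without its final \<open>False\<close>. Each round is
    charged \<open>13 * v + 14\<close> steps, with the original \<open>v\<close>; \<open>u\<close>
    rounds are enough because \<open>Suc (u div 2) \<le> u\<close> for positive
    \<open>u\<close>.\<close>
  have "\<exists>zs. enc_nat u = zs @ [False] \<and>
      run k x (While (pos m) ?B) (R(m := u), h, ys) (u * (13 * v + 14) + 1) (R, h, ys @ zs)"
    if "u \<le> v" for u
    using that
  proof (induction u arbitrary: ys rule: less_induct)
    case (less u)
    show ?case
    proof (cases "u = 0")
      case True
      then show ?thesis
        using run_While_False_pos[of m k R x ?B h ys] m 0 R by (simp add: enc_nat_0)
    next
      case False
      then have "u div 2 < u" "u div 2 \<le> v" using less.prems by auto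
      from less.IH[OF this, of "(ys @ [True]) @ [odd u]"]
      obtain zs where zs: "enc_nat (u div 2) = zs @ [False]"
        and IH: "run k x (While (pos m) ?B) (R(m := u div 2), h, (ys @ [True]) @ [odd u])
          ((u div 2) * (13 * v + 14) + 1) (R, h, ((ys @ [True]) @ [odd u]) @ zs)"
        by blast
      have 1: "run k x (Out True) (R(m := u), h, ys) 1 (R(m := u), h, ys @ [True])"
        by (rule run_Out) simp
      have e: "of_bool (odd u) = u mod 2" by (simp add: mod2_eq_if)
      have 2: "run k x (halve m) (R(m := u), h, ys @ [True]) (u * 8 + 1)
          (R(m := 0, m + 1 := u div 2, m + 2 := of_bool (odd u)), h, ys @ [True])"
        using run_halve[of m k "R(m := u)" u x h "ys @ [True]"] m 0 unfolding e by simp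
      have 3: "run k x (out_bit m) (R(m := 0, m + 1 := u div 2, m + 2 := of_bool (odd u)), h, ys @ [True])
          ((u div 2) * 5 + 6) (R(m := u div 2), h, (ys @ [True]) @ [odd u])"
        by (rule run_out_bit) (use m 0 in auto)
      have b: "run k x ?B (R(m := u), h, ys) (13 * v + 10) (R(m := u div 2), h, (ys @ [True]) @ [odd u])"
        by (rule run_Seq[OF 1 run_Seq[OF 2 3 order.refl]]) (use less.prems in linarith)
      have "Suc (u div 2) \<le> u" using False by linarith
      then have "Suc (u div 2) * (13 * v + 14) \<le> u * (13 * v + 14)" by (rule mult_le_mono1)
      then have "run k x (While (pos m) ?B) (R(m := u), h, ys) (u * (13 * v + 14) + 1)
          (R, h, ((ys @ [True]) @ [odd u]) @ zs)"
        by (intro run_While_True_pos[OF _ _ b IH]) (use m False in auto)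
      then have "run k x (While (pos m) ?B) (R(m := u), h, ys) (u * (13 * v + 14) + 1)
          (R, h, ys @ (True # odd u # zs))"
        by (simp only: append_assoc append_Cons append_Nil)
      moreover have "enc_nat u = (True # odd u # zs) @ [False]" using zs False by (simp add: enc_nat_pos)
      ultimately show ?thesis by blast
    qed
  qed
  then obtain zs where zs: "enc_nat v = zs @ [False]"
    and r: "run k x (While (pos m) ?B) (R(m := v), h, ys) (v * (13 * v + 14) + 1) (R, h, ys @ zs)"
    by blast
  have "run k x (Out False) (R, h, ys @ zs) 1 (R, h, ys @ enc_nat v)"
    by (rule run_Out) (simp add: zs)
  from run_Seq[OF r this] show ?thesis unfolding numc_def by simp
qed

section \<open>Generating words\<close>

text \<open>The iteration \<open>For e g\<close> at level \<open>m\<close> runs variable \<open>m\<close> downwards from the value of \<open>e\<close>, so that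
  it can serve as its own loop counter; \<open>ForIn g0 g1\<close> runs variable \<open>m\<close> upwards through the input
  positions and generates \<open>g0\<close> or \<open>g1\<close>, depending on the bit. Variable 0 is the length of the input.\<close>

datatype gen = Str "bool list" | Cat gen gen | Num expr | For expr gen | ForIn gen gen

fun gen_word :: "nat \<Rightarrow> gen \<Rightarrow> bool list \<Rightarrow> (nat \<Rightarrow> nat) \<Rightarrow> bool list" where
  "gen_word m (Str bs) x R = bs"
| "gen_word m (Cat g h) x R = gen_word m g x R @ gen_word m h x R"
| "gen_word m (Num e) x R = enc_nat (val e R)"
| "gen_word m (For e g) x R =
     concat (map (\<lambda>i. gen_word (Suc m) g x (R(m := i))) (rev [0..<val e R]))"
| "gen_word m (ForIn g0 g1) x R =
     concat (map (\<lambda>i. gen_word (Suc m) (if x ! i then g1 else g0) x (R(m := i))) [0..<length x])"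

text \<open>The input head keeps the position of a \<open>ForIn\<close>, so the bodies must not move
  it; in return they may run at any head position.\<close>

fun no_input :: "gen \<Rightarrow> bool" where
  "no_input (Str bs) \<longleftrightarrow> True"
| "no_input (Cat g h) \<longleftrightarrow> no_input g \<and> no_input h"
| "no_input (Num e) \<longleftrightarrow> True"
| "no_input (For e g) \<longleftrightarrow> no_input g"
| "no_input (ForIn g0 g1) \<longleftrightarrow> False"

fun wf_gen :: "nat \<Rightarrow> gen \<Rightarrow> bool" where
  "wf_gen m (Str bs) \<longleftrightarrow> True"
| "wf_gen m (Cat g h) \<longleftrightarrow> wf_gen m g \<and> wf_gen m h"
| "wf_gen m (Num e) \<longleftrightarrow> below m e"
| "wf_gen m (For e g) \<longleftrightarrow> below m e \<and> wf_gen (Suc m) g"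
| "wf_gen m (ForIn g0 g1) \<longleftrightarrow>
     wf_gen (Suc m) g0 \<and> no_input g0 \<and> wf_gen (Suc m) g1 \<and> no_input g1"

definition on_input :: "nat list \<Rightarrow> bool" where "on_input ss \<longleftrightarrow> ss ! 0 \<noteq> 0"
definition input_bit :: "nat list \<Rightarrow> bool" where "input_bit ss \<longleftrightarrow> ss ! 0 = 2"

fun genc :: "nat \<Rightarrow> gen \<Rightarrow> com" where
  "genc m (Str bs) = foldr (\<lambda>b. Seq (Out b)) bs Skip"
| "genc m (Cat g h) = Seq (genc m g) (genc m h)"
| "genc m (Num e) = Seq (addc e m (Suc m)) (numc m)"
| "genc m (For e g) = Seq (addc e m (Suc m)) (loop m (genc (Suc m) g))"
| "genc m (ForIn g0 g1) = Seq
     (While on_input (Seq (Cond input_bit (genc (Suc m) g1) (genc (Suc m) g0)) (Seq InR (Inc m))))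
     (loop m InL)"

lemma wf_genc [simp]: "wf_com k 3 (genc m g)"
proof (induction m g rule: genc.induct)
  case (1 m bs)
  show ?case by (induction bs) auto
qed auto

text \<open>All counters and the input head are restored, so generators compose and a loop variable
  survives the body of its loop. Only a generator that scans the input needs the head at cell
  0.\<close>

definition emits :: "nat \<Rightarrow> gen \<Rightarrow> nat poly \<Rightarrow> nat \<Rightarrow> bool" where
  "emits m g P k \<longleftrightarrow> (\<forall>x R h ys B. (h = 0 \<or> no_input g) \<longrightarrow> length x \<le> B \<longrightarrow>
     (\<forall>j<m. R j \<le> B) \<longrightarrow> (\<forall>j\<ge>m. R j = 0) \<longrightarrow>
     run k x (genc m g) (R, h, ys) (poly P B) (R, h, ys @ gen_word m g x R))"

lemma emitsI:
  "(\<And>x R h ys B. h = 0 \<or> no_input g \<Longrightarrow> length x \<le> B \<Longrightarrow> \<forall>j<m. R j \<le> B \<Longrightarrow> \<forall>j\<ge>m. R j = 0 \<Longrightarrow>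
     run k x (genc m g) (R, h, ys) (poly P B) (R, h, ys @ gen_word m g x R)) \<Longrightarrow> emits m g P k"
  unfolding emits_def by blast

lemma emitsD:
  "emits m g P k \<Longrightarrow> h = 0 \<or> no_input g \<Longrightarrow> length x \<le> B \<Longrightarrow> \<forall>j<m. R j \<le> B \<Longrightarrow> \<forall>j\<ge>m. R j = 0 \<Longrightarrow>
     run k x (genc m g) (R, h, ys) (poly P B) (R, h, ys @ gen_word m g x R)"
  unfolding emits_def by blast

lemma run_Str: "run k x (foldr (\<lambda>b. Seq (Out b)) bs Skip) (R, h, ys) (2 * length bs) (R, h, ys @ bs)"
proof (induction bs arbitrary: ys)
  case Nil
  then show ?case by (simp add: run_Skip)
next
  case (Cons b bs)
  show ?case
    unfolding foldr.simps o_apply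
    by (rule run_Seq[OF run_Out[OF refl] Cons[of "ys @ [b]", unfolded append_assoc append_Cons append_Nil]])
      simp
qed

lemma tape_read_input:
  "i < length x \<Longrightarrow> on_input (map tape_read (tapes k x (R, int i, ys)))"
  "i < length x \<Longrightarrow> input_bit (map tape_read (tapes k x (R, int i, ys))) \<longleftrightarrow> x ! i"
  "\<not> on_input (map tape_read (tapes k x (R, int (length x), ys)))"
  by (auto simp: on_input_def input_bit_def tapes_nth tape_read_def word_contents_def)

lemma run_genc: "wf_gen m g \<Longrightarrow> \<exists>k0 P. \<forall>k\<ge>k0. emits m g P k"
proof (induction g arbitrary: m)
  case (Str bs)
  show ?case
    by (intro exI[of _ 0] exI[of _ "[:2 * length bs:]"] allI impI emitsI) (simp add: run_Str)
next
  case (Cat g h)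
  obtain k1 P where 1: "\<And>k. k \<ge> k1 \<Longrightarrow> emits m g P k" using Cat by auto metis
  obtain k2 Q where 2: "\<And>k. k \<ge> k2 \<Longrightarrow> emits m h Q k" using Cat by auto metis
  show ?case
  proof (intro exI[of _ "max k1 k2"] exI[of _ "P + Q + [:1:]"] allI impI emitsI)
    fix k and x :: "bool list" and R :: "nat \<Rightarrow> nat" and h' :: int and ys B
    assume k: "max k1 k2 \<le> k" and A: "h' = 0 \<or> no_input (Cat g h)" "length x \<le> B"
      "\<forall>j<m. R j \<le> B" "\<forall>j\<ge>m. R j = 0"
    have "run k x (genc m g) (R, h', ys) (poly P B) (R, h', ys @ gen_word m g x R)"
      by (rule emitsD[OF 1]) (use k A in auto)
    moreover have "run k x (genc m h) (R, h', ys @ gen_word m g x R) (poly Q B)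
        (R, h', (ys @ gen_word m g x R) @ gen_word m h x R)"
      by (rule emitsD[OF 2]) (use k A in auto)
    ultimately have "run k x (Seq (genc m g) (genc m h)) (R, h', ys) (poly (P + Q + [:1:]) B)
        (R, h', (ys @ gen_word m g x R) @ gen_word m h x R)"
      by (rule run_Seq) simp
    then show "run k x (genc m (Cat g h)) (R, h', ys) (poly (P + Q + [:1:]) B)
        (R, h', ys @ gen_word m (Cat g h) x R)" by simp
  qed
next
  case (Num e)
  then obtain k1 P where 1: "\<And>k. k \<ge> k1 \<Longrightarrow> adds m e m (Suc m) P k"
    using run_addc[of m e m "Suc m"] by auto
  obtain V where V: "\<And>R B. (\<forall>j<m. R j \<le> B) \<Longrightarrow> val e R \<le> poly V B"
    using val_bound[of m e] Num by auto
  let ?T = "P + V * ([:13:] * V + [:14:]) + [:4:]"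
  show ?case
  proof (intro exI[of _ "max k1 (m + 3)"] exI[of _ ?T] allI impI emitsI)
    fix k and x :: "bool list" and R :: "nat \<Rightarrow> nat" and h :: int and ys B
    assume k: "max k1 (m + 3) \<le> k" and A: "h = 0 \<or> no_input (Num e)" "length x \<le> B"
      "\<forall>j<m. R j \<le> B" "\<forall>j\<ge>m. R j = 0"
    let ?v = "val e R"
    have "run k x (addc e m (Suc m)) (R, h, ys) (poly P B) (R(m := ?v), h, ys)"
      using addsD[OF 1 A(3), of k x h ys] k A by simp
    moreover have "run k x (numc m) (R(m := ?v), h, ys) (?v * (13 * ?v + 14) + 3) (R, h, ys @ enc_nat ?v)"
      by (rule run_numc) (use k A in auto)
    moreover from V[OF A(3)] have "?v * (13 * ?v + 14) \<le> poly V B * (13 * poly V B + 14)"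
      by (intro mult_le_mono) auto
    then have "poly P B + (?v * (13 * ?v + 14) + 3) + 1 \<le> poly ?T B" by (simp add: algebra_simps)
    ultimately have "run k x (Seq (addc e m (Suc m)) (numc m)) (R, h, ys) (poly ?T B) (R, h, ys @ enc_nat ?v)"
      by (rule run_Seq)
    then show "run k x (genc m (Num e)) (R, h, ys) (poly ?T B) (R, h, ys @ gen_word m (Num e) x R)"
      by simp
  qed
next
  case (For e g)
  then obtain k1 P where 1: "\<And>k. k \<ge> k1 \<Longrightarrow> adds m e m (Suc m) P k"
    using run_addc[of m e m "Suc m"] by auto
  obtain k2 Q where 2: "\<And>k. k \<ge> k2 \<Longrightarrow> emits (Suc m) g Q k"
    using For.IH[of "Suc m"] For.prems by auto
  obtain V where V: "\<And>R B. (\<forall>j<m. R j \<le> B) \<Longrightarrow> val e R \<le> poly V B"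
    using val_bound[of m e] For by auto
  \<comment> \<open>In the body, the loop variable is bounded by the value of \<open>e\<close>
    instead of \<open>B\<close>, so the bound for the body is taken at
    \<open>B + poly V B\<close>.\<close>
  define Q' where "Q' = pcompose Q ([:0, 1:] + V)"
  let ?T = "P + V * (Q' + [:4:]) + [:2:]"
  show ?case
  proof (intro exI[of _ "max k1 (max k2 (Suc m))"] exI[of _ ?T] allI impI emitsI)
    fix k and x :: "bool list" and R :: "nat \<Rightarrow> nat" and h :: int and ys B
    assume k: "max k1 (max k2 (Suc m)) \<le> k" and A: "h = 0 \<or> no_input (For e g)" "length x \<le> B"
      "\<forall>j<m. R j \<le> B" "\<forall>j\<ge>m. R j = 0"
    let ?L = "val e R"
    let ?w = "\<lambda>i. gen_word (Suc m) g x (R(m := i))"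
    let ?st = "\<lambda>v. (R(m := v), h, ys @ concat (map ?w (rev [v..<?L])))"
    have L: "?L \<le> poly V B" by (rule V[OF A(3)])
    have "run k x (addc e m (Suc m)) (R, h, ys) (poly P B) (R(m := ?L), h, ys)"
      using addsD[OF 1 A(3), of k x h ys] k A by simp
    moreover have "run k x (loop m (genc (Suc m) g)) (R(m := ?L), h, ys) (?L * (poly Q' B + 4) + 1)
        (R, h, ys @ concat (map ?w (rev [0..<?L])))"
    proof (rule run_loop[where st = ?st and L = ?L and m = "poly Q' B"])
      fix v assume v: "v < ?L"
      have "run k x (genc (Suc m) g) (R(m := v), h, ys @ concat (map ?w (rev [Suc v..<?L])))
          (poly Q (B + poly V B))
          (R(m := v), h, (ys @ concat (map ?w (rev [Suc v..<?L]))) @ ?w v)"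
        by (rule emitsD[OF 2]) (use k A v L in \<open>auto simp: less_Suc_eq trans_le_add1\<close>)
      moreover have "concat (map ?w (rev [v..<?L])) = concat (map ?w (rev [Suc v..<?L])) @ ?w v"
        using v by (simp add: upt_conv_Cons)
      ultimately show "run k x (genc (Suc m) g) ((fst (?st (Suc v)))(m := v), snd (?st (Suc v)))
          (poly Q' B) (?st v)"
        by (simp add: Q'_def poly_pcompose)
    qed (use k A in \<open>auto simp: fun_eq_iff\<close>)
    ultimately have "run k x (Seq (addc e m (Suc m)) (loop m (genc (Suc m) g))) (R, h, ys) (poly ?T B)
        (R, h, ys @ concat (map ?w (rev [0..<?L])))"
      by (rule run_Seq) (use L in simp)
    then show "run k x (genc m (For e g)) (R, h, ys) (poly ?T B) (R, h, ys @ gen_word m (For e g) x R)"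
      by simp
  qed
next
  case (ForIn g0 g1)
  obtain k1 P where 1: "\<And>k. k \<ge> k1 \<Longrightarrow> emits (Suc m) g0 P k"
    using ForIn.IH(1)[of "Suc m"] ForIn.prems by auto
  obtain k2 Q where 2: "\<And>k. k \<ge> k2 \<Longrightarrow> emits (Suc m) g1 Q k"
    using ForIn.IH(2)[of "Suc m"] ForIn.prems by auto
  let ?S = "P + Q + [:7:]"
  let ?T = "[:0, 1:] * ?S + [:0, 5:] + [:3:]"
  let ?B = "Seq (Cond input_bit (genc (Suc m) g1) (genc (Suc m) g0)) (Seq InR (Inc m))"
  show ?case
  proof (intro exI[of _ "max k1 (max k2 (Suc m))"] exI[of _ ?T] allI impI emitsI)
    fix k and x :: "bool list" and R :: "nat \<Rightarrow> nat" and h :: int and ys B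
    assume k: "max k1 (max k2 (Suc m)) \<le> k" and A: "h = 0 \<or> no_input (ForIn g0 g1)" "length x \<le> B"
      "\<forall>j<m. R j \<le> B" "\<forall>j\<ge>m. R j = 0"
    let ?n = "length x"
    let ?w = "\<lambda>i. gen_word (Suc m) (if x ! i then g1 else g0) x (R(m := i))"
    let ?st = "\<lambda>i. (R(m := i), int i, ys @ concat (map ?w [0..<i]))"
    have body: "run k x ?B (?st i) (poly P B + poly Q B + 5) (?st (Suc i))" if i: "i < ?n" for i
    proof -
      let ?ys = "ys @ concat (map ?w [0..<i])"
      have "run k x (genc (Suc m) (if x ! i then g1 else g0)) (R(m := i), int i, ?ys)
          (poly P B + poly Q B) (R(m := i), int i, ?ys @ ?w i)"
      proof (cases "x ! i")
        case True
        have "run k x (genc (Suc m) g1) (R(m := i), int i, ?ys) (poly Q B) (R(m := i), int i, ?ys @ ?w i)"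
          unfolding if_P[OF True] by (rule emitsD[OF 2]) (use k A i ForIn.prems in auto)
        then show ?thesis using True by (auto intro: run_mono)
      next
        case False
        have "run k x (genc (Suc m) g0) (R(m := i), int i, ?ys) (poly P B) (R(m := i), int i, ?ys @ ?w i)"
          unfolding if_not_P[OF False] by (rule emitsD[OF 1]) (use k A i ForIn.prems in auto)
        then show ?thesis using False by (auto intro: run_mono)
      qed
      then have c: "run k x (Cond input_bit (genc (Suc m) g1) (genc (Suc m) g0)) (?st i)
          (Suc (poly P B + poly Q B)) (R(m := i), int i, ?ys @ ?w i)"
        using i unfolding run_def by (intro runs_Cond) (cases "x ! i"; simp add: tape_read_input)
      have r: "run k x InR (R(m := i), int i, ?ys @ ?w i) 1 (R(m := i), int (Suc i), ?ys @ ?w i)"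
        by (rule run_InR) simp
      have "run k x (Inc m) (R(m := i), int (Suc i), ?ys @ ?w i) 1 (?st (Suc i))"
        by (rule run_Inc) (use k in auto)
      from run_Seq[OF c run_Seq[OF r this order.refl]] show ?thesis by simp
    qed
    \<comment> \<open>The scan goes upwards, whereas \<open>runs_While_count\<close> counts
      remaining rounds; \<open>?n - v\<close> converts one into the other.\<close>
    have "runs (While on_input ?B) (tapes k x (?st (?n - ?n))) (?n * ((poly P B + poly Q B + 5) + 2) + 1)
        (tapes k x (?st (?n - 0)))"
    proof (rule runs_While_count)
      fix v assume v: "v < ?n"
      then show "on_input (map tape_read (tapes k x (?st (?n - Suc v))))"
        by (intro tape_read_input) auto
      have "?n - v = Suc (?n - Suc v)" using v by simp
      then show "runs ?B (tapes k x (?st (?n - Suc v))) (poly P B + poly Q B + 5)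
          (tapes k x (?st (?n - v)))"
        using body[of "?n - Suc v"] v by (simp add: run_def)
    qed (simp add: tape_read_input)
    moreover have "R(m := 0) = R" "h = 0" using A by (auto simp: fun_eq_iff)
    ultimately have 1: "run k x (While on_input ?B) (R, h, ys) (?n * (poly P B + poly Q B + 7) + 1) (?st ?n)"
      by (simp add: run_def ac_simps)
    \<comment> \<open>Counter \<open>m\<close> equals the head position, so emptying it takes the
      head back to cell 0.\<close>
    have 2: "run k x (loop m InL) (?st ?n) (?n * 5 + 1) (R, h, ys @ concat (map ?w [0..<?n]))"
      by (rule run_loop[where st = "\<lambda>v. (R(m := v), int v, ys @ concat (map ?w [0..<?n]))"
            and m = 1 and L = ?n])
        (use k \<open>R(m := 0) = R\<close> \<open>h = 0\<close> in \<open>auto intro!: run_InL[unfolded One_nat_def]\<close>)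
    have "?n * (poly P B + poly Q B + 7) + 1 + (?n * 5 + 1) + 1 \<le> poly ?T B"
      using mult_le_mono1[OF A(2), of "poly P B + poly Q B + 12"] by (simp add: algebra_simps)
    then have "run k x (genc m (ForIn g0 g1)) (R, h, ys) (poly ?T B) (R, h, ys @ concat (map ?w [0..<?n]))"
      unfolding genc.simps by (rule run_Seq[OF 1 2])
    then show "run k x (genc m (ForIn g0 g1)) (R, h, ys) (poly ?T B)
        (R, h, ys @ gen_word m (ForIn g0 g1) x R)"
      by simp
  qed
qed

section \<open>Initial marks, the length of the input, and the machine for a generator\<close>

definition mark :: com where
  "mark = Act (\<lambda>ss. (ss ! 0, 0) # map (\<lambda>s. (1, 0)) (butlast (tl ss)) @ [(ss ! (length ss - 1), 0)])"

text \<open>Counter 1 follows the head and is used up on the way back, while counter 0 keeps the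
  length.\<close>

definition measure_input :: com where
  "measure_input = Seq (While on_input (Seq InR (Seq (Inc 0) (Inc 1)))) (loop 1 InL)"

lemma wf_mark: "k \<ge> 2 \<Longrightarrow> wf_com k 3 mark"
  by (auto simp: mark_def valid_act_def)

lemma runs_mark:
  assumes "tm_tapes M = k + 2"
  shows "runs mark (snd (tm_init M x)) 1 (tapes k x (\<lambda>_. 0, 0, []))"
proof -
  let ?ts = "snd (tm_init M x)"
  let ?f = "\<lambda>ss :: nat list.
    (ss ! 0, 0) # map (\<lambda>s. (1, 0)) (butlast (tl ss)) @ [(ss ! (length ss - 1), 0)] :: (nat \<times> int) list"
  have len: "length ?ts = k + 2" using assms by (simp add: tm_init_def)
  have nth: "?ts ! 0 = (word_contents x, 0)" "\<And>j. j \<le> k \<Longrightarrow> ?ts ! Suc j = (word_contents [], 0)"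
    using assms by (simp_all add: tm_init_def del: replicate_Suc)
  have f: "length (?f (map tape_read ?ts)) = k + 2" "?f (map tape_read ?ts) ! 0 = (tape_read (?ts ! 0), 0)"
    "\<And>j. j < k \<Longrightarrow> ?f (map tape_read ?ts) ! Suc j = (1, 0)"
    "?f (map tape_read ?ts) ! Suc k = (tape_read (?ts ! Suc k), 0)"
    using len by (auto simp: nth_append nth_tl nth_butlast)
  have "map2 tape_act (?f (map tape_read ?ts)) ?ts = tapes k x (\<lambda>_. 0, 0, [])"
  proof (rule tapes_eqI)
    show "length (map2 tape_act (?f (map tape_read ?ts)) ?ts) = k + 2" using len f(1) by simp
    show "map2 tape_act (?f (map tape_read ?ts)) ?ts ! 0 = (word_contents x, 0)"
      using len f(1,2) nth(1) by (simp add: tape_act_def tape_read_def)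
    show "map2 tape_act (?f (map tape_read ?ts)) ?ts ! Suc k = out_tape []"
      using f(4) len nth(2)[of k] unfolding out_tape_def
      by (subst nth_map) (simp_all add: tape_act_def tape_read_def f(1))
    show "map2 tape_act (?f (map tape_read ?ts)) ?ts ! Suc j = counter_tape 0" if "j < k" for j
      using len f(1) f(3)[OF that] nth(2)[of j] that
      by (auto simp: tape_act_def counter_tape_def word_contents_def)
  qed
  then show ?thesis unfolding mark_def using runs_Act[of ?f ?ts] by simp
qed

lemma run_measure_input:
  assumes "k \<ge> 2"
  shows "run k x measure_input ((\<lambda>_. 0), 0, []) (12 * length x + 3) ((\<lambda>_. 0)(0 := length x), 0, [])"
proof -
  let ?n = "length x"
  let ?B = "Seq InR (Seq (Inc 0) (Inc 1))"
  let ?st = "\<lambda>i. ((\<lambda>_. 0)(0 := i, 1 := i), int i, [])"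
  have body: "run k x ?B (?st i) 5 (?st (Suc i))" for i
  proof -
    have 1: "run k x InR (?st i) 1 ((\<lambda>_. 0)(0 := i, 1 := i), int (Suc i), [])"
      by (rule run_InR) simp
    have 2: "run k x (Inc 0) ((\<lambda>_. 0)(0 := i, 1 := i), int (Suc i), []) 1
        ((\<lambda>_. 0)(0 := Suc i, 1 := i), int (Suc i), [])"
      by (rule run_Inc) (use assms in \<open>auto simp: fun_eq_iff\<close>)
    have 3: "run k x (Inc 1) ((\<lambda>_. 0)(0 := Suc i, 1 := i), int (Suc i), []) 1 (?st (Suc i))"
      by (rule run_Inc) (use assms in \<open>auto simp: fun_eq_iff\<close>)
    show ?thesis by (rule run_Seq[OF 1 run_Seq[OF 2 3 order.refl]]) simp
  qed
  have "runs (While on_input ?B) (tapes k x (?st (?n - ?n))) (?n * (5 + 2) + 1) (tapes k x (?st (?n - 0)))"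
  proof (rule runs_While_count)
    fix v assume v: "v < ?n"
    then show "on_input (map tape_read (tapes k x (?st (?n - Suc v))))"
      by (intro tape_read_input) auto
    have "?n - v = Suc (?n - Suc v)" using v by simp
    then show "runs ?B (tapes k x (?st (?n - Suc v))) 5 (tapes k x (?st (?n - v)))"
      using body[of "?n - Suc v"] by (simp add: run_def)
  qed (simp add: tape_read_input)
  moreover have "(\<lambda>_. 0)(0 := 0, Suc 0 := 0) = (\<lambda>_. 0 :: nat)" by (simp add: fun_eq_iff)
  ultimately have 1: "run k x (While on_input ?B) ((\<lambda>_. 0), 0, []) (?n * 7 + 1) (?st ?n)"
    by (simp add: run_def)
  have 2: "run k x (loop 1 InL) (?st ?n) (?n * 5 + 1) ((\<lambda>_. 0)(0 := ?n), 0, [])"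
    by (rule run_loop[where st = "\<lambda>v. ((\<lambda>_. 0)(0 := ?n, 1 := v), int v, [])" and m = 1 and L = ?n])
      (use assms in \<open>auto intro!: run_InL[unfolded One_nat_def] simp: fun_eq_iff\<close>)
  show ?thesis unfolding measure_input_def by (rule run_Seq[OF 1 2]) simp
qed

theorem polytime_gen_word:
  assumes "wf_gen 1 g"
  shows "polytime_computable (\<lambda>x. gen_word 1 g x ((\<lambda>_. 0)(0 := length x)))"
proof -
  obtain k0 P where P: "\<And>k. k \<ge> k0 \<Longrightarrow> emits 1 g P k"
    using run_genc[OF assms] by blast
  \<comment> \<open>Measuring the input takes two counters and the generator \<open>k0\<close>; the
    input and output tapes come on top.\<close>
  define k where "k = max k0 2"
  let ?c = "Seq mark (Seq measure_input (genc 1 g))"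
  let ?p = "P + [:0, 12:] + [:6:]"
  have wf: "wf_com (k + 2) 3 ?c" by (simp add: wf_mark measure_input_def)
  obtain M where M: "wf_tm M" "deterministic M" "tm_tapes M = k + 2"
    and sim: "\<And>ts b ts'. runs ?c ts b ts' \<Longrightarrow>
       \<exists>n q. n \<le> b \<and> (tm_step M ^^ n) (0, ts) (q, ts') \<and> tm_halted M (q, ts')"
    by (rule com_machine[OF wf]) auto
  have "\<exists>n c. n \<le> poly ?p (length x) \<and> (tm_step M ^^ n) (tm_init M x) c \<and> tm_halted M c \<and>
      tm_outputs c (gen_word 1 g x ((\<lambda>_. 0)(0 := length x)))" for x
  proof -
    let ?y = "gen_word 1 g x ((\<lambda>_. 0)(0 := length x))"
    let ?R = "(\<lambda>_. 0)(0 := length x)"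
    have "run k x (genc 1 g) (?R, 0, []) (poly P (length x)) (?R, 0, [] @ ?y)"
      by (rule emitsD[OF P]) (auto simp: k_def)
    from run_Seq[OF run_measure_input this order.refl]
    have "runs (Seq measure_input (genc 1 g)) (tapes k x (\<lambda>_. 0, 0, []))
        (12 * length x + 3 + poly P (length x) + 1) (tapes k x (?R, 0, ?y))"
      by (simp add: run_def k_def)
    from runs_Seq[OF runs_mark[OF M(3)] this]
    have "runs ?c (snd (tm_init M x)) (poly ?p (length x)) (tapes k x (?R, 0, ?y))"
      by (rule runs_mono) simp
    from sim[OF this] obtain n q where
      "n \<le> poly ?p (length x)" "(tm_step M ^^ n) (0, snd (tm_init M x)) (q, tapes k x (?R, 0, ?y))"
      "tm_halted M (q, tapes k x (?R, 0, ?y))" by blast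
    moreover have "(0, snd (tm_init M x)) = tm_init M x" by (simp add: tm_init_def)
    moreover have "tm_outputs (q, tapes k x (?R, 0, ?y)) ?y"
      by (simp add: tm_outputs_def tapes_def out_tape_def)
    ultimately show ?thesis by metis
  qed
  with M(1,2) show ?thesis unfolding polytime_computable_def by blast
qed

section \<open>From choice problems to matchings\<close>

text \<open>Post 0 of \<open>choice_inst N K cs\<close> is the only choice of the applicants below \<open>N\<close>. The three probes
  \<open>N\<close>, \<open>N + 1\<close>, \<open>N + 2\<close> prefer post 1 to post 0. If post 0 is filled up by applicants below \<open>N\<close>, the
  probes compete for a single seat, and any of them may have it. Otherwise two of them can be matched,
  and a cyclic shift of the three probes pleases two and displeases one of them.\<close>

definition chooser :: applicant where
  "chooser = \<lparr>app_prefs = [[0]], app_quota = 1, app_classes = []\<rparr>"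

definition probe :: applicant where
  "probe = \<lparr>app_prefs = [[1], [0]], app_quota = 1, app_classes = []\<rparr>"

definition choice_inst :: "nat \<Rightarrow> nat \<Rightarrow> classification \<Rightarrow> inst" where
  "choice_inst N K cs = \<lparr>applicants = replicate N chooser @ replicate 3 probe,
     posts = [\<lparr>post_quota = K, post_classes = ([N, N + 1, N + 2], 1) # cs\<rparr>,
              \<lparr>post_quota = 1, post_classes = []\<rparr>]\<rparr>"

definition solvable :: "nat \<Rightarrow> nat \<Rightarrow> classification \<Rightarrow> bool" where
  "solvable N K cs \<longleftrightarrow> (\<exists>S \<subseteq> {..<N}. K \<le> card S \<and> (\<forall>(C, q) \<in> set cs. card (S \<inter> set C) \<le> q))"

definition match :: "nat set \<Rightarrow> nat set \<Rightarrow> nat set \<Rightarrow> (nat \<times> nat) set" where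
  "match S X Y = (S \<union> X) \<times> {0} \<union> Y \<times> {1}"

text \<open>Here \<open>S\<close> and \<open>X\<close> are the choosers and the probes at post 0,
  and \<open>Y\<close> are the probes at post 1. The class of all probes limits \<open>X\<close> to
  one element, and the classes of \<open>cs\<close> concern \<open>S\<close> alone.\<close>

definition admissible :: "nat \<Rightarrow> nat \<Rightarrow> classification \<Rightarrow> nat set \<Rightarrow> nat set \<Rightarrow> nat set \<Rightarrow> bool" where
  "admissible N K cs S X Y \<longleftrightarrow> S \<subseteq> {..<N} \<and> X \<subseteq> {N..<N + 3} \<and> Y \<subseteq> {N..<N + 3} \<and> X \<inter> Y = {} \<and>
     card X \<le> 1 \<and> card Y \<le> 1 \<and> card S + card X \<le> K \<and>
     (\<forall>(C, q) \<in> set cs. card (S \<inter> set C) \<le> q)"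

lemma admissibleD:
  assumes "admissible N K cs S X Y"
  shows "finite S" "finite X" "finite Y" "S \<inter> (X \<union> Y) = {}" "X \<inter> Y = {}" "card X \<le> 1" "card Y \<le> 1"
proof -
  have sub: "S \<subseteq> {..<N}" "X \<subseteq> {N..<N + 3}" "Y \<subseteq> {N..<N + 3}"
    using assms by (simp_all add: admissible_def)
  then show "finite S" "finite X" "finite Y" using finite_subset by blast+
  have "{..<N} \<inter> {N..<N + 3} = {}" by auto
  then show "S \<inter> (X \<union> Y) = {}" using sub by blast
qed (use assms in \<open>simp_all add: admissible_def\<close>)

lemma card_le_one_singleton: "finite A \<Longrightarrow> card A \<le> 1 \<Longrightarrow> A = {} \<or> (\<exists>a. A = {a})"
  by (metis One_nat_def card_0_eq card_1_singletonE le_Suc_eq le_zero_eq)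

context
  fixes N K :: nat and cs :: classification
  assumes cs: "\<forall>(C, q) \<in> set cs. distinct C \<and> set C \<subseteq> {..<N}" "distinct (map (set \<circ> fst) cs)"
begin

abbreviation "single_inst \<equiv> choice_inst N K cs"

lemma length_choice_inst [simp]: "length (applicants single_inst) = N + 3" "length (posts single_inst) = 2"
  by (simp_all add: choice_inst_def)

lemma applicants_choice_inst:
  "a < N \<Longrightarrow> applicants single_inst ! a = chooser"
  "N \<le> a \<Longrightarrow> a < N + 3 \<Longrightarrow> applicants single_inst ! a = probe"
  by (simp_all add: choice_inst_def nth_append del: replicate_Suc)

lemma posts_choice_inst:
  "posts single_inst ! 0 = \<lparr>post_quota = K, post_classes = ([N, N + 1, N + 2], 1) # cs\<rparr>"
  "posts single_inst ! 1 = \<lparr>post_quota = 1, post_classes = []\<rparr>"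
  by (simp_all add: choice_inst_def)

lemma edges_choice_inst: "edges single_inst = {..<N + 3} \<times> {0} \<union> {N..<N + 3} \<times> {1}"
proof -
  have *: "(\<exists>g\<in>set (app_prefs (applicants single_inst ! a)). p \<in> set g) \<longleftrightarrow> p = 0 \<or> p = 1 \<and> N \<le> a"
    if "a < N + 3" for a p
    using that by (cases "a < N") (auto simp: applicants_choice_inst chooser_def probe_def)
  have "(a, p) \<in> edges single_inst \<longleftrightarrow> (a, p) \<in> {..<N + 3} \<times> {0} \<union> {N..<N + 3} \<times> {1}" for a p
    using *[of a p] by (cases "a < N + 3") (auto simp: edges_def)
  then show ?thesis by (intro set_eqI) (simp only: split_paired_all)
qed

lemma edge_rank_choice_inst:
  "a < N \<Longrightarrow> edge_rank single_inst a 0 = 1"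
  "N \<le> a \<Longrightarrow> a < N + 3 \<Longrightarrow> edge_rank single_inst a 0 = 2"
  "N \<le> a \<Longrightarrow> a < N + 3 \<Longrightarrow> edge_rank single_inst a 1 = 1"
proof -
  show "edge_rank single_inst a 0 = 1" if "a < N"
    unfolding edge_rank_def
    by (rule the_equality) (use that in \<open>auto simp: applicants_choice_inst chooser_def\<close>)
  show "edge_rank single_inst a 0 = 2" if "N \<le> a" "a < N + 3"
    unfolding edge_rank_def
    by (rule the_equality) (use that in \<open>auto simp: applicants_choice_inst probe_def nth_Cons' le_Suc_eq split: if_splits\<close>)
  show "edge_rank single_inst a 1 = 1" if "N \<le> a" "a < N + 3"
    unfolding edge_rank_def
    by (rule the_equality) (use that in \<open>auto simp: applicants_choice_inst probe_def nth_Cons' le_Suc_eq split: if_splits\<close>)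
qed

lemma max_rank_choice_inst: "max_rank single_inst = 2"
proof -
  have "edge_rank single_inst a p \<in> {1, 2}" if "(a, p) \<in> edges single_inst" for a p
  proof -
    consider "p = 0" "a < N" | "p = 0" "N \<le> a" "a < N + 3" | "p = 1" "N \<le> a" "a < N + 3"
      using \<open>(a, p) \<in> edges single_inst\<close> unfolding edges_choice_inst by fastforce
    then show ?thesis by cases (use edge_rank_choice_inst in simp_all)
  qed
  then have "{edge_rank single_inst a p | a p. (a, p) \<in> edges single_inst} \<subseteq> {1, 2}" by blast
  moreover have "2 \<in> {edge_rank single_inst a p | a p. (a, p) \<in> edges single_inst}"
    by (intro CollectI exI[of _ N] exI[of _ 0])
      (use edge_rank_choice_inst(2)[of N] in \<open>simp add: edges_choice_inst\<close>)
  moreover have "1 \<in> {edge_rank single_inst a p | a p. (a, p) \<in> edges single_inst}"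
    by (intro CollectI exI[of _ N] exI[of _ 1])
      (use edge_rank_choice_inst(3)[of N] in \<open>simp add: edges_choice_inst\<close>)
  ultimately have "{edge_rank single_inst a p | a p. (a, p) \<in> edges single_inst} = {1, 2}" by blast
  then show ?thesis by (simp add: max_rank_def)
qed

lemma valid_choice_inst: "valid_inst single_inst"
proof -
  have "applicants_of (edges single_inst) 0 = {..<N + 3}" by (auto simp: applicants_of_def edges_choice_inst)
  \<comment> \<open>Classes must differ as sets; the given ones contain only numbers below
    \<open>N\<close>.\<close>
  moreover have "{N, N + 1, N + 2} \<notin> (set \<circ> fst) ` set cs" using cs(1) by fastforce
  ultimately have "valid_classification (applicants_of (edges single_inst) 0) (([N, N + 1, N + 2], 1) # cs)"
    using cs by (fastforce simp: valid_classification_def)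
  then have "valid_classification (applicants_of (edges single_inst) p) (post_classes (posts single_inst ! p))"
    if "p < length (posts single_inst)" for p
  proof -
    have "p = 0 \<or> p = 1" using that by auto
    then show ?thesis
      using \<open>valid_classification (applicants_of (edges single_inst) 0) _\<close> posts_choice_inst
      by (elim disjE) (simp_all add: valid_classification_def)
  qed
  moreover have "[] \<notin> set (app_prefs A) \<and> distinct (concat (app_prefs A)) \<and>
      set (concat (app_prefs A)) \<subseteq> {..<length (posts single_inst)} \<and> valid_classification P (app_classes A)"
    if "A = applicants single_inst ! a" "a < N + 3" for A a P
    using that
    by (cases "a < N") (auto simp: applicants_choice_inst chooser_def probe_def valid_classification_def)
  ultimately show ?thesis unfolding valid_inst_def Let_def length_choice_inst(1) by blast
qed

lemma restrictions_choice_inst: "strict_prefs single_inst" "only_posts_classified single_inst" "unit_app_quotas single_inst"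
  by (auto simp: strict_prefs_def only_posts_classified_def unit_app_quotas_def choice_inst_def
      chooser_def probe_def)

lemma posts_of_match: "posts_of (match S X Y) a =
    (if a \<in> S \<union> X then {0} else {}) \<union> (if a \<in> Y then {1} else {})"
  by (auto simp: posts_of_def match_def)

lemma applicants_of_match:
  "applicants_of (match S X Y) 0 = S \<union> X" "applicants_of (match S X Y) (Suc 0) = Y"
  by (auto simp: applicants_of_def match_def)

lemma feasible_match:
  assumes "S \<subseteq> {..<N}" "X \<subseteq> {N..<N + 3}" "Y \<subseteq> {N..<N + 3}"
  shows "feasible single_inst (match S X Y) \<longleftrightarrow> admissible N K cs S X Y"
proof -
  have fin: "finite S" "finite X" "finite Y" using assms finite_subset by blast+
  have "S \<inter> X = {}" using assms by fastforce
  then have card: "card (S \<union> X) = card S + card X" using fin by (simp add: card_Un_disjoint)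
  have e: "match S X Y \<subseteq> edges single_inst" using assms by (fastforce simp: match_def edges_choice_inst)
  have P: "{N, N + 1, N + 2} = {N..<N + 3}" by auto
  have X: "(S \<union> X) \<inter> {N, N + 1, N + 2} = X" unfolding P using assms by fastforce
  have C: "(S \<union> X) \<inter> set C = S \<inter> set C" if "(C, q) \<in> set cs" for C q
    using cs(1) that assms(2) by fastforce
  have "within_quotas (app_quota (applicants single_inst ! a)) (app_classes (applicants single_inst ! a))
      (posts_of (match S X Y) a) \<longleftrightarrow> a \<notin> X \<inter> Y" if a: "a < N + 3" for a
  proof -
    have "app_quota (applicants single_inst ! a) = 1" "app_classes (applicants single_inst ! a) = []"
      using a by (cases "a < N"; simp add: applicants_choice_inst chooser_def probe_def)+
    moreover have "a \<in> Y \<Longrightarrow> a \<notin> S" using assms by fastforce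
    ultimately show ?thesis by (auto simp: within_quotas_def posts_of_match card_insert_if)
  qed
  moreover have "a < N + 3" if "a \<in> X" for a using assms(2) that by auto
  then have "X \<inter> Y = {} \<longleftrightarrow> (\<forall>a < N + 3. a \<notin> X \<inter> Y)" by blast
  ultimately have A: "(\<forall>a < N + 3. within_quotas (app_quota (applicants single_inst ! a))
      (app_classes (applicants single_inst ! a)) (posts_of (match S X Y) a)) \<longleftrightarrow> X \<inter> Y = {}"
    by auto
  have "(\<forall>p < length (posts single_inst). within_quotas (post_quota (posts single_inst ! p)) (post_classes (posts single_inst ! p))
      (applicants_of (match S X Y) p)) \<longleftrightarrow>
    card S + card X \<le> K \<and> card X \<le> 1 \<and> card Y \<le> 1 \<and> (\<forall>(C, q) \<in> set cs. card (S \<inter> set C) \<le> q)"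
  proof -
    have "(\<forall>p < length (posts single_inst). Q p) \<longleftrightarrow> Q 0 \<and> Q 1" for Q
      by (auto simp: less_2_cases_iff)
    moreover have "(\<forall>(C, q) \<in> set cs. card ((S \<union> X) \<inter> set C) \<le> q) \<longleftrightarrow>
        (\<forall>(C, q) \<in> set cs. card (S \<inter> set C) \<le> q)"
      using C by (intro ball_cong) auto
    ultimately show ?thesis
      using X by (auto simp: applicants_of_match within_quotas_def card posts_choice_inst[unfolded One_nat_def])
  qed
  then show ?thesis
    unfolding feasible_def length_choice_inst(1) admissible_def A using e assms by auto
qed

lemma feasible_choice_inst:
  "feasible single_inst M \<longleftrightarrow> (\<exists>S X Y. admissible N K cs S X Y \<and> M = match S X Y)"
proof
  assume f: "feasible single_inst M"
  then have e: "M \<subseteq> {..<N + 3} \<times> {0} \<union> {N..<N + 3} \<times> {1}"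
    unfolding feasible_def edges_choice_inst by blast
  define S X Y where "S = {a. (a, 0) \<in> M \<and> a < N}" and "X = {a. (a, 0) \<in> M \<and> N \<le> a}"
    and "Y = {a. (a, 1) \<in> M}"
  have M: "M = match S X Y"
  proof (rule set_eqI)
    fix x show "x \<in> M \<longleftrightarrow> x \<in> match S X Y"
      using e by (cases x) (auto simp: match_def S_def X_def Y_def not_less)
  qed
  have "S \<subseteq> {..<N}" "X \<subseteq> {N..<N + 3}" "Y \<subseteq> {N..<N + 3}"
    using e by (auto simp: S_def X_def Y_def)
  then have "admissible N K cs S X Y" using feasible_match f M by blast
  then show "\<exists>S X Y. admissible N K cs S X Y \<and> M = match S X Y" using M by blast
qed (use feasible_match in \<open>auto simp: admissible_def\<close>)

lemma feasible_admissible: "admissible N K cs S X Y \<Longrightarrow> feasible single_inst (match S X Y)"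
  unfolding feasible_choice_inst by blast

text \<open>Post 1 is the first choice of a probe, so gaining it is always an improvement, whereas
  post 0 only improves on being unmatched. A chooser merely distinguishes being matched from being
  unmatched.\<close>

lemma prefers_match:
  assumes "admissible N K cs S X Y" "admissible N K cs S' X' Y'" "a < N + 3"
  shows "prefers single_inst a (match S X Y) (match S' X' Y') \<longleftrightarrow>
    a \<in> S - S' \<or> a \<in> Y - Y' \<or> a \<in> X - (X' \<union> Y')"
proof (cases "a < N")
  case True
  then have "a \<notin> X" "a \<notin> Y" "a \<notin> X'" "a \<notin> Y'" using assms by (auto simp: admissible_def)
  then show ?thesis
    using edge_rank_choice_inst(1)[OF True] by (auto simp: prefers_def posts_of_match)
next
  case False
  then have a: "a \<notin> S" "a \<notin> S'" "a \<in> X \<Longrightarrow> a \<notin> Y" "a \<in> X' \<Longrightarrow> a \<notin> Y'"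
    using assms by (auto simp: admissible_def)
  have r: "edge_rank single_inst a 0 = 2" "edge_rank single_inst a (Suc 0) = 1"
    using edge_rank_choice_inst(2,3)[of a] assms(3) False by auto
  show ?thesis
    using a r by (auto simp: prefers_def posts_of_match)
qed

lemma votes:
  assumes "admissible N K cs S X Y" "admissible N K cs S' X' Y'"
  shows "card {a. a < length (applicants single_inst) \<and> prefers single_inst a (match S X Y) (match S' X' Y')} =
    card (S - S') + card ((Y - Y') \<union> (X - (X' \<union> Y')))"
proof -
  have lt: "a < N + 3" if "a \<in> S \<union> X \<union> Y" for a
    using assms(1) that by (auto simp: admissible_def)
  have "{a. a < length (applicants single_inst) \<and> prefers single_inst a (match S X Y) (match S' X' Y')} =
    (S - S') \<union> ((Y - Y') \<union> (X - (X' \<union> Y')))"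
    using prefers_match[OF assms] lt unfolding length_choice_inst by blast
  moreover have "finite (S - S')" "finite ((Y - Y') \<union> (X - (X' \<union> Y')))"
    "(S - S') \<inter> ((Y - Y') \<union> (X - (X' \<union> Y'))) = {}"
    using admissibleD[OF assms(1)] by (simp_all, blast)
  ultimately show ?thesis by (simp add: card_Un_disjoint)
qed

lemma more_popular_match:
  assumes "admissible N K cs S X Y" "admissible N K cs S' X' Y'"
  shows "more_popular single_inst (match S' X' Y') (match S X Y) \<longleftrightarrow>
    card (S - S') + card ((Y - Y') \<union> (X - (X' \<union> Y')))
    < card (S' - S) + card ((Y' - Y) \<union> (X' - (X \<union> Y)))"
  unfolding more_popular_def votes[OF assms] votes[OF assms(2,1)] by simp

text \<open>A solution can be thinned out to exactly \<open>K\<close> elements, as required by the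
  quota of post 0, because classes impose upper bounds only.\<close>

lemma solvable_full:
  assumes "solvable N K cs"
  obtains S where "S \<subseteq> {..<N}" "card S = K" "\<forall>(C, q) \<in> set cs. card (S \<inter> set C) \<le> q"
proof -
  obtain T where T: "T \<subseteq> {..<N}" "K \<le> card T" "\<forall>(C, q) \<in> set cs. card (T \<inter> set C) \<le> q"
    using assms unfolding solvable_def by blast
  obtain S where S: "S \<subseteq> T" "card S = K"
    using obtain_subset_with_card_n[OF T(2)] by blast
  have "card (S \<inter> set C) \<le> card (T \<inter> set C)" for C
    using S(1) by (intro card_mono) auto
  then have "\<forall>(C, q) \<in> set cs. card (S \<inter> set C) \<le> q" using T(3) le_trans by fast
  then show thesis using that S T(1) by blast
qed

lemma CPM_choice_inst: "CPM single_inst \<longleftrightarrow> solvable N K cs"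
proof
  assume "solvable N K cs"
  then obtain S where S: "S \<subseteq> {..<N}" "card S = K" "\<forall>(C, q) \<in> set cs. card (S \<inter> set C) \<le> q"
    by (rule solvable_full)
  have adm: "admissible N K cs S {} {N}" using S by (simp add: admissible_def)
  have "\<not> more_popular single_inst M' (match S {} {N})" if f: "feasible single_inst M'" for M'
  proof -
    obtain S' X' Y' where adm': "admissible N K cs S' X' Y'" and M': "M' = match S' X' Y'"
      using f unfolding feasible_choice_inst by blast
    have fin: "finite S" "finite S'" "finite X'" "finite Y'"
      using admissibleD[OF adm] admissibleD[OF adm'] by simp_all
    \<comment> \<open>Post 0 is full, so every newcomer there, chooser or probe, displaces a chooser
      of \<open>S\<close>, who has no alternative and votes against the change.\<close>
    have 1: "card (S' - S) + card X' \<le> card (S - S')"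
    proof -
      have "card S = card (S \<inter> S') + card (S - S')" "card S' = card (S' \<inter> S) + card (S' - S)"
        using fin card_Int_Diff by blast+
      moreover have "card (S' \<inter> S) = card (S \<inter> S')" by (simp add: Int_commute)
      moreover have "card S' + card X' \<le> K" using adm' by (simp add: admissible_def)
      ultimately show ?thesis using S(2) by linarith
    qed
    \<comment> \<open>Another probe can enter post 1 only if \<open>N\<close> leaves it, so these
      two votes cancel. Probes at post 0 are paid for by the previous bound.\<close>
    have 2: "card ((Y' - {N}) \<union> (X' - ({} \<union> {N}))) \<le> card X' + card ({N} - Y')"
    proof -
      have "card ((Y' - {N}) \<union> (X' - ({} \<union> {N}))) \<le> card (Y' - {N}) + card X'"
        using fin card_Un_le[of "Y' - {N}" "X' - {N}"] card_mono[of X' "X' - {N}"] by auto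
      moreover have "card (Y' - {N}) \<le> card ({N} - Y')"
      proof (cases "N \<in> Y'")
        case True
        then have "Y' = {N}" using card_le_one_singleton[OF fin(4) admissibleD(7)[OF adm']] by auto
        then show ?thesis by simp
      next
        case False
        then have "{N} - Y' = {N}" "Y' - {N} = Y'" by auto
        then show ?thesis using admissibleD(7)[OF adm'] by simp
      qed
      ultimately show ?thesis by simp
    qed
    show ?thesis
      unfolding M' more_popular_match[OF adm adm'] using 1 2 by simp
  qed
  then show "CPM single_inst" using feasible_admissible[OF adm] unfolding CPM_def popular_def by blast
next
  assume "CPM single_inst"
  then obtain M where M: "popular single_inst M" unfolding CPM_def by blast
  then have "feasible single_inst M" unfolding popular_def by blast
  then obtain S X Y where adm: "admissible N K cs S X Y" and MM: "M = match S X Y"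
    unfolding feasible_choice_inst by blast
  note pop = M[unfolded MM]
  \<comment> \<open>With \<open>S\<close> unchanged, only the probes vote, so no rearrangement of
    them may win.\<close>
  have beaten: "\<not> admissible N K cs S X' Y'"
    if "card ((Y - Y') \<union> (X - (X' \<union> Y'))) < card ((Y' - Y) \<union> (X' - (X \<union> Y)))" for X' Y'
  proof
    assume adm': "admissible N K cs S X' Y'"
    have "more_popular single_inst (match S X' Y') (match S X Y)"
      unfolding more_popular_match[OF adm adm'] using that by simp
    then show False using pop feasible_admissible[OF adm'] unfolding popular_def by blast
  qed
  show "solvable N K cs"
  proof (rule ccontr)
    assume "\<not> solvable N K cs"
    moreover have "S \<subseteq> {..<N}" "\<forall>(C, q) \<in> set cs. card (S \<inter> set C) \<le> q"
      using adm by (simp_all add: admissible_def)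
    \<comment> \<open>Hence post 0 always has room for one probe beside \<open>S\<close>.\<close>
    ultimately have less: "card S < K" unfolding solvable_def not_less[symmetric] by blast
    have fin: "finite X" "finite Y"
      using admissibleD[OF adm] by simp_all
    have third: "\<exists>b \<in> {N..<N + 3}. b \<noteq> y \<and> b \<noteq> z" for y z
    proof -
      have "N \<noteq> y \<and> N \<noteq> z \<or> N + 1 \<noteq> y \<and> N + 1 \<noteq> z \<or> N + 2 \<noteq> y \<and> N + 2 \<noteq> z" by presburger
      then show ?thesis by auto
    qed
    have "X = {} \<or> (\<exists>z. X = {z})" "Y = {} \<or> (\<exists>y. Y = {y})"
      using fin admissibleD(6,7)[OF adm] by (simp_all add: card_le_one_singleton)
    then consider "Y = {}" | y where "Y = {y}" "X = {}" | y z where "Y = {y}" "X = {z}"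
      by blast
    then show False
    proof cases
      case 1
      obtain b where b: "b \<in> {N..<N + 3}" "b \<notin> X"
        using third \<open>X = {} \<or> (\<exists>z. X = {z})\<close> by blast
      have "admissible N K cs S X {b}" using adm 1 b by (simp add: admissible_def)
      then show False using beaten[of "{b}" X] b 1 by auto
    next
      case 2
      obtain b where b: "b \<in> {N..<N + 3}" "b \<noteq> y" using third by blast
      have "admissible N K cs S {b} Y" using adm 2 b less by (simp add: admissible_def)
      then show False using beaten[of Y "{b}"] b 2 by auto
    next
      case 3
      \<comment> \<open>The cyclic shift: \<open>z\<close> moves up to post 1, the unmatched
        \<open>b\<close> takes its seat at post 0, and \<open>y\<close> drops out. Two votes stand
        against one.\<close>
      obtain b where b: "b \<in> {N..<N + 3}" "b \<noteq> y" "b \<noteq> z" using third by blast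
      have yz: "y \<noteq> z" using adm 3 by (auto simp: admissible_def)
      have "admissible N K cs S {b} {z}" using adm 3 b less by (simp add: admissible_def)
      moreover have "(Y - {z}) \<union> (X - ({b} \<union> {z})) = {y}" "({z} - Y) \<union> ({b} - (X \<union> Y)) = {z, b}"
        using 3 b yz by auto
      ultimately show False using beaten[of "{z}" "{b}"] b(3) by auto
    qed
  qed
qed

lemma signature_match:
  assumes "admissible N K cs S X Y"
  shows "signature single_inst (match S X Y) = [card S + card Y, card X]"
proof -
  have fin: "finite S" "finite X" "finite Y" and sub: "S \<subseteq> {..<N}" "X \<subseteq> {N..<N + 3}" "Y \<subseteq> {N..<N + 3}"
    using assms admissibleD[OF assms] by (simp_all add: admissible_def)
  have r: "a \<in> S \<Longrightarrow> edge_rank single_inst a 0 = 1" "a \<in> X \<Longrightarrow> edge_rank single_inst a 0 = 2" "a \<in> Y \<Longrightarrow> edge_rank single_inst a (Suc 0) = 1" for a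
    using edge_rank_choice_inst[of a] sub[THEN subsetD, of a] by auto
  have upt: "[1..<Suc 2] = [1, 2]" by (simp add: upt_rec)
  have "{(a, p). (a, p) \<in> match S X Y \<and> edge_rank single_inst a p = 1} = S \<times> {0} \<union> Y \<times> {1}"
    using r by (auto simp: match_def)
  moreover have "{(a, p). (a, p) \<in> match S X Y \<and> edge_rank single_inst a p = 2} = X \<times> {0}"
    using r by (auto simp: match_def)
  moreover have "card (S \<times> {0 :: nat} \<union> Y \<times> {1}) = card S + card Y"
    using fin by (subst card_Un_disjoint) (auto simp: card_cartesian_product)
  ultimately show ?thesis
    unfolding signature_def max_rank_choice_inst upt by (simp add: card_cartesian_product)
qed

text \<open>Post 1 contributes at most one edge of rank 1, so of \<open>K + 1\<close> such edges at
  least \<open>K\<close> belong to choosers. The second entry 0 turns the threshold into a condition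
  on rank 1 alone.\<close>

lemma CRMM_choice_inst: "CRMM (single_inst, [K + 1, 0]) \<longleftrightarrow> solvable N K cs"
proof
  assume "solvable N K cs"
  then obtain S where S: "S \<subseteq> {..<N}" "card S = K" "\<forall>(C, q) \<in> set cs. card (S \<inter> set C) \<le> q"
    by (rule solvable_full)
  then have adm: "admissible N K cs S {} {N}" by (simp add: admissible_def)
  have "ord_class.lexordp_eq [K + 1, 0] (signature single_inst (match S {} {N}))"
    unfolding signature_match[OF adm] using S by simp
  then show "CRMM (single_inst, [K + 1, 0])"
    using feasible_admissible[OF adm] by (auto simp: CRMM_def)
next
  assume "CRMM (single_inst, [K + 1, 0])"
  then obtain M where "feasible single_inst M" "ord_class.lexordp_eq [K + 1, 0] (signature single_inst M)"
    unfolding CRMM_def by auto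
  then obtain S X Y where adm: "admissible N K cs S X Y"
    and "ord_class.lexordp_eq [K + 1, 0] (signature single_inst (match S X Y))"
    unfolding feasible_choice_inst by blast
  then have "K + 1 \<le> card S + card Y" unfolding signature_match[OF adm] by auto
  then have "K \<le> card S" using adm by (simp add: admissible_def)
  then show "solvable N K cs" using adm by (auto simp: admissible_def solvable_def)
qed

end

section \<open>From constraint satisfaction to choice problems\<close>

text \<open>There are \<open>G\<close> variables with values below \<open>Z\<close>; applicant \<open>g * Z + v\<close> stands for the assignment of
  \<open>v\<close> to variable \<open>g\<close>. Each forbidden combination of assignments is tagged with a number \<open>d\<close>. The
  applicant \<open>G * Z + d\<close>, who is chosen in every solution, makes the classes different as sets.\<close>

definition csp_classes :: "nat \<Rightarrow> nat \<Rightarrow> nat list \<Rightarrow> (nat \<times> nat list) list \<Rightarrow> classification" where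
  "csp_classes G Z gs L = map (\<lambda>g. ([g * Z..<g * Z + Z], 1)) gs @
     map (\<lambda>(d, ns). ((G * Z + d) # ns, length ns)) L"

context
  fixes G Z m :: nat and gs :: "nat list" and L :: "(nat \<times> nat list) list"
  assumes Z: "Z > 0" and gs: "distinct gs" "set gs = {..<G}"
    and L: "\<forall>(d, ns) \<in> set L. d < m \<and> distinct ns \<and> set ns \<subseteq> {..<G * Z}"
      "distinct (map fst L)"
begin

lemma group_less: "g < G \<Longrightarrow> v < Z \<Longrightarrow> g * Z + v < G * Z"
proof -
  assume "g < G" "v < Z"
  then have "g * Z + v < Suc g * Z" "Suc g * Z \<le> G * Z" by (simp, intro mult_le_mono1) simp
  then show ?thesis by linarith
qed

lemma csp_classes_valid:
  "\<forall>(C, q) \<in> set (csp_classes G Z gs L). distinct C \<and> set C \<subseteq> {..<G * Z + m}"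
  "distinct (map (set \<circ> fst) (csp_classes G Z gs L))"
proof -
  have g: "x < G * Z" if "g < G" "x < g * Z + Z" for g x
    using group_less[of g "Z - 1"] that Z by linarith
  show "\<forall>(C, q) \<in> set (csp_classes G Z gs L). distinct C \<and> set C \<subseteq> {..<G * Z + m}"
    using L gs g by (fastforce simp: csp_classes_def)
  \<comment> \<open>The classes are told apart by their maxima: the blocks end at different places
    below \<open>G * Z\<close>, and the maximum of a forbidden combination is its tagged
    applicant.\<close>
  have Max1: "Max (set [g * Z..<g * Z + Z]) = g * Z + (Z - 1)" for g
    by (rule Max_eqI) (use Z in auto)
  have Max2: "Max (set ((G * Z + d) # ns)) = G * Z + d" if "(d, ns) \<in> set L" for d ns
    by (rule Max_eqI) (use L(1) that in fastforce)+
  have "map (Max \<circ> (set \<circ> fst)) (csp_classes G Z gs L) =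
      map (\<lambda>g. g * Z + (Z - 1)) gs @ map (\<lambda>d. G * Z + d) (map fst L)"
    using Max1 Max2 by (auto simp: csp_classes_def)
  moreover have "distinct (map (\<lambda>g. g * Z + (Z - 1)) gs @ map (\<lambda>d. G * Z + d) (map fst L))"
  proof -
    have "inj_on (\<lambda>g. g * Z + (Z - 1)) (set gs)"
    proof (rule inj_onI)
      fix g g' assume "g * Z + (Z - 1) = g' * Z + (Z - 1)"
      then have "g * Z = g' * Z" by linarith
      then show "g = g'" using Z by simp
    qed
    moreover have "g * Z + (Z - 1) < G * Z" if "g \<in> set gs" for g
      using group_less[of g "Z - 1"] gs that Z by auto
    ultimately show ?thesis using gs L(2) by (fastforce simp: distinct_map inj_on_def)
  qed
  ultimately have "distinct (map Max (map (set \<circ> fst) (csp_classes G Z gs L)))"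
    by (simp del: map_append)
  then show "distinct (map (set \<circ> fst) (csp_classes G Z gs L))" by (simp only: distinct_map)
qed

lemma solvable_csp:
  "solvable (G * Z + m) (G + m) (csp_classes G Z gs L) \<longleftrightarrow>
   (\<exists>A. (\<forall>g < G. A g < Z) \<and> (\<forall>(d, ns) \<in> set L. \<exists>v \<in> set ns. A (v div Z) \<noteq> v mod Z))"
proof
  assume "solvable (G * Z + m) (G + m) (csp_classes G Z gs L)"
  then obtain S where S: "S \<subseteq> {..<G * Z + m}" "G + m \<le> card S"
    and q: "\<And>C q. (C, q) \<in> set (csp_classes G Z gs L) \<Longrightarrow> card (S \<inter> set C) \<le> q"
    unfolding solvable_def by blast
  have finS: "finite S" using S(1) finite_subset by blast
  \<comment> \<open>Sends a value to its variable and the tagged applicants to the \<open>m\<close>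
    numbers from \<open>G\<close> on. The block classes make this injective on \<open>S\<close>, so
    by counting, \<open>S\<close> meets every block and contains every tagged applicant.\<close>
  define \<phi> where "\<phi> x = (if x < G * Z then x div Z else G + (x - G * Z))" for x
  have div_less: "x div Z < G" if "x < G * Z" for x
    using that by (simp add: less_mult_imp_div_less)
  have inj: "inj_on \<phi> S"
  proof (rule inj_onI)
    fix x y assume xy: "x \<in> S" "y \<in> S" "\<phi> x = \<phi> y"
    show "x = y"
    proof (cases "x < G * Z")
      case True
      let ?g = "x div Z"
      have y: "y < G * Z" "y div Z = ?g"
        using xy True div_less[of x] by (auto simp: \<phi>_def split: if_splits)
      have "([?g * Z..<?g * Z + Z], 1) \<in> set (csp_classes G Z gs L)"
        using div_less[OF True] gs by (auto simp: csp_classes_def)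
      then have "card (S \<inter> set [?g * Z..<?g * Z + Z]) \<le> 1" by (rule q)
      then have le: "card (S \<inter> {?g * Z..<?g * Z + Z}) \<le> Suc 0" by simp
      have block: "z \<in> {?g * Z..<?g * Z + Z}" if "z div Z = ?g" for z
      proof -
        have "z = ?g * Z + z mod Z" using that div_mult_mod_eq[of z Z] by simp
        moreover have "z mod Z < Z" using Z by simp
        ultimately show ?thesis unfolding atLeastLessThan_iff by linarith
      qed
      have "finite (S \<inter> {?g * Z..<?g * Z + Z})" by simp
      from card_le_Suc0_iff_eq[OF this] le
      have "\<forall>a \<in> S \<inter> {?g * Z..<?g * Z + Z}. \<forall>b \<in> S \<inter> {?g * Z..<?g * Z + Z}. a = b" by blast
      then show ?thesis using xy(1,2) block[OF refl] block[OF y(2)] by blast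
    next
      case False
      then show ?thesis using xy div_less[of y] by (auto simp: \<phi>_def split: if_splits)
    qed
  qed
  have im: "\<phi> ` S = {..<G + m}"
  proof (rule card_subset_eq)
    show "\<phi> ` S \<subseteq> {..<G + m}"
      using S(1) div_less by (fastforce simp: \<phi>_def)
    then have "card (\<phi> ` S) \<le> G + m" using card_mono[of "{..<G + m}"] by fastforce
    then show "card (\<phi> ` S) = card {..<G + m}" using S(2) card_image[OF inj] by simp
  qed simp
  have dummy: "G * Z + d \<in> S" if d: "d < m" for d
  proof -
    have "G + d \<in> \<phi> ` S" using im d by auto
    then obtain x where x: "x \<in> S" "\<phi> x = G + d" by auto
    then have "x = G * Z + d" using div_less[of x] by (auto simp: \<phi>_def split: if_splits)
    then show ?thesis using x by simp
  qed
  have "\<exists>x \<in> S. x div Z = g" if "g < G" for g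
  proof -
    have "g \<in> \<phi> ` S" using im that by auto
    then show ?thesis using that by (auto simp: \<phi>_def split: if_splits)
  qed
  then obtain c where c: "\<And>g. g < G \<Longrightarrow> c g \<in> S" "\<And>g. g < G \<Longrightarrow> c g div Z = g" by metis
  define A where "A g = c g mod Z" for g
  have "\<exists>v \<in> set ns. A (v div Z) \<noteq> v mod Z" if dns: "(d, ns) \<in> set L" for d ns
  proof (rule ccontr)
    \<comment> \<open>If all the forbidden values were taken, the whole class would lie in
      \<open>S\<close>, tagged applicant included, and exceed its quota by one.\<close>
    assume "\<not> ?thesis"
    then have eq: "A (v div Z) = v mod Z" if "v \<in> set ns" for v using that by blast
    have "v \<in> S" if v: "v \<in> set ns" for v
    proof -
      have "v < G * Z" using L(1) dns v by auto
      then have g: "v div Z < G" by (rule div_less)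
      have "v = c (v div Z)"
        using c(2)[OF g] eq[OF v] unfolding A_def by (metis div_mod_decomp)
      then show ?thesis using c(1)[OF g] by simp
    qed
    then have "S \<inter> set ((G * Z + d) # ns) = set ((G * Z + d) # ns)"
      using dummy L(1) dns by auto
    moreover have "distinct ((G * Z + d) # ns)" using L(1) dns by fastforce
    moreover have "card (S \<inter> set ((G * Z + d) # ns)) \<le> length ns"
      by (rule q) (use dns in \<open>force simp: csp_classes_def\<close>)
    ultimately show False using distinct_card[of "(G * Z + d) # ns"] by simp
  qed
  then show "\<exists>A. (\<forall>g < G. A g < Z) \<and> (\<forall>(d, ns) \<in> set L. \<exists>v \<in> set ns. A (v div Z) \<noteq> v mod Z)"
    using Z by (intro exI[of _ A]) (auto simp: A_def)
next
  assume "\<exists>A. (\<forall>g < G. A g < Z) \<and> (\<forall>(d, ns) \<in> set L. \<exists>v \<in> set ns. A (v div Z) \<noteq> v mod Z)"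
  then obtain A where A: "\<And>g. g < G \<Longrightarrow> A g < Z"
    and ng: "\<And>d ns. (d, ns) \<in> set L \<Longrightarrow> \<exists>v \<in> set ns. A (v div Z) \<noteq> v mod Z" by blast
  define T where "T = (\<lambda>g. g * Z + A g) ` {..<G}"
  define S where "S = T \<union> {G * Z..<G * Z + m}"
  have div: "(g * Z + A g) div Z = g" "(g * Z + A g) mod Z = A g" if "g < G" for g
    using A[OF that] Z by simp_all
  have T: "x < G * Z \<and> x mod Z = A (x div Z)" if "x \<in> T" for x
  proof -
    from that obtain g where g: "g < G" "x = g * Z + A g" by (auto simp: T_def)
    show ?thesis unfolding g(2) div[OF g(1)] using group_less[OF g(1) A[OF g(1)]] by simp
  qed
  have "inj_on (\<lambda>g. g * Z + A g) {..<G}"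
  proof (rule inj_onI)
    fix g g' assume gg: "g \<in> {..<G}" "g' \<in> {..<G}" "g * Z + A g = g' * Z + A g'"
    then show "g = g'" by (metis div(1) lessThan_iff)
  qed
  then have "card T = G" by (simp add: T_def card_image)
  moreover have "T \<inter> {G * Z..<G * Z + m} = {}" using T by fastforce
  ultimately have "card S = G + m" by (simp add: S_def card_Un_disjoint T_def)
  moreover have "S \<subseteq> {..<G * Z + m}" using T by (fastforce simp: S_def)
  moreover have "card (S \<inter> set C) \<le> q" if "(C, q) \<in> set (csp_classes G Z gs L)" for C q
  proof -
    from that consider g where "g < G" "C = [g * Z..<g * Z + Z]" "q = 1"
      | d ns where "(d, ns) \<in> set L" "C = (G * Z + d) # ns" "q = length ns"
      using gs by (auto simp: csp_classes_def)
    then show ?thesis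
    proof cases
      case 1
      have "S \<inter> set C \<subseteq> {g * Z + A g}"
      proof
        fix x assume x: "x \<in> S \<inter> set C"
        have "x < G * Z" using x 1 group_less[of g "Z - 1"] Z by auto
        then have "x \<in> T" using x by (auto simp: S_def)
        have "x div Z = g"
        proof (rule div_nat_eqI)
          show "Z * g \<le> x" "x < Z * Suc g" using x 1 by (auto simp: mult.commute)
        qed
        then show "x \<in> {g * Z + A g}" using T[OF \<open>x \<in> T\<close>] by (metis div_mod_decomp singletonI)
      qed
      then have "card (S \<inter> set C) \<le> card {g * Z + A g}" by (intro card_mono) auto
      then show ?thesis using 1 by simp
    next
      case 2
      obtain v where v: "v \<in> set ns" "A (v div Z) \<noteq> v mod Z" using ng[OF 2(1)] by blast
      have "v < G * Z" using L(1) 2(1) v by fastforce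
      then have "v \<notin> S" using T[of v] v by (auto simp: S_def)
      then have "card (S \<inter> set C) < card (set C)"
        using v 2 by (intro psubset_card_mono) auto
      then show ?thesis using card_length[of C] 2 by simp
    qed
  qed
  ultimately show "solvable (G * Z + m) (G + m) (csp_classes G Z gs L)"
    unfolding solvable_def by (intro exI[of _ S]) auto
qed

end

section \<open>Computations as tableaux\<close>

definition accepting :: "tm \<Rightarrow> config \<Rightarrow> bool" where
  "accepting M c \<longleftrightarrow> tm_halted M c \<and> fst c = tm_accept M"

definition idle_step :: "tm \<Rightarrow> config \<Rightarrow> config \<Rightarrow> bool" where
  "idle_step M c c' \<longleftrightarrow> tm_step M c c' \<or> accepting M c \<and> c' = c"

text \<open>As no computation from \<open>c0\<close> exceeds \<open>T\<close> steps, an accepting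
  one can be prolonged to length \<open>T\<close> by waiting at its end. Waiting is possible only in
  an accepting configuration, so nothing new gets accepted.\<close>

lemma accepting_padded:
  assumes "\<And>n c. (tm_step M ^^ n) c0 c \<Longrightarrow> n \<le> T"
  shows "(\<exists>c. (tm_step M)\<^sup>*\<^sup>* c0 c \<and> accepting M c) \<longleftrightarrow>
    (\<exists>C. C 0 = c0 \<and> (\<forall>t<T. idle_step M (C t) (C (Suc t))) \<and> accepting M (C T))"
proof
  assume "\<exists>c. (tm_step M)\<^sup>*\<^sup>* c0 c \<and> accepting M c"
  then obtain c n where c: "(tm_step M ^^ n) c0 c" "accepting M c"
    by (auto simp: rtranclp_power)
  have "n \<le> T" using assms c(1) by blast
  obtain C where C: "C 0 = c0" "C n = c" "\<And>t. t < n \<Longrightarrow> tm_step M (C t) (C (Suc t))"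
    using c(1) by (auto simp: relpowp_fun_conv)
  define D where "D t = (if t \<le> n then C t else c)" for t
  have "idle_step M (D t) (D (Suc t))" for t
    using C c(2) by (cases "t < n") (auto simp: D_def idle_step_def not_less le_Suc_eq)
  moreover have "D 0 = c0" "accepting M (D T)"
    using C c(2) \<open>n \<le> T\<close> by (auto simp: D_def)
  ultimately show "\<exists>C. C 0 = c0 \<and> (\<forall>t<T. idle_step M (C t) (C (Suc t))) \<and> accepting M (C T)"
    by blast
next
  assume "\<exists>C. C 0 = c0 \<and> (\<forall>t<T. idle_step M (C t) (C (Suc t))) \<and> accepting M (C T)"
  then obtain C where C: "C 0 = c0" "\<And>t. t < T \<Longrightarrow> idle_step M (C t) (C (Suc t))" "accepting M (C T)"
    by blast
  have "t \<le> T \<Longrightarrow> (tm_step M)\<^sup>*\<^sup>* c0 (C t)" for t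
  proof (induction t)
    case (Suc t)
    then have "(tm_step M)\<^sup>*\<^sup>* c0 (C t)" "idle_step M (C t) (C (Suc t))" using C(2) by simp_all
    then show ?case by (auto simp: idle_step_def)
  qed (simp add: C)
  then show "\<exists>c. (tm_step M)\<^sup>*\<^sup>* c0 c \<and> accepting M c" using C(3) by blast
qed

type_synonym trans = "nat \<times> nat list \<times> nat \<times> (nat \<times> int) list"

abbreviation src :: "trans \<Rightarrow> nat" where "src \<tau> \<equiv> fst \<tau>"
abbreviation reads :: "trans \<Rightarrow> nat list" where "reads \<tau> \<equiv> fst (snd \<tau>)"
abbreviation tgt :: "trans \<Rightarrow> nat" where "tgt \<tau> \<equiv> fst (snd (snd \<tau>))"
abbreviation acts :: "trans \<Rightarrow> (nat \<times> int) list" where "acts \<tau> \<equiv> snd (snd (snd \<tau>))"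

text \<open>Whether a configuration is halted and accepting depends only on the state and the
  scanned symbols, so an extra transition that changes nothing can record it. In the last row it
  expresses acceptance.\<close>

definition idle :: "tm \<Rightarrow> trans \<Rightarrow> bool" where
  "idle M \<tau> \<longleftrightarrow> src \<tau> = tm_accept M \<and> tm_delta M (src \<tau>) (reads \<tau>) = {}"

definition transitions :: "tm \<Rightarrow> trans set" where
  "transitions M = {\<tau>. src \<tau> < tm_states M \<and> length (reads \<tau>) = tm_tapes M \<and>
     (\<forall>s\<in>set (reads \<tau>). s < tm_symbols M) \<and>
     ((tgt \<tau>, acts \<tau>) \<in> tm_delta M (src \<tau>) (reads \<tau>) \<or>
      idle M \<tau> \<and> tgt \<tau> = src \<tau> \<and> acts \<tau> = stay (reads \<tau>))}"

definition applies :: "trans \<Rightarrow> config \<Rightarrow> config \<Rightarrow> bool" where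
  "applies \<tau> c c' \<longleftrightarrow> src \<tau> = fst c \<and> reads \<tau> = map tape_read (snd c) \<and>
     c' = (tgt \<tau>, map2 tape_act (acts \<tau>) (snd c))"

definition valid_config :: "tm \<Rightarrow> config \<Rightarrow> bool" where
  "valid_config M c \<longleftrightarrow> fst c < tm_states M \<and> length (snd c) = tm_tapes M \<and>
     (\<forall>t \<in> set (snd c). \<forall>i. fst t i < tm_symbols M)"

definition view :: "tape \<Rightarrow> int \<Rightarrow> nat" where "view t i = fst t (snd t + i)"

lemma view_act: "view (tape_act a t) i = (if i + snd a = 0 then fst a else view t (i + snd a))"
  by (auto simp: view_def tape_act_def ac_simps)

lemma view_0: "view t 0 = tape_read t"
  by (simp add: view_def tape_read_def)

lemma halted_iff: "tm_halted M c \<longleftrightarrow> tm_delta M (fst c) (map tape_read (snd c)) = {}"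
  by (auto simp: tm_halted_def tm_step_def)

text \<open>Row \<open>t\<close> of a tableau describes the configuration at time \<open>t\<close>. The tapes are shown relative to
  their heads, which are at column \<open>T + 1\<close>. Variable \<open>tm_tapes M\<close> of that column is the number of the
  transition applied. The relative displacement of a tape by a move \<open>d\<close> is \<open>- d\<close>, and \<open>shift\<close> is
  \<open>1 - d\<close>, so that all columns are sums of natural numbers. Cells that enter the window are
  arbitrary; they are too far away to be reached within \<open>T\<close> steps.\<close>

definition shift :: "trans \<Rightarrow> nat \<Rightarrow> nat" where
  "shift \<tau> j = nat (1 - snd (acts \<tau> ! j))"

definition tableau :: "tm \<Rightarrow> (nat \<Rightarrow> trans) \<Rightarrow> nat \<Rightarrow> bool list \<Rightarrow> (nat \<Rightarrow> nat \<Rightarrow> nat \<Rightarrow> nat) \<Rightarrow> bool" where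
  "tableau M tr P x A \<longleftrightarrow> (let k = tm_tapes M; n = length x; T = n + P; \<tau> = (\<lambda>t. tr (A t (T + 1) k)) in
     (\<forall>t<T + 1. \<forall>j<k. A t (T + 1) j = reads (\<tau> t) ! j) \<and>
     (\<forall>t<T. \<forall>j<k. A (t + 1) (T + shift (\<tau> t) j) j = fst (acts (\<tau> t) ! j)) \<and>
     (\<forall>t<T. \<forall>i<T. \<forall>j<k. A (t + 1) (i + shift (\<tau> t) j) j = A t (i + 1) j) \<and>
     (\<forall>t<T. \<forall>i<T. \<forall>j<k. A (t + 1) (T + 1 + i + shift (\<tau> t) j) j = A t (T + 2 + i) j) \<and>
     (\<forall>t<T. src (\<tau> (t + 1)) = tgt (\<tau> t)) \<and>
     src (\<tau> 0) = 0 \<and> idle M (\<tau> T) \<and>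
     (\<forall>i<T. A 0 (i + 1) 0 = 0) \<and>
     (\<forall>i<n. A 0 (T + 1 + i) 0 = (if x ! i then 2 else 1)) \<and>
     (\<forall>i<P + 1. A 0 (T + 1 + n + i) 0 = 0) \<and>
     (\<forall>i<2 * T + 3. \<forall>j<k. j \<noteq> 0 \<longrightarrow> A 0 i j = 0))"

context
  fixes M :: tm
  assumes wf: "wf_tm M"
begin

lemma transitions_bounds:
  assumes "\<tau> \<in> transitions M"
  shows "tgt \<tau> < tm_states M" "length (acts \<tau>) = tm_tapes M"
    "\<forall>(s, d) \<in> set (acts \<tau>). s < tm_symbols M \<and> d \<in> {-1, 0, 1}"
proof -
  have *: "tgt \<tau> < tm_states M \<and> length (acts \<tau>) = tm_tapes M \<and>
    (\<forall>(s, d) \<in> set (acts \<tau>). s < tm_symbols M \<and> d \<in> {-1, 0, 1})"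
  proof (cases "(tgt \<tau>, acts \<tau>) \<in> tm_delta M (src \<tau>) (reads \<tau>)")
    case True
    have "\<forall>(q', as) \<in> tm_delta M (src \<tau>) (reads \<tau>). q' < tm_states M \<and> length as = tm_tapes M \<and>
         (\<forall>(s, d) \<in> set as. s < tm_symbols M \<and> d \<in> {-1, 0, 1})"
      using wf assms unfolding wf_tm_def transitions_def by blast
    from bspec[OF this True] show ?thesis unfolding prod.case .
  next
    case False
    then have "tgt \<tau> = src \<tau>" "acts \<tau> = stay (reads \<tau>)" using assms by (auto simp: transitions_def)
    then show ?thesis using assms by (auto simp: transitions_def stay_def)
  qed
  show "tgt \<tau> < tm_states M" "length (acts \<tau>) = tm_tapes M"
    "\<forall>(s, d) \<in> set (acts \<tau>). s < tm_symbols M \<and> d \<in> {-1, 0, 1}"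
    using * by blast+
qed

lemma finite_transitions: "finite (transitions M)"
proof -
  let ?k = "tm_tapes M"
  let ?R = "{ss. set ss \<subseteq> {..<tm_symbols M} \<and> length ss = ?k}"
  let ?A = "{as. set as \<subseteq> {..<tm_symbols M} \<times> {-1, 0, 1 :: int} \<and> length as = ?k}"
  have "transitions M \<subseteq> {..<tm_states M} \<times> ?R \<times> {..<tm_states M} \<times> ?A"
  proof
    fix \<tau> assume \<tau>: "\<tau> \<in> transitions M"
    have "src \<tau> \<in> {..<tm_states M}" "reads \<tau> \<in> ?R" using \<tau> by (auto simp: transitions_def)
    moreover have "tgt \<tau> \<in> {..<tm_states M}" "acts \<tau> \<in> ?A"
      using transitions_bounds[OF \<tau>] by fastforce+
    ultimately show "\<tau> \<in> {..<tm_states M} \<times> ?R \<times> {..<tm_states M} \<times> ?A"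
      by (simp add: mem_Times_iff)
  qed
  moreover have "finite ({..<tm_states M} \<times> ?R \<times> {..<tm_states M} \<times> ?A)"
    by (intro finite_cartesian_product finite_lists_length_eq) auto
  ultimately show ?thesis by (rule finite_subset)
qed

lemma idle_step_applies:
  assumes "valid_config M c" "idle_step M c c'"
  shows "\<exists>\<tau> \<in> transitions M. applies \<tau> c c'"
proof -
  let ?ss = "map tape_read (snd c)"
  have v: "fst c < tm_states M" "length ?ss = tm_tapes M" "\<forall>s\<in>set ?ss. s < tm_symbols M"
    using assms(1) by (auto simp: valid_config_def tape_read_def)
  from assms(2) consider "tm_step M c c'" | "accepting M c" "c' = c"
    unfolding idle_step_def by blast
  then show ?thesis
  proof cases
    case 1
    then obtain as where "(fst c', as) \<in> tm_delta M (fst c) ?ss" "snd c' = map2 tape_act as (snd c)"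
      unfolding tm_step_def by blast
    then show ?thesis
      using v by (intro bexI[of _ "(fst c, ?ss, fst c', as)"])
        (auto simp: transitions_def applies_def prod_eq_iff)
  next
    case 2
    then show ?thesis
      using v stay_act[of "snd c"] by (intro bexI[of _ "(fst c, ?ss, fst c, stay ?ss)"])
        (auto simp: transitions_def applies_def idle_def accepting_def halted_iff prod_eq_iff)
  qed
qed

lemma accepting_applies:
  assumes "valid_config M c" "accepting M c"
  shows "\<exists>\<tau> \<in> transitions M. idle M \<tau> \<and> applies \<tau> c c"
proof -
  let ?ss = "map tape_read (snd c)"
  have v: "fst c < tm_states M" "length ?ss = tm_tapes M" "\<forall>s\<in>set ?ss. s < tm_symbols M"
    using assms(1) by (auto simp: valid_config_def tape_read_def)
  then show ?thesis
    using assms(2) stay_act[of "snd c"] by (intro bexI[of _ "(fst c, ?ss, fst c, stay ?ss)"])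
      (auto simp: transitions_def applies_def idle_def accepting_def halted_iff prod_eq_iff)
qed

lemma applies_idle_step:
  assumes "\<tau> \<in> transitions M" "applies \<tau> c c'"
  shows "idle_step M c c'"
proof (cases "(tgt \<tau>, acts \<tau>) \<in> tm_delta M (src \<tau>) (reads \<tau>)")
  case True
  have "tm_step M c c'"
    unfolding tm_step_def by (rule exI[of _ "acts \<tau>"]) (use True assms(2) in \<open>simp add: applies_def\<close>)
  then show ?thesis by (simp add: idle_step_def)
next
  case False
  then have "idle M \<tau>" "tgt \<tau> = src \<tau>" "acts \<tau> = stay (reads \<tau>)"
    using assms(1) by (auto simp: transitions_def)
  then show ?thesis
    using assms(2) stay_act[of "snd c"]
    by (auto simp: idle_step_def accepting_def idle_def halted_iff applies_def)
qed

lemma applies_valid: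
  assumes "\<tau> \<in> transitions M" "applies \<tau> c c'" "valid_config M c"
  shows "valid_config M c'"
proof -
  have c': "c' = (tgt \<tau>, map2 tape_act (acts \<tau>) (snd c))" using assms(2) by (simp add: applies_def)
  have "fst (tape_act a t) i < tm_symbols M" if "(a, t) \<in> set (zip (acts \<tau>) (snd c))" for a t i
  proof -
    have "a \<in> set (acts \<tau>)" "t \<in> set (snd c)" using that by (auto dest: set_zip_leftD set_zip_rightD)
    then have "fst a < tm_symbols M" "fst t i < tm_symbols M"
      using transitions_bounds(3)[OF assms(1)] assms(3) by (auto simp: valid_config_def)
    then show ?thesis by (simp add: tape_act_def)
  qed
  then show ?thesis
    using transitions_bounds[OF assms(1)] assms(3) by (auto simp: c' valid_config_def)
qed

lemma valid_config_init: "valid_config M (tm_init M x)"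
  using wf by (auto simp: valid_config_def tm_init_def wf_tm_def word_contents_def)

context
  fixes tr :: "nat \<Rightarrow> trans" and Z :: nat
  assumes tr: "\<forall>v. tr v \<in> transitions M \<or> src (tr v) = tm_states M"
    and tr_surj: "\<forall>\<tau> \<in> transitions M. \<exists>v<Z. tr v = \<tau>"
    and Z: "tm_symbols M \<le> Z"
begin

lemma tableau_sound:
  assumes "tableau M tr P x A"
  shows "\<exists>C. C 0 = tm_init M x \<and> (\<forall>t<length x + P. idle_step M (C t) (C (Suc t))) \<and>
    accepting M (C (length x + P))"
proof -
  define k T where "k = tm_tapes M" and "T = length x + P"
  define \<tau> where "\<tau> t = tr (A t (T + 1) k)" for t
  have rd: "\<And>t j. t \<le> T \<Longrightarrow> j < k \<Longrightarrow> A t (T + 1) j = reads (\<tau> t) ! j"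
    and wr: "\<And>t j. t < T \<Longrightarrow> j < k \<Longrightarrow> A (t + 1) (T + shift (\<tau> t) j) j = fst (acts (\<tau> t) ! j)"
    and shl: "\<And>t i j. t < T \<Longrightarrow> i < T \<Longrightarrow> j < k \<Longrightarrow> A (t + 1) (i + shift (\<tau> t) j) j = A t (i + 1) j"
    and shr: "\<And>t i j. t < T \<Longrightarrow> i < T \<Longrightarrow> j < k \<Longrightarrow>
      A (t + 1) (T + 1 + i + shift (\<tau> t) j) j = A t (T + 2 + i) j"
    and st: "\<And>t. t < T \<Longrightarrow> src (\<tau> (t + 1)) = tgt (\<tau> t)"
    and st0: "src (\<tau> 0) = 0" and fin: "idle M (\<tau> T)"
    and i1: "\<And>i. i < T \<Longrightarrow> A 0 (i + 1) 0 = 0"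
    and i2: "\<And>i. i < length x \<Longrightarrow> A 0 (T + 1 + i) 0 = (if x ! i then 2 else 1)"
    and i3: "\<And>i. i < P + 1 \<Longrightarrow> A 0 (T + 1 + length x + i) 0 = 0"
    and i4: "\<And>i j. i < 2 * T + 3 \<Longrightarrow> j < k \<Longrightarrow> j \<noteq> 0 \<Longrightarrow> A 0 i j = 0"
    using assms unfolding tableau_def Let_def k_def[symmetric] T_def[symmetric] \<tau>_def[symmetric]
    by auto
  have k: "k \<ge> 1" using wf by (simp add: wf_tm_def k_def)
  \<comment> \<open>The transitions alone determine the computation; the cells of the tableau have
    to be shown to agree with it.\<close>
  define C where "C = rec_nat (tm_init M x) (\<lambda>t c. (tgt (\<tau> t), map2 tape_act (acts (\<tau> t)) (snd c)))"
  have C0: "C 0 = tm_init M x" and CSuc: "\<And>t. C (Suc t) = (tgt (\<tau> t), map2 tape_act (acts (\<tau> t)) (snd (C t)))"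
    by (simp_all add: C_def)
  \<comment> \<open>Each step may spoil one more column at either border, so in row \<open>t\<close>
    only the cells up to distance \<open>T - t\<close> from the head are reliable. In row
    \<open>T\<close> this leaves the scanned cell, which suffices for the final test.\<close>
  have inv: "\<tau> t \<in> transitions M \<and> fst (C t) = src (\<tau> t) \<and> length (snd (C t)) = k \<and>
    (\<forall>j<k. \<forall>i. \<bar>i\<bar> \<le> int (T - t) \<longrightarrow> view (snd (C t) ! j) i = A t (nat (int (T + 1) + i)) j)"
    if "t \<le> T" for t
    using that
  proof (induction t)
    case 0
    have "\<tau> 0 \<in> transitions M"
      using tr[rule_format, of "A 0 (T + 1) k"] st0 wf unfolding \<tau>_def by (auto simp: wf_tm_def)
    moreover have "fst (C 0) = src (\<tau> 0)" "length (snd (C 0)) = k"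
      using st0 k by (simp_all add: C0 tm_init_def k_def)
    moreover have "view (snd (C 0) ! j) i = A 0 (nat (int (T + 1) + i)) j"
      if j: "j < k" and i: "\<bar>i\<bar> \<le> int T" for i j
    proof (cases "j = 0")
      case True
      have "view (snd (C 0) ! j) i = word_contents x i"
        by (simp add: True C0 tm_init_def view_def)
      also have "\<dots> = A 0 (nat (int (T + 1) + i)) 0"
      proof -
        consider "i < 0" | "0 \<le> i" "i < int (length x)" | "int (length x) \<le> i" by linarith
        then show ?thesis
        proof cases
          case 1
          then have "nat (int (T + 1) + i) = nat (int T + i) + 1" "nat (int T + i) < T" using i by auto
          then show ?thesis using i1[of "nat (int T + i)"] 1 by (simp add: word_contents_def)
        next
          case 2
          then have "nat (int (T + 1) + i) = T + 1 + nat i" "nat i < length x" using i by auto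
          then show ?thesis using i2[of "nat i"] 2 by (simp add: word_contents_def)
        next
          case 3
          then have "nat (int (T + 1) + i) = T + 1 + length x + nat (i - int (length x))"
            "nat (i - int (length x)) < P + 1" using i by (auto simp: T_def)
          then show ?thesis using i3[of "nat (i - int (length x))"] 3 by (simp add: word_contents_def)
        qed
      qed
      finally show ?thesis using True by simp
    next
      case False
      then have "view (snd (C 0) ! j) i = 0"
        using j by (simp add: C0 tm_init_def view_def k_def word_contents_def)
      moreover have "nat (int (T + 1) + i) < 2 * T + 3" using i by auto
      ultimately show ?thesis using i4 j False by simp
    qed
    ultimately show ?case by simp
  next
    case (Suc t)
    then have t: "t < T" and IH: "\<tau> t \<in> transitions M" "fst (C t) = src (\<tau> t)" "length (snd (C t)) = k"
      "\<And>j i. j < k \<Longrightarrow> \<bar>i\<bar> \<le> int (T - t) \<Longrightarrow> view (snd (C t) ! j) i = A t (nat (int (T + 1) + i)) j"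
      by auto
    note b = transitions_bounds[OF IH(1), folded k_def]
    \<comment> \<open>A value of \<open>tr\<close> outside \<open>transitions M\<close> has source
      \<open>tm_states M\<close>, which is not the target of a transition.\<close>
    have "\<tau> (Suc t) \<in> transitions M"
      using tr[rule_format, of "A (Suc t) (T + 1) k"] st[OF t] b(1) unfolding \<tau>_def by auto
    moreover have "fst (C (Suc t)) = src (\<tau> (Suc t))" "length (snd (C (Suc t))) = k"
      using st[OF t] b(2) IH(3) by (simp_all add: CSuc)
    moreover have "view (snd (C (Suc t)) ! j) i = A (Suc t) (nat (int (T + 1) + i)) j"
      if j: "j < k" and i: "\<bar>i\<bar> \<le> int (T - Suc t)" for i j
    proof -
      define a where "a = acts (\<tau> t) ! j"
      have "a \<in> set (acts (\<tau> t))" using j b(2) by (simp add: a_def)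
      then have d: "snd a \<in> {-1, 0, 1}" using b(3) by (cases a) auto
      have v: "view (snd (C (Suc t)) ! j) i = (if i + snd a = 0 then fst a else view (snd (C t) ! j) (i + snd a))"
        using j b(2) IH(3) by (simp add: CSuc view_act a_def)
      have bd: "\<bar>i + snd a\<bar> \<le> int (T - t)" using i d t by auto
      have sh: "int (shift (\<tau> t) j) = 1 - snd a" using d by (auto simp: shift_def a_def[symmetric])
      \<comment> \<open>\<open>i + snd a\<close> is the position relative to the old head. The cell
        just written, the cells left of it and the cells right of it are governed by different
        clauses of the tableau.\<close>
      consider "i + snd a = 0" | "i + snd a < 0" | "i + snd a > 0" by linarith
      then show ?thesis
      proof cases
        case 1
        then have "nat (int (T + 1) + i) = T + shift (\<tau> t) j" using sh by linarith
        then show ?thesis using wr[OF t j] v 1 by (simp add: a_def)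
      next
        case 2
        define i' where "i' = nat (int T + (i + snd a))"
        have i': "int i' = int T + (i + snd a)" "i' < T" using 2 bd t by (auto simp: i'_def)
        have "nat (int (T + 1) + i) = i' + shift (\<tau> t) j" "nat (int (T + 1) + (i + snd a)) = i' + 1"
          using i'(1) sh by linarith+
        then show ?thesis using shl[OF t i'(2) j] v 2 IH(4)[OF j bd] by simp
      next
        case 3
        define i' where "i' = nat (i + snd a - 1)"
        have i': "int i' = i + snd a - 1" "i' < T" using 3 bd t by (auto simp: i'_def)
        have "nat (int (T + 1) + i) = T + 1 + i' + shift (\<tau> t) j"
          "nat (int (T + 1) + (i + snd a)) = T + 2 + i'"
          using i'(1) sh by linarith+
        then show ?thesis using shr[OF t i'(2) j] v 3 IH(4)[OF j bd] by simp
      qed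
    qed
    ultimately show ?case by simp
  qed
  have ap: "src (\<tau> t) = fst (C t)" "reads (\<tau> t) = map tape_read (snd (C t))" if "t \<le> T" for t
  proof -
    note I = inv[OF that]
    show "src (\<tau> t) = fst (C t)" using I by simp
    show "reads (\<tau> t) = map tape_read (snd (C t))"
    proof (rule nth_equalityI)
      show "length (reads (\<tau> t)) = length (map tape_read (snd (C t)))"
        using I by (simp add: transitions_def k_def)
      fix j assume "j < length (reads (\<tau> t))"
      then have j: "j < k" using I by (simp add: transitions_def k_def)
      have "tape_read (snd (C t) ! j) = A t (nat (int (T + 1) + 0)) j"
        unfolding view_0[symmetric] using I j by (auto simp del: of_nat_add)
      also have "\<dots> = reads (\<tau> t) ! j" using rd[OF that j] by (metis add.right_neutral nat_int)
      finally show "reads (\<tau> t) ! j = map tape_read (snd (C t)) ! j" using I j by simp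
    qed
  qed
  have "idle_step M (C t) (C (Suc t))" if "t < T" for t
    by (rule applies_idle_step[of "\<tau> t"]) (use inv[of t] ap[of t] that in \<open>auto simp: applies_def CSuc\<close>)
  moreover have "accepting M (C T)"
    using fin ap[of T] by (auto simp: idle_def accepting_def halted_iff)
  ultimately show ?thesis using C0 unfolding T_def by blast
qed

lemma tableau_complete:
  assumes C0: "C 0 = tm_init M x" and steps: "\<forall>t<length x + P. idle_step M (C t) (C (Suc t))"
    and acc: "accepting M (C (length x + P))"
  shows "\<exists>A. (\<forall>t i j. j \<le> tm_tapes M \<longrightarrow> A t i j < Z) \<and> tableau M tr P x A"
proof -
  define k T where "k = tm_tapes M" and "T = length x + P"
  have valid: "valid_config M (C t)" if "t \<le> T" for t
    using that
  proof (induction t)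
    case 0
    then show ?case using valid_config_init C0 by simp
  next
    case (Suc t)
    then have "valid_config M (C t)" "idle_step M (C t) (C (Suc t))" using steps by (auto simp: T_def)
    then show ?case using idle_step_applies applies_valid by blast
  qed
  have "\<exists>v<Z. tr v \<in> transitions M \<and> src (tr v) = fst (C t) \<and> reads (tr v) = map tape_read (snd (C t)) \<and>
    (t < T \<longrightarrow> applies (tr v) (C t) (C (Suc t))) \<and> (t = T \<longrightarrow> idle M (tr v))" if "t \<le> T" for t
  proof (cases "t = T")
    case True
    then have "accepting M (C t)" using acc by (simp add: T_def)
    then obtain \<tau> where \<tau>: "\<tau> \<in> transitions M" "idle M \<tau>" "applies \<tau> (C t) (C t)"
      using accepting_applies valid[OF \<open>t \<le> T\<close>] by blast
    then obtain v where "v < Z" "tr v = \<tau>" using tr_surj by blast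
    then show ?thesis using \<tau> True by (intro exI[of _ v]) (simp add: applies_def)
  next
    case False
    then have t: "t < T" using that by simp
    then have "idle_step M (C t) (C (Suc t))" using steps by (simp add: T_def)
    then obtain \<tau> where \<tau>: "\<tau> \<in> transitions M" "applies \<tau> (C t) (C (Suc t))"
      using idle_step_applies valid[OF \<open>t \<le> T\<close>] by blast
    then obtain v where "v < Z" "tr v = \<tau>" using tr_surj by blast
    then show ?thesis using \<tau> t by (intro exI[of _ v]) (simp add: applies_def)
  qed
  then obtain v where v: "\<And>t. t \<le> T \<Longrightarrow> v t < Z" "\<And>t. t \<le> T \<Longrightarrow> tr (v t) \<in> transitions M"
    "\<And>t. t \<le> T \<Longrightarrow> src (tr (v t)) = fst (C t)"
    "\<And>t. t \<le> T \<Longrightarrow> reads (tr (v t)) = map tape_read (snd (C t))"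
    "\<And>t. t < T \<Longrightarrow> applies (tr (v t)) (C t) (C (Suc t))" "idle M (tr (v T))"
    by (metis less_imp_le order_refl)
  \<comment> \<open>The head is in column \<open>T + 1\<close>, hence the offset. Rows beyond
    \<open>T\<close> get the default 0, since the bound on the values is demanded
    everywhere.\<close>
  define A where "A t i j = (if T < t then 0 else if j = k then v t
      else view (snd (C t) ! j) (int i - int (T + 1)))" for t i j
  have Zpos: "0 < Z" using Z wf by (simp add: wf_tm_def)
  have len: "length (snd (C t)) = k" if "t \<le> T" for t
    using valid[OF that] by (simp add: valid_config_def k_def)
  have bounds: "A t i j < Z" if "j \<le> k" for t i j
  proof (cases "T < t \<or> j = k")
    case True
    then show ?thesis using v(1)[of t] Zpos by (auto simp: A_def)
  next
    case False
    then have t: "t \<le> T" "j < k" using that by auto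
    have "snd (C t) ! j \<in> set (snd (C t))" using t len[of t] by simp
    then have "view (snd (C t) ! j) i < tm_symbols M" for i
      using valid[OF t(1)] by (auto simp: valid_config_def view_def)
    then show ?thesis using False Z by (auto simp: A_def intro: less_le_trans)
  qed
  define \<tau> where "\<tau> t = tr (A t (T + 1) k)" for t
  have \<tau>: "\<tau> t = tr (v t)" if "t \<le> T" for t using that by (simp add: \<tau>_def A_def)
  have cell: "A t i j = view (snd (C t) ! j) (int i - int (T + 1))" if "t \<le> T" "j < k" for t i j
    using that by (simp add: A_def)
  have next_cell: "A (t + 1) i j = (let d = snd (acts (\<tau> t) ! j); i' = int i - int (T + 1) + d in
      if i' = 0 then fst (acts (\<tau> t) ! j) else view (snd (C t) ! j) i')"
    and sh: "int (shift (\<tau> t) j) = 1 - snd (acts (\<tau> t) ! j)"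
    if t: "t < T" and j: "j < k" for t i j
  proof -
    have \<tau>t: "\<tau> t \<in> transitions M" "applies (\<tau> t) (C t) (C (Suc t))" using v t \<tau> by auto
    note b = transitions_bounds[OF \<tau>t(1), folded k_def]
    have "snd (C (Suc t)) ! j = tape_act (acts (\<tau> t) ! j) (snd (C t) ! j)"
      using \<tau>t(2) j b(2) len[of t] t by (simp add: applies_def)
    then show "A (t + 1) i j = (let d = snd (acts (\<tau> t) ! j); i' = int i - int (T + 1) + d in
      if i' = 0 then fst (acts (\<tau> t) ! j) else view (snd (C t) ! j) i')"
      using cell[of "t + 1" j i] t j by (simp add: view_act)
    have "acts (\<tau> t) ! j \<in> set (acts (\<tau> t))" using j b(2) by simp
    from bspec[OF b(3) this] have "snd (acts (\<tau> t) ! j) \<in> {-1, 0, 1}"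
      by (simp add: case_prod_beta)
    then show "int (shift (\<tau> t) j) = 1 - snd (acts (\<tau> t) ! j)" by (auto simp: shift_def)
  qed
  have rd: "A t (T + 1) j = reads (\<tau> t) ! j" if "t < T + 1" "j < k" for t j
    using cell[of t j "T + 1"] v(4)[of t] \<tau>[of t] that len[of t] by (simp add: view_0)
  have wr: "A (t + 1) (T + shift (\<tau> t) j) j = fst (acts (\<tau> t) ! j)" if "t < T" "j < k" for t j
    using next_cell[OF that, of "T + shift (\<tau> t) j"] sh[OF that] by simp
  have shl: "A (t + 1) (i + shift (\<tau> t) j) j = A t (i + 1) j" if "t < T" "i < T" "j < k" for t i j
    using next_cell[OF that(1,3), of "i + shift (\<tau> t) j"] sh[OF that(1,3)] cell[of t j "i + 1"] that
    by (simp add: Let_def)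
  have shr: "A (t + 1) (T + 1 + i + shift (\<tau> t) j) j = A t (T + 2 + i) j" if "t < T" "i < T" "j < k" for t i j
    using next_cell[OF that(1,3), of "T + 1 + i + shift (\<tau> t) j"] sh[OF that(1,3)]
      cell[of t j "T + 2 + i"] that
    by (simp add: Let_def)
  have st: "src (\<tau> (t + 1)) = tgt (\<tau> t)" if "t < T" for t
    using v(3)[of "Suc t"] v(5)[of t] \<tau>[of t] \<tau>[of "Suc t"] that by (simp add: applies_def)
  have init: "A 0 i j = (if j = 0 then word_contents x (int i - int (T + 1)) else 0)" if "j < k" for i j
    using cell[of 0 j i] that by (cases j) (simp_all add: C0 tm_init_def view_def k_def word_contents_def)
  have k0: "0 < k" using wf by (simp add: wf_tm_def k_def)
  have "tableau M tr P x A"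
    unfolding tableau_def Let_def k_def[symmetric] T_def[symmetric] \<tau>_def[symmetric]
  proof (intro conjI allI impI)
    show "src (\<tau> 0) = 0" using v(3)[of 0] \<tau>[of 0] by (simp add: C0 tm_init_def)
    show "idle M (\<tau> T)" using v(6) \<tau>[of T] by simp
    show "A 0 (i + 1) 0 = 0" if "i < T" for i
      using init[OF k0] that by (simp add: word_contents_def)
    show "A 0 (T + 1 + i) 0 = (if x ! i then 2 else 1)" if "i < length x" for i
      using init[OF k0] that by (simp add: word_contents_def)
    show "A 0 (T + 1 + length x + i) 0 = 0" for i
      using init[OF k0] by (simp add: word_contents_def)
    show "A 0 i j = 0" if "j < k" "j \<noteq> 0" for i j
      using init[OF that(1)] that by simp
  qed (use rd wr shl shr st in auto)
  then show ?thesis using bounds unfolding k_def by blast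
qed

lemma tableau_iff:
  "(\<exists>A. (\<forall>t i j. j \<le> tm_tapes M \<longrightarrow> A t i j < Z) \<and> tableau M tr P x A) \<longleftrightarrow>
   (\<exists>C. C 0 = tm_init M x \<and> (\<forall>t<length x + P. idle_step M (C t) (C (Suc t))) \<and>
     accepting M (C (length x + P)))"
  using tableau_sound tableau_complete by blast

end

end

section \<open>Tableaux as constraint satisfaction problems\<close>

text \<open>A rule \<open>(b, r, c, cells)\<close> forbids, for each of its sites \<open>(t, i)\<close>, that all its cells have the
  given values. The sites are the pairs below \<open>(r, c)\<close> or, if \<open>b\<close> is a bit, the input positions \<open>i\<close>
  holding that bit, with \<open>t = 0\<close>. A cell consists of row, column, variable, and value. In these
  expressions, variables 0, 1, 2 are the length of the input, \<open>t\<close>, and \<open>i\<close>.\<close>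

type_synonym cell = "expr \<times> expr \<times> nat \<times> nat"
type_synonym rule = "bool option \<times> expr \<times> expr \<times> cell list"

definition input_env :: "bool list \<Rightarrow> nat \<Rightarrow> nat" where
  "input_env x = (\<lambda>_. 0)(0 := length x)"

definition site_env :: "bool list \<Rightarrow> nat \<times> nat \<Rightarrow> nat \<Rightarrow> nat" where
  "site_env x s = (input_env x)(1 := fst s, 2 := snd s)"

text \<open>The ranges are reversed because the loops of generators run downwards; so the classes
  appear in the order in which they are generated.\<close>

fun sites :: "bool list \<Rightarrow> rule \<Rightarrow> (nat \<times> nat) list" where
  "sites x (None, r, c, cs) = List.product (rev [0..<val r (input_env x)]) (rev [0..<val c (input_env x)])"
| "sites x (Some b, r, c, cs) = map (Pair 0) (filter (\<lambda>i. x ! i = b) [0..<length x])"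

definition cells :: "rule \<Rightarrow> cell list" where "cells r = snd (snd (snd r))"

definition cell_at :: "bool list \<Rightarrow> nat \<times> nat \<Rightarrow> cell \<Rightarrow> nat \<times> nat \<times> nat \<times> nat" where
  "cell_at x s = (\<lambda>(r, c, j, v). (val r (site_env x s), val c (site_env x s), j, v))"

definition obeys :: "(nat \<Rightarrow> nat \<Rightarrow> nat \<Rightarrow> nat) \<Rightarrow> bool list \<Rightarrow> rule \<Rightarrow> bool" where
  "obeys A x r \<longleftrightarrow> (\<forall>s \<in> set (sites x r). \<exists>(t, i, j, v) \<in> cell_at x s ` set (cells r). A t i j \<noteq> v)"

lemma set_sites_None:
  "set (sites x (None, r, c, cs)) = {..<val r (input_env x)} \<times> {..<val c (input_env x)}"
  by auto

lemma set_sites_Some: "set (sites x (Some b, r, c, cs)) = {0} \<times> {i. i < length x \<and> x ! i = b}"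
  by auto

lemma distinct_sites: "distinct (sites x r)"
  by (cases "(x, r)" rule: sites.cases) (simp_all add: distinct_product distinct_map inj_on_def)

lemma site_env_simps [simp]:
  "site_env x s 0 = length x" "site_env x s (Suc 0) = fst s" "site_env x s 2 = snd s"
  "input_env x 0 = length x"
  by (simp_all add: site_env_def input_env_def)

lemma val_site_env: "below 1 e \<Longrightarrow> val e (site_env x s) = val e (input_env x)"
  by (rule val_cong) (auto simp: site_env_def input_env_def)

definition wf_rule :: "rule \<Rightarrow> bool" where
  "wf_rule r \<longleftrightarrow> below 1 (fst (snd r)) \<and> below 1 (fst (snd (snd r))) \<and>
     (\<forall>(re, ce, j, v) \<in> set (cells r). below 3 re \<and> below 3 ce)"

text \<open>Bounds on the sites keep the tags apart, and distinct cells inside the grid turn into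
  class members without repetitions.\<close>

definition fits :: "nat \<Rightarrow> nat \<Rightarrow> nat \<Rightarrow> nat \<Rightarrow> bool list \<Rightarrow> rule \<Rightarrow> bool" where
  "fits H W k Z x r \<longleftrightarrow> (\<forall>s \<in> set (sites x r). fst s < H \<and> snd s < W \<and>
     distinct (map (cell_at x s) (cells r)) \<and>
     cell_at x s ` set (cells r) \<subseteq> {..<H} \<times> {..<W} \<times> {..k} \<times> {..<Z})"

context
  fixes M :: tm and tr :: "nat \<Rightarrow> trans" and Z :: nat and PE :: expr
begin

abbreviation "TE \<equiv> Plus (Var 0) PE"
abbreviation "CE \<equiv> Plus TE (Const 1)"
abbreviation "WE \<equiv> Plus (Plus TE TE) (Const 3)"

text \<open>An equation is expressed by forbidding all other values below \<open>Z\<close>. The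
  bound \<open>Const 1\<close> makes the site consist of a row only.\<close>

definition rules_read :: "rule list" where
  "rules_read = [(None, CE, Const 1, [(Var 1, CE, tm_tapes M, v), (Var 1, CE, j, s)]).
     v \<leftarrow> [0..<Z], j \<leftarrow> [0..<tm_tapes M], s \<leftarrow> [0..<Z], s \<noteq> reads (tr v) ! j]"

definition rules_write :: "rule list" where
  "rules_write = [(None, TE, Const 1, [(Var 1, CE, tm_tapes M, v),
       (Plus (Var 1) (Const 1), Plus TE (Const (shift (tr v) j)), j, s)]).
     v \<leftarrow> [0..<Z], j \<leftarrow> [0..<tm_tapes M], s \<leftarrow> [0..<Z], s \<noteq> fst (acts (tr v) ! j)]"

text \<open>The value \<open>v\<close> of the transition variable is part of the combination, so the
  displacement \<open>shift (tr v) j\<close> is a constant. Forbidding every \<open>s'\<close> other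
  than \<open>s\<close> amounts to copying the cell.\<close>

definition rules_left :: "rule list" where
  "rules_left = [(None, TE, TE, [(Var 1, CE, tm_tapes M, v), (Var 1, Plus (Var 2) (Const 1), j, s),
       (Plus (Var 1) (Const 1), Plus (Var 2) (Const (shift (tr v) j)), j, s')]).
     v \<leftarrow> [0..<Z], j \<leftarrow> [0..<tm_tapes M], s \<leftarrow> [0..<Z], s' \<leftarrow> [0..<Z], s' \<noteq> s]"

definition rules_right :: "rule list" where
  "rules_right = [(None, TE, TE, [(Var 1, CE, tm_tapes M, v),
       (Var 1, Plus (Plus TE (Const 2)) (Var 2), j, s),
       (Plus (Var 1) (Const 1), Plus (Plus CE (Var 2)) (Const (shift (tr v) j)), j, s')]).
     v \<leftarrow> [0..<Z], j \<leftarrow> [0..<tm_tapes M], s \<leftarrow> [0..<Z], s' \<leftarrow> [0..<Z], s' \<noteq> s]"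

definition rules_state :: "rule list" where
  "rules_state = [(None, TE, Const 1, [(Var 1, CE, tm_tapes M, v),
       (Plus (Var 1) (Const 1), CE, tm_tapes M, v')]).
     v \<leftarrow> [0..<Z], v' \<leftarrow> [0..<Z], src (tr v') \<noteq> tgt (tr v)]"

definition rules_ends :: "rule list" where
  "rules_ends =
     [(None, Const 1, Const 1, [(Const 0, CE, tm_tapes M, v)]). v \<leftarrow> [0..<Z], src (tr v) \<noteq> 0] @
     [(None, Const 1, Const 1, [(TE, CE, tm_tapes M, v)]). v \<leftarrow> [0..<Z], \<not> idle M (tr v)]"

definition rules_blank_left :: "rule list" where
  "rules_blank_left =
     [(None, Const 1, TE, [(Const 0, Plus (Var 2) (Const 1), 0, s)]). s \<leftarrow> [0..<Z], s \<noteq> 0]"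

definition rules_input :: "rule list" where
  "rules_input =
     [(Some False, Const 1, Const 1, [(Const 0, Plus CE (Var 2), 0, s)]). s \<leftarrow> [0..<Z], s \<noteq> 1] @
     [(Some True, Const 1, Const 1, [(Const 0, Plus CE (Var 2), 0, s)]). s \<leftarrow> [0..<Z], s \<noteq> 2]"

definition rules_blank_right :: "rule list" where
  "rules_blank_right = [(None, Const 1, Plus PE (Const 1),
     [(Const 0, Plus (Plus CE (Var 0)) (Var 2), 0, s)]). s \<leftarrow> [0..<Z], s \<noteq> 0]"

definition rules_blank_tapes :: "rule list" where
  "rules_blank_tapes = [(None, Const 1, WE, [(Const 0, Var 2, j, s)]).
     j \<leftarrow> [0..<tm_tapes M], j \<noteq> 0, s \<leftarrow> [0..<Z], s \<noteq> 0]"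

definition rules :: "rule list" where
  "rules = rules_read @ rules_write @ rules_left @ rules_right @ rules_state @ rules_ends @
     rules_blank_left @ rules_input @ rules_blank_right @ rules_blank_tapes"

context
  assumes PE: "below 1 PE" and k: "tm_tapes M \<ge> 1"
    and shift: "\<forall>v. \<forall>j < tm_tapes M. shift (tr v) j \<le> 2"
begin

lemma wf_rules: "r \<in> set rules \<Longrightarrow> wf_rule r"
proof -
  have "below 3 PE" "below (Suc 0) PE" using PE below_mono[of 1 PE 3] by auto
  then show "r \<in> set rules \<Longrightarrow> wf_rule r"
    unfolding rules_def rules_read_def rules_write_def rules_left_def rules_right_def rules_state_def
      rules_ends_def rules_blank_left_def rules_input_def rules_blank_right_def rules_blank_tapes_def
    by (auto simp: wf_rule_def cells_def)
qed

lemma PE_site: "val PE (site_env x s) = val PE (input_env x)"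
  using PE by (rule val_site_env)

lemma ball_Times: "(\<forall>s \<in> S \<times> T. Q s) \<longleftrightarrow> (\<forall>t \<in> S. \<forall>i \<in> T. Q (t, i))"
  by blast

lemma fits_alt: "fits H W k Z x r \<longleftrightarrow> (\<forall>s \<in> set (sites x r). fst s < H \<and> snd s < W \<and>
    distinct (map (cell_at x s) (cells r)) \<and> (\<forall>(re, ce, j, v) \<in> set (cells r).
      val re (site_env x s) < H \<and> val ce (site_env x s) < W \<and> j \<le> k \<and> v < Z))"
  by (simp add: fits_def cell_at_def case_prod_beta image_subset_iff mem_Times_iff)

lemma fits_None: "fits H W k Z x (None, r, c, cs) \<longleftrightarrow>
    (\<forall>t < val r (input_env x). \<forall>i < val c (input_env x). t < H \<and> i < W \<and>
      distinct (map (cell_at x (t, i)) cs) \<and> (\<forall>(re, ce, j, v) \<in> set cs.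
        val re (site_env x (t, i)) < H \<and> val ce (site_env x (t, i)) < W \<and> j \<le> k \<and> v < Z))"
  unfolding fits_alt set_sites_None ball_Times by (simp add: cells_def Ball_def)

lemma fits_Some: "fits H W k Z x (Some b, r, c, cs) \<longleftrightarrow>
    (\<forall>i < length x. x ! i = b \<longrightarrow> 0 < H \<and> i < W \<and>
      distinct (map (cell_at x (0, i)) cs) \<and> (\<forall>(re, ce, j, v) \<in> set cs.
        val re (site_env x (0, i)) < H \<and> val ce (site_env x (0, i)) < W \<and> j \<le> k \<and> v < Z))"
  unfolding fits_alt set_sites_Some ball_Times by (simp add: cells_def Ball_def imp_conjL)

text \<open>The head column \<open>T + 1\<close> has \<open>T + 1\<close> columns on either side:
  \<open>T\<close> of them are copied to the next row, and one more is needed because a shift of 0,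
  1 or 2 moves a cell by at most one column. Hence the width \<open>2 * T + 3\<close>.\<close>

lemma fits_rules:
  assumes T: "T = length x + val PE (input_env x)" and r: "r \<in> set rules"
  shows "fits (T + 1) (2 * T + 3) (tm_tapes M) Z x r"
proof -
  define P where "P = val PE (input_env x)"
  have PE': "val PE (site_env x s) = P" "val PE (input_env x) = P" for s using PE_site P_def by simp_all
  note d = fits_None fits_Some cell_at_def PE' T Int_iff mem_Collect_eq
  have sh: "shift (tr v) j < 3" if "j < tm_tapes M" for v j using shift that by (simp add: le_imp_less_Suc numeral_3_eq_3 numeral_2_eq_2)
  have sh1: "i + shift (tr v) j < 2 * (length x + P) + 3" if "j < tm_tapes M" "i < length x + P" for i v j
    using sh[OF that(1), of v] that(2) by auto
  have sh2: "length x + P + 1 + i + shift (tr v) j < 2 * (length x + P) + 3"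
    if "j < tm_tapes M" "i < length x + P" for i v j
    using sh[OF that(1), of v] that(2) by auto
  have sh0: "length x + P + shift (tr v) j < 2 * (length x + P) + 3" if "j < tm_tapes M" for v j
    using sh[OF that(1), of v] by auto
  have "\<forall>r \<in> set rules_read. fits (T + 1) (2 * T + 3) (tm_tapes M) Z x r"
    by (simp add: rules_read_def d)
  moreover have "\<forall>r \<in> set rules_write. fits (T + 1) (2 * T + 3) (tm_tapes M) Z x r"
    using sh0 by (simp add: rules_write_def d)
  moreover have "\<forall>r \<in> set rules_left. fits (T + 1) (2 * T + 3) (tm_tapes M) Z x r"
    using sh1 by (simp add: rules_left_def d)
  moreover have "\<forall>r \<in> set rules_right. fits (T + 1) (2 * T + 3) (tm_tapes M) Z x r"
    using sh2 by (simp add: rules_right_def d)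
  moreover have "\<forall>r \<in> set rules_state. fits (T + 1) (2 * T + 3) (tm_tapes M) Z x r"
    by (simp add: rules_state_def d)
  moreover have "\<forall>r \<in> set rules_ends. fits (T + 1) (2 * T + 3) (tm_tapes M) Z x r"
    by (simp add: rules_ends_def d ball_Un)
  moreover have "\<forall>r \<in> set rules_blank_left. fits (T + 1) (2 * T + 3) (tm_tapes M) Z x r"
    by (simp add: rules_blank_left_def d)
  moreover have "\<forall>r \<in> set rules_input. fits (T + 1) (2 * T + 3) (tm_tapes M) Z x r"
    by (simp add: rules_input_def d ball_Un)
  moreover have "\<forall>r \<in> set rules_blank_right. fits (T + 1) (2 * T + 3) (tm_tapes M) Z x r"
    by (simp add: rules_blank_right_def d)
  moreover have "\<forall>r \<in> set rules_blank_tapes. fits (T + 1) (2 * T + 3) (tm_tapes M) Z x r"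
    by (simp add: rules_blank_tapes_def d)
  ultimately show ?thesis using r unfolding rules_def set_append Un_iff by blast
qed

lemma obeys_alt: "obeys A x r \<longleftrightarrow> (\<forall>s \<in> set (sites x r).
    \<not> (\<forall>(re, ce, j, v) \<in> set (cells r). A (val re (site_env x s)) (val ce (site_env x s)) j = v))"
  by (simp add: obeys_def cell_at_def case_prod_beta)

lemma obeys_None: "obeys A x (None, r, c, cs) \<longleftrightarrow>
    (\<forall>t < val r (input_env x). \<forall>i < val c (input_env x).
      \<not> (\<forall>(re, ce, j, v) \<in> set cs. A (val re (site_env x (t, i))) (val ce (site_env x (t, i))) j = v))"
  unfolding obeys_alt set_sites_None ball_Times by (simp add: cells_def Ball_def)

lemma obeys_Some: "obeys A x (Some b, r, c, cs) \<longleftrightarrow>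
    (\<forall>i < length x. x ! i = b \<longrightarrow>
      \<not> (\<forall>(re, ce, j, v) \<in> set cs. A (val re (site_env x (0, i))) (val ce (site_env x (0, i))) j = v))"
  unfolding obeys_alt set_sites_Some ball_Times by (simp add: cells_def Ball_def imp_conjL)

text \<open>Only for values below \<open>Z\<close> do the forbidden combinations amount to
  equations. Given this, each list of rules yields its own clauses of
  \<open>tableau\<close>.\<close>

lemma obeys_rules:
  assumes A: "\<And>t i j. j \<le> tm_tapes M \<Longrightarrow> A t i j < Z" and P: "P = val PE (input_env x)"
  shows "(\<forall>r \<in> set rules. obeys A x r) \<longleftrightarrow> tableau M tr P x A"
proof -
  define k n T where "k = tm_tapes M" and "n = length x" and "T = n + P"
  define \<tau> where "\<tau> t = tr (A t (T + 1) k)" for t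
  have PE': "val PE (site_env x s) = P" for s using PE_site P by simp
  note d = obeys_None obeys_Some PE' P[symmetric] k_def[symmetric] n_def[symmetric] T_def[symmetric]
    add.assoc
  have Ak: "A t i k < Z" for t i using A by (simp add: k_def)
  have Aj: "A t i j < Z" if "j < k" for t i j using A that by (simp add: k_def)
  have k0: "0 < k" using k by (simp add: k_def)
  have "(\<forall>r \<in> set rules_read. obeys A x r) \<longleftrightarrow> (\<forall>v<Z. \<forall>j<k. \<forall>s<Z. s \<noteq> reads (tr v) ! j \<longrightarrow>
     (\<forall>t<T + 1. A t (T + 1) k = v \<longrightarrow> A t (T + 1) j \<noteq> s))"
    by (simp add: rules_read_def d) (auto simp: Ball_def; blast)
  also have "\<dots> \<longleftrightarrow> (\<forall>t<T + 1. \<forall>j<k. A t (T + 1) j = reads (\<tau> t) ! j)"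
    unfolding \<tau>_def using Ak Aj by blast
  finally have read: "(\<forall>r \<in> set rules_read. obeys A x r) \<longleftrightarrow>
      (\<forall>t<T + 1. \<forall>j<k. A t (T + 1) j = reads (\<tau> t) ! j)" .
  have "(\<forall>r \<in> set rules_write. obeys A x r) \<longleftrightarrow> (\<forall>v<Z. \<forall>j<k. \<forall>s<Z. s \<noteq> fst (acts (tr v) ! j) \<longrightarrow>
     (\<forall>t<T. A t (T + 1) k = v \<longrightarrow> A (t + 1) (T + shift (tr v) j) j \<noteq> s))"
    by (simp add: rules_write_def d) (auto simp: Ball_def; blast)
  also have "\<dots> \<longleftrightarrow> (\<forall>t<T. \<forall>j<k. A (t + 1) (T + shift (\<tau> t) j) j = fst (acts (\<tau> t) ! j))"
    unfolding \<tau>_def using Ak Aj by blast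
  finally have wr: "(\<forall>r \<in> set rules_write. obeys A x r) \<longleftrightarrow>
      (\<forall>t<T. \<forall>j<k. A (t + 1) (T + shift (\<tau> t) j) j = fst (acts (\<tau> t) ! j))" .
  have "(\<forall>r \<in> set rules_left. obeys A x r) \<longleftrightarrow> (\<forall>v<Z. \<forall>j<k. \<forall>s<Z. \<forall>s'<Z. s' \<noteq> s \<longrightarrow>
     (\<forall>t<T. \<forall>i<T. A t (T + 1) k = v \<longrightarrow> A t (i + 1) j = s \<longrightarrow> A (t + 1) (i + shift (tr v) j) j \<noteq> s'))"
    by (simp add: rules_left_def d) (auto simp: Ball_def; blast)
  also have "\<dots> \<longleftrightarrow> (\<forall>t<T. \<forall>i<T. \<forall>j<k. A (t + 1) (i + shift (\<tau> t) j) j = A t (i + 1) j)"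
    unfolding \<tau>_def using Ak Aj by blast
  finally have left: "(\<forall>r \<in> set rules_left. obeys A x r) \<longleftrightarrow>
      (\<forall>t<T. \<forall>i<T. \<forall>j<k. A (t + 1) (i + shift (\<tau> t) j) j = A t (i + 1) j)" .
  have "(\<forall>r \<in> set rules_right. obeys A x r) \<longleftrightarrow> (\<forall>v<Z. \<forall>j<k. \<forall>s<Z. \<forall>s'<Z. s' \<noteq> s \<longrightarrow>
     (\<forall>t<T. \<forall>i<T. A t (T + 1) k = v \<longrightarrow> A t (T + 2 + i) j = s \<longrightarrow>
        A (t + 1) (T + 1 + i + shift (tr v) j) j \<noteq> s'))"
    by (simp add: rules_right_def d) (auto simp: Ball_def; blast)
  also have "\<dots> \<longleftrightarrow> (\<forall>t<T. \<forall>i<T. \<forall>j<k.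
      A (t + 1) (T + 1 + i + shift (\<tau> t) j) j = A t (T + 2 + i) j)"
    unfolding \<tau>_def using Ak Aj by blast
  finally have right: "(\<forall>r \<in> set rules_right. obeys A x r) \<longleftrightarrow> (\<forall>t<T. \<forall>i<T. \<forall>j<k.
      A (t + 1) (T + 1 + i + shift (\<tau> t) j) j = A t (T + 2 + i) j)" .
  have "(\<forall>r \<in> set rules_state. obeys A x r) \<longleftrightarrow> (\<forall>v<Z. \<forall>v'<Z. src (tr v') \<noteq> tgt (tr v) \<longrightarrow>
     (\<forall>t<T. A t (T + 1) k = v \<longrightarrow> A (t + 1) (T + 1) k \<noteq> v'))"
    by (simp add: rules_state_def d) (auto simp: Ball_def; blast)
  also have "\<dots> \<longleftrightarrow> (\<forall>t<T. src (\<tau> (t + 1)) = tgt (\<tau> t))"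
    unfolding \<tau>_def using Ak by blast
  finally have state: "(\<forall>r \<in> set rules_state. obeys A x r) \<longleftrightarrow> (\<forall>t<T. src (\<tau> (t + 1)) = tgt (\<tau> t))" .
  have "(\<forall>r \<in> set rules_ends. obeys A x r) \<longleftrightarrow>
     (\<forall>v<Z. src (tr v) \<noteq> 0 \<longrightarrow> A 0 (T + 1) k \<noteq> v) \<and> (\<forall>v<Z. \<not> idle M (tr v) \<longrightarrow> A T (T + 1) k \<noteq> v)"
    by (simp add: rules_ends_def d ball_Un) (auto simp: Ball_def; blast)
  also have "\<dots> \<longleftrightarrow> src (\<tau> 0) = 0 \<and> idle M (\<tau> T)"
    unfolding \<tau>_def using Ak[of 0] Ak[of T] by metis
  finally have ends: "(\<forall>r \<in> set rules_ends. obeys A x r) \<longleftrightarrow> src (\<tau> 0) = 0 \<and> idle M (\<tau> T)" .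
  have "(\<forall>r \<in> set rules_blank_left. obeys A x r) \<longleftrightarrow>
     (\<forall>s<Z. s \<noteq> 0 \<longrightarrow> (\<forall>i<T. A 0 (i + 1) 0 \<noteq> s))"
    by (simp add: rules_blank_left_def d) (auto simp: Ball_def; blast)
  also have "\<dots> \<longleftrightarrow> (\<forall>i<T. A 0 (i + 1) 0 = 0)"
    using Aj[OF k0] by metis
  finally have blank_left: "(\<forall>r \<in> set rules_blank_left. obeys A x r) \<longleftrightarrow> (\<forall>i<T. A 0 (i + 1) 0 = 0)" .
  have "(\<forall>r \<in> set rules_input. obeys A x r) \<longleftrightarrow>
     (\<forall>s<Z. s \<noteq> 1 \<longrightarrow> (\<forall>i<n. \<not> x ! i \<longrightarrow> A 0 (T + 1 + i) 0 \<noteq> s)) \<and>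
     (\<forall>s<Z. s \<noteq> 2 \<longrightarrow> (\<forall>i<n. x ! i \<longrightarrow> A 0 (T + 1 + i) 0 \<noteq> s))"
    by (simp add: rules_input_def d ball_Un) (auto simp: Ball_def; blast)
  also have "\<dots> \<longleftrightarrow> (\<forall>i<n. \<not> x ! i \<longrightarrow> A 0 (T + 1 + i) 0 = 1) \<and>
     (\<forall>i<n. x ! i \<longrightarrow> A 0 (T + 1 + i) 0 = 2)"
    using Aj[OF k0] by blast
  also have "\<dots> \<longleftrightarrow> (\<forall>i<n. A 0 (T + 1 + i) 0 = (if x ! i then 2 else 1))"
    by auto
  finally have input: "(\<forall>r \<in> set rules_input. obeys A x r) \<longleftrightarrow>
     (\<forall>i<n. A 0 (T + 1 + i) 0 = (if x ! i then 2 else 1))" .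
  have "(\<forall>r \<in> set rules_blank_right. obeys A x r) \<longleftrightarrow>
     (\<forall>s<Z. s \<noteq> 0 \<longrightarrow> (\<forall>i<P + 1. A 0 (T + 1 + n + i) 0 \<noteq> s))"
    by (simp add: rules_blank_right_def d) (auto simp: Ball_def; blast)
  also have "\<dots> \<longleftrightarrow> (\<forall>i<P + 1. A 0 (T + 1 + n + i) 0 = 0)"
    using Aj[OF k0] by metis
  finally have blank_right: "(\<forall>r \<in> set rules_blank_right. obeys A x r) \<longleftrightarrow>
     (\<forall>i<P + 1. A 0 (T + 1 + n + i) 0 = 0)" .
  have W: "val WE (input_env x) = 2 * T + 3" by (simp add: T_def n_def P)
  have "(\<forall>r \<in> set rules_blank_tapes. obeys A x r) \<longleftrightarrow>
     (\<forall>j<k. j \<noteq> 0 \<longrightarrow> (\<forall>s<Z. s \<noteq> 0 \<longrightarrow> (\<forall>i<2 * T + 3. A 0 i j \<noteq> s)))"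
    by (simp add: rules_blank_tapes_def obeys_None W k_def[symmetric] del: val.simps(3))
      (auto simp: Ball_def; blast)
  also have "\<dots> \<longleftrightarrow> (\<forall>i<2 * T + 3. \<forall>j<k. j \<noteq> 0 \<longrightarrow> A 0 i j = 0)"
  proof (intro iffI allI impI)
    fix i j
    assume *: "\<forall>j<k. j \<noteq> 0 \<longrightarrow> (\<forall>s<Z. s \<noteq> 0 \<longrightarrow> (\<forall>i<2 * T + 3. A 0 i j \<noteq> s))"
      "i < 2 * T + 3" "j < k" "j \<noteq> 0"
    show "A 0 i j = 0" using *(1)[rule_format, OF *(3,4) Aj[OF *(3), of 0 i] _ *(2)] by auto
  qed auto
  finally have blank_tapes: "(\<forall>r \<in> set rules_blank_tapes. obeys A x r) \<longleftrightarrow>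
     (\<forall>i<2 * T + 3. \<forall>j<k. j \<noteq> 0 \<longrightarrow> A 0 i j = 0)" .
  show ?thesis
    unfolding rules_def set_append ball_Un tableau_def Let_def k_def[symmetric] n_def[symmetric]
      T_def[symmetric] \<tau>_def[symmetric] read wr left right state ends blank_left input blank_right blank_tapes
    by (simp only: conj_assoc)
qed

end

end

section \<open>Numbering grid variables, their values and the tags in mixed radix\<close>

definition var_index :: "nat \<Rightarrow> nat \<Rightarrow> nat \<Rightarrow> nat \<Rightarrow> nat \<Rightarrow> nat" where
  "var_index W k t i j = (t * W + i) * (k + 1) + j"

text \<open>Follows the numbering of \<open>csp_classes\<close>: the quotient by \<open>Z\<close> is
  the variable, the remainder is the value.\<close>

definition addr :: "nat \<Rightarrow> nat \<Rightarrow> nat \<Rightarrow> nat \<times> nat \<times> nat \<times> nat \<Rightarrow> nat" where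
  "addr W k Z = (\<lambda>(t, i, j, v). var_index W k t i j * Z + v)"

text \<open>The rule number is the last digit. For \<open>i < W\<close> and \<open>f < F\<close>,
  different sites or different rules therefore get different tags.\<close>

definition tag :: "nat \<Rightarrow> nat \<Rightarrow> nat \<Rightarrow> nat \<times> nat \<Rightarrow> nat" where
  "tag W F f = (\<lambda>(t, i). (t * W + i) * F + f)"

definition constraints :: "bool list \<Rightarrow> nat \<Rightarrow> nat \<Rightarrow> nat \<Rightarrow> rule list \<Rightarrow> (nat \<times> nat list) list" where
  "constraints x W k Z rs = concat (map (\<lambda>f. map (\<lambda>s.
     (tag W (length rs) f s, map (addr W k Z \<circ> cell_at x s) (cells (rs ! f)))) (sites x (rs ! f)))
     [0..<length rs])"

lemma mixed_radix_less: "a * n + b < m * n" if "a < m" "b < n" for a b m n :: nat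
proof -
  have "a * n + b < Suc a * n" "Suc a * n \<le> m * n" using that by (simp, intro mult_le_mono1) simp
  then show ?thesis by linarith
qed

lemma mixed_radix_div_mod: "(a * n + b) div n = a" "(a * n + b) mod n = b" if "b < n" for a b n :: nat
  using that by simp_all

lemma var_index_less: "t < H \<Longrightarrow> i < W \<Longrightarrow> j \<le> k \<Longrightarrow> var_index W k t i j < H * W * (k + 1)"
  unfolding var_index_def by (intro mixed_radix_less) auto

lemma var_index_decode:
  assumes "i < W" "j \<le> k"
  shows "var_index W k t i j div (k + 1) div W = t" "var_index W k t i j div (k + 1) mod W = i"
    "var_index W k t i j mod (k + 1) = j"
  unfolding var_index_def using assms
  by (simp_all only: mixed_radix_div_mod less_Suc_eq_le Suc_eq_plus1[symmetric])

lemma addr_decode: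
  assumes "v < Z"
  shows "addr W k Z (t, i, j, v) div Z = var_index W k t i j" "addr W k Z (t, i, j, v) mod Z = v"
  using assms by (simp_all add: addr_def)

lemma inj_addr: "inj_on (addr W k Z) ({..<H} \<times> {..<W} \<times> {..k} \<times> {..<Z})"
proof (rule inj_onI)
  fix c c' :: "nat \<times> nat \<times> nat \<times> nat"
  assume mem: "c \<in> {..<H} \<times> {..<W} \<times> {..k} \<times> {..<Z}" "c' \<in> {..<H} \<times> {..<W} \<times> {..k} \<times> {..<Z}"
    and "addr W k Z c = addr W k Z c'"
  moreover obtain t i j v t' i' j' v' where c: "c = (t, i, j, v)" "c' = (t', i', j', v')"
    by (metis surj_pair)
  ultimately have eq: "addr W k Z (t, i, j, v) = addr W k Z (t', i', j', v')" by simp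
  have less: "v < Z" "v' < Z" "i < W" "i' < W" "j \<le> k" "j' \<le> k" using mem by (simp_all add: c)
  have "v = v'" using eq less(1,2) addr_decode(2) by metis
  moreover have v: "var_index W k t i j = var_index W k t' i' j'"
    using eq less(1,2) addr_decode(1) by metis
  have "t = t'" "i = i'" "j = j'"
    using var_index_decode[OF less(3,5)] var_index_decode[OF less(4,6)] v by metis+
  ultimately show "c = c'" by (simp add: c)
qed

lemma distinct_concat_map:
  assumes "distinct xs" "\<And>x. x \<in> set xs \<Longrightarrow> distinct (h x)"
    "\<And>x y. x \<in> set xs \<Longrightarrow> y \<in> set xs \<Longrightarrow> x \<noteq> y \<Longrightarrow> set (h x) \<inter> set (h y) = {}"
  shows "distinct (concat (map h xs))"
  using assms
proof (induction xs)
  case (Cons x xs)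
  have "set (h x) \<inter> set (h y) = {}" if "y \<in> set xs" for y
    by (rule Cons.prems(3)) (use that Cons.prems(1) in auto)
  then have "set (h x) \<inter> set (concat (map h xs)) = {}" by auto
  moreover have "distinct (concat (map h xs))"
    by (rule Cons.IH) (use Cons.prems in auto)
  ultimately show ?case using Cons.prems(2)[of x] by simp
qed simp

context
  fixes x :: "bool list" and H W k Z :: nat and rs :: "rule list"
  assumes fits: "\<forall>r \<in> set rs. fits H W k Z x r"
begin

lemma constraints_mem: "(d, ns) \<in> set (constraints x W k Z rs) \<longleftrightarrow>
    (\<exists>f < length rs. \<exists>s \<in> set (sites x (rs ! f)). d = tag W (length rs) f s \<and>
       ns = map (addr W k Z) (map (cell_at x s) (cells (rs ! f))))"
  by (auto simp: constraints_def)

lemma constraints_wf: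
  "\<forall>(d, ns) \<in> set (constraints x W k Z rs). d < H * W * length rs \<and> distinct ns \<and>
     set ns \<subseteq> {..<H * W * (k + 1) * Z}"
proof clarify
  fix d ns assume "(d, ns) \<in> set (constraints x W k Z rs)"
  then obtain f s where f: "f < length rs" "s \<in> set (sites x (rs ! f))" "d = tag W (length rs) f s"
    and ns: "ns = map (addr W k Z) (map (cell_at x s) (cells (rs ! f)))"
    unfolding constraints_mem by blast
  have "fits H W k Z x (rs ! f)" using fits f(1) by simp
  then have s: "fst s < H" "snd s < W" "distinct (map (cell_at x s) (cells (rs ! f)))"
    "set (map (cell_at x s) (cells (rs ! f))) \<subseteq> {..<H} \<times> {..<W} \<times> {..k} \<times> {..<Z}"
    using f(2) unfolding fits_def by auto
  have "d < H * W * length rs"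
    unfolding f(3) tag_def case_prod_beta using f(1) s(1,2) by (intro mixed_radix_less)
  moreover have "distinct ns"
    unfolding ns distinct_map[of "addr W k Z"] using s(3) inj_on_subset[OF inj_addr s(4)] by blast
  moreover have "addr W k Z c < H * W * (k + 1) * Z" if "c \<in> {..<H} \<times> {..<W} \<times> {..k} \<times> {..<Z}" for c
  proof (cases c)
    case (fields t i j v)
    then have "t < H" "i < W" "j \<le> k" "v < Z" using that by auto
    then show ?thesis
      unfolding fields addr_def prod.case by (intro mixed_radix_less var_index_less)
  qed
  then have "set ns \<subseteq> {..<H * W * (k + 1) * Z}"
    using s(4) unfolding ns by (auto dest!: subsetD)
  ultimately show "d < H * W * length rs \<and> distinct ns \<and> set ns \<subseteq> {..<H * W * (k + 1) * Z}"
    by blast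
qed

lemma tag_inj:
  assumes "tag W F f s = tag W F f' s'" "f < F" "f' < F" "snd s < W" "snd s' < W"
  shows "f = f' \<and> s = s'"
proof -
  have "f = f'" "fst s * W + snd s = fst s' * W + snd s'"
    using assms(1-3) mixed_radix_div_mod[of f F] mixed_radix_div_mod[of f' F]
    unfolding tag_def case_prod_beta by metis+
  moreover have "fst s = fst s'" "snd s = snd s'"
    using calculation(2) assms(4,5) mixed_radix_div_mod[of "snd s" W] mixed_radix_div_mod[of "snd s'" W]
    by metis+
  ultimately show ?thesis by (simp add: prod_eq_iff)
qed

lemma distinct_tags: "distinct (map fst (constraints x W k Z rs))"
proof -
  have less: "snd s < W" if "f < length rs" "s \<in> set (sites x (rs ! f))" for f s
  proof -
    have "fits H W k Z x (rs ! f)" using fits that(1) by simp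
    then show ?thesis using that(2) unfolding fits_def by blast
  qed
  have "map fst (constraints x W k Z rs) =
      concat (map (\<lambda>f. map (tag W (length rs) f) (sites x (rs ! f))) [0..<length rs])"
    by (simp add: constraints_def map_concat o_def)
  also have "distinct \<dots>"
  proof (rule distinct_concat_map)
    fix f assume "f \<in> set [0..<length rs]"
    then show "distinct (map (tag W (length rs) f) (sites x (rs ! f)))"
      using distinct_sites tag_inj less by (auto simp: distinct_map inj_on_def)
  next
    fix f g assume fg: "f \<in> set [0..<length rs]" "g \<in> set [0..<length rs]" "f \<noteq> g"
    show "set (map (tag W (length rs) f) (sites x (rs ! f))) \<inter>
        set (map (tag W (length rs) g) (sites x (rs ! g))) = {}"
    proof (rule ccontr)
      assume "\<not> ?thesis"
      then obtain s s' where "s \<in> set (sites x (rs ! f))" "s' \<in> set (sites x (rs ! g))"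
        "tag W (length rs) f s = tag W (length rs) g s'" by auto
      then show False using tag_inj[of "length rs" f s g s'] less fg by auto
    qed
  qed simp
  finally show ?thesis .
qed

lemma constraints_satisfiable:
  assumes Z: "Z > 0"
  shows "(\<exists>A. (\<forall>g < H * W * (k + 1). A g < Z) \<and>
      (\<forall>(d, ns) \<in> set (constraints x W k Z rs). \<exists>v \<in> set ns. A (v div Z) \<noteq> v mod Z)) \<longleftrightarrow>
    (\<exists>A. (\<forall>t i j. j \<le> k \<longrightarrow> A t i j < Z) \<and> (\<forall>r \<in> set rs. obeys A x r))"
proof -
  \<comment> \<open>For either direction it suffices to find a flat assignment \<open>B\<close> and
    a grid \<open>A\<close> that agree inside the \<open>H\<close> by \<open>W\<close> grid, as
    \<open>fits\<close> keeps all cells there.\<close>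
  have key: "(\<forall>(d, ns) \<in> set (constraints x W k Z rs). \<exists>v \<in> set ns. B (v div Z) \<noteq> v mod Z) \<longleftrightarrow>
      (\<forall>r \<in> set rs. obeys A x r)"
    if AB: "\<And>t i j. t < H \<Longrightarrow> i < W \<Longrightarrow> j \<le> k \<Longrightarrow> B (var_index W k t i j) = A t i j" for A B
  proof -
    have cell: "B (addr W k Z c div Z) \<noteq> addr W k Z c mod Z \<longleftrightarrow> (case c of (t, i, j, v) \<Rightarrow> A t i j \<noteq> v)"
      if "c \<in> {..<H} \<times> {..<W} \<times> {..k} \<times> {..<Z}" for c
      using that AB by (auto simp: addr_decode)
    have "(\<forall>(d, ns) \<in> set (constraints x W k Z rs). \<exists>v \<in> set ns. B (v div Z) \<noteq> v mod Z) \<longleftrightarrow>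
      (\<forall>d ns. (d, ns) \<in> set (constraints x W k Z rs) \<longrightarrow> (\<exists>v \<in> set ns. B (v div Z) \<noteq> v mod Z))"
      by blast
    also have "\<dots> \<longleftrightarrow> (\<forall>f < length rs. \<forall>s \<in> set (sites x (rs ! f)).
        \<exists>v \<in> set (map (addr W k Z) (map (cell_at x s) (cells (rs ! f)))). B (v div Z) \<noteq> v mod Z)"
      unfolding constraints_mem by blast
    also have "\<dots> \<longleftrightarrow> (\<forall>f < length rs. \<forall>s \<in> set (sites x (rs ! f)). \<exists>c \<in> cell_at x s ` set (cells (rs ! f)).
         B (addr W k Z c div Z) \<noteq> addr W k Z c mod Z)"
      unfolding set_map bex_simps(7) ..
    also have "\<dots> \<longleftrightarrow> (\<forall>f < length rs. \<forall>s \<in> set (sites x (rs ! f)).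
        \<exists>(t, i, j, v) \<in> cell_at x s ` set (cells (rs ! f)). A t i j \<noteq> v)"
    proof (intro all_cong ball_cong bex_cong refl)
      fix f s c assume "f < length rs" "s \<in> set (sites x (rs ! f))"
        "c \<in> cell_at x s ` set (cells (rs ! f))"
      moreover have "fits H W k Z x (rs ! f)" using fits \<open>f < length rs\<close> by simp
      ultimately have "c \<in> {..<H} \<times> {..<W} \<times> {..k} \<times> {..<Z}" unfolding fits_def by blast
      then show "B (addr W k Z c div Z) \<noteq> addr W k Z c mod Z \<longleftrightarrow> (case c of (t, i, j, v) \<Rightarrow> A t i j \<noteq> v)"
        by (rule cell)
    qed
    also have "\<dots> \<longleftrightarrow> (\<forall>r \<in> set rs. obeys A x r)"
      unfolding obeys_def all_set_conv_all_nth by blast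
    finally show ?thesis .
  qed
  show ?thesis
  proof
    assume "\<exists>A. (\<forall>g < H * W * (k + 1). A g < Z) \<and>
      (\<forall>(d, ns) \<in> set (constraints x W k Z rs). \<exists>v \<in> set ns. A (v div Z) \<noteq> v mod Z)"
    then obtain B where B: "\<And>g. g < H * W * (k + 1) \<Longrightarrow> B g < Z"
      and sat: "\<forall>(d, ns) \<in> set (constraints x W k Z rs). \<exists>v \<in> set ns. B (v div Z) \<noteq> v mod Z" by blast
    define A where "A t i j = (if t < H \<and> i < W then B (var_index W k t i j) else 0)" for t i j
    have "\<forall>r \<in> set rs. obeys A x r" using key[of B A] sat by (simp add: A_def)
    moreover have "A t i j < Z" if "j \<le> k" for t i j
      using B[OF var_index_less[of t H i W j k]] that Z by (simp add: A_def)
    ultimately show "\<exists>A. (\<forall>t i j. j \<le> k \<longrightarrow> A t i j < Z) \<and> (\<forall>r \<in> set rs. obeys A x r)" by blast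
  next
    assume "\<exists>A. (\<forall>t i j. j \<le> k \<longrightarrow> A t i j < Z) \<and> (\<forall>r \<in> set rs. obeys A x r)"
    then obtain A where A: "\<And>t i j. j \<le> k \<Longrightarrow> A t i j < Z" and sat: "\<forall>r \<in> set rs. obeys A x r" by blast
    define B where "B g = A (g div (k + 1) div W) (g div (k + 1) mod W) (g mod (k + 1))" for g
    have "B (var_index W k t i j) = A t i j" if "i < W" "j \<le> k" for t i j
      unfolding B_def var_index_decode[OF that] ..
    then have "\<forall>(d, ns) \<in> set (constraints x W k Z rs). \<exists>v \<in> set ns. B (v div Z) \<noteq> v mod Z"
      using key[of B A] sat by blast
    moreover have "B g < Z" for g unfolding B_def by (rule A) (simp add: less_Suc_eq_le[symmetric])
    ultimately show "\<exists>A. (\<forall>g < H * W * (k + 1). A g < Z) \<and>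
      (\<forall>(d, ns) \<in> set (constraints x W k Z rs). \<exists>v \<in> set ns. A (v div Z) \<noteq> v mod Z)" by blast
  qed
qed

end

section \<open>Generating the instances\<close>

definition cats :: "gen list \<Rightarrow> gen" where "cats gs = foldr Cat gs (Str [])"

lemma cats_simps [simp]:
  "gen_word m (cats gs) x R = concat (map (\<lambda>g. gen_word m g x R) gs)"
  "wf_gen m (cats gs) \<longleftrightarrow> (\<forall>g \<in> set gs. wf_gen m g)"
  "no_input (cats gs) \<longleftrightarrow> (\<forall>g \<in> set gs. no_input g)"
  unfolding cats_def by (induction gs) auto

lemma concat_map_product:
  "concat (map w (List.product ts is)) = concat (map (\<lambda>t. concat (map (\<lambda>i. w (t, i)) is)) ts)"
  by (induction ts) (simp_all add: o_def)

lemma concat_concat_map: "concat (map u (concat (map v xs))) = concat (map (\<lambda>x. concat (map u (v x))) xs)"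
  by (induction xs) auto

lemma concat_map_filter: "concat (map w (filter Q xs)) = concat (map (\<lambda>i. if Q i then w i else []) xs)"
  by (induction xs) auto

lemma enc_list_concat: "enc_list e xs = concat (map (\<lambda>x. True # e x) xs) @ [False]"
  by (induction xs) auto

definition class_gen :: "expr list \<Rightarrow> nat \<Rightarrow> gen" where
  "class_gen es q =
     cats (Str [True] # map (\<lambda>e. Cat (Str [True]) (Num e)) es @ [Str (False # enc_nat q)])"

lemma gen_word_class: "gen_word m (class_gen es q) x R = True # enc_class (map (\<lambda>e. val e R) es, q)"
  by (simp add: class_gen_def enc_class_def enc_list_concat o_def)

lemma class_gen_simps [simp]:
  "wf_gen m (class_gen es q) \<longleftrightarrow> (\<forall>e \<in> set es. below m e)" "no_input (class_gen es q)"
  by (auto simp: class_gen_def)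

definition num_vars :: "nat \<Rightarrow> nat \<Rightarrow> nat \<Rightarrow> nat" where "num_vars k h w = h * w * (k + 1)"
definition num_tags :: "rule list \<Rightarrow> nat \<Rightarrow> nat \<Rightarrow> nat" where "num_tags rs h w = h * w * length rs"

definition csp_of :: "nat \<Rightarrow> nat \<Rightarrow> rule list \<Rightarrow> bool list \<Rightarrow> nat \<Rightarrow> nat \<Rightarrow> classification" where
  "csp_of k Z rs x h w =
     csp_classes (num_vars k h w) Z (rev [0..<num_vars k h w]) (constraints x w k Z rs)"

definition inst_of :: "nat \<Rightarrow> nat \<Rightarrow> rule list \<Rightarrow> bool list \<Rightarrow> nat \<Rightarrow> nat \<Rightarrow> inst" where
  "inst_of k Z rs x h w = choice_inst (num_vars k h w * Z + num_tags rs h w)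
     (num_vars k h w + num_tags rs h w) (csp_of k Z rs x h w)"

context
  fixes H W :: expr and k Z :: nat and rs :: "rule list"
begin

definition G_expr :: expr where "G_expr = Mult (Mult H W) (Const (k + 1))"
definition m_expr :: expr where "m_expr = Mult (Mult H W) (Const (length rs))"
definition N_expr :: expr where "N_expr = Plus (Mult G_expr (Const Z)) m_expr"
definition K_expr :: expr where "K_expr = Plus G_expr m_expr"

text \<open>The symbolic form of \<open>addr\<close> applied to \<open>cell_at\<close>, with the
  site in variables 1 and 2.\<close>

definition cell_expr :: "cell \<Rightarrow> expr" where
  "cell_expr = (\<lambda>(r, c, j, v). Plus (Mult (Plus (Mult (Plus (Mult r W) c) (Const (k + 1))) (Const j))
     (Const Z)) (Const v))"

definition tag_expr :: "nat \<Rightarrow> expr" where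
  "tag_expr f = Plus (Mult G_expr (Const Z))
     (Plus (Mult (Plus (Mult (Var 1) W) (Var 2)) (Const (length rs))) (Const f))"

text \<open>In the second case, the loop of a single round sets the row, variable 1, to 0 and makes
  the input position variable 2, so that the same class generator \<open>g\<close> fits both
  cases.\<close>

definition rule_gen :: "nat \<Rightarrow> gen" where
  "rule_gen f = (let g = class_gen (tag_expr f # map cell_expr (cells (rs ! f))) (length (cells (rs ! f)))
     in case rs ! f of
       (None, r, c, _) \<Rightarrow> For r (For c g)
     | (Some b, _) \<Rightarrow> For (Const 1) (if b then ForIn (Str []) g else ForIn g (Str [])))"

definition group_gen :: gen where
  "group_gen = For G_expr (class_gen (map (\<lambda>v. Plus (Mult (Var 1) (Const Z)) (Const v)) [0..<Z]) 1)"

text \<open>The literal bits between the parts are list markers: \<open>True\<close> announces an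
  element and \<open>False\<close> ends a list. So \<open>[False, True]\<close> ends the applicants
  and opens post 0, and the last string first ends the classes of post 0.\<close>

definition inst_gen :: gen where
  "inst_gen = cats ([For N_expr (Str (True # enc_applicant chooser)),
     Str (concat (replicate 3 (True # enc_applicant probe)) @ [False, True]),
     Num K_expr,
     class_gen [N_expr, Plus N_expr (Const 1), Plus N_expr (Const 2)] 1,
     group_gen] @ map rule_gen [0..<length rs] @
     [Str (False # True # enc_post \<lparr>post_quota = 1, post_classes = []\<rparr> @ [False])])"

definition vec_gen :: gen where
  "vec_gen = cats [inst_gen, Str [True], Num (Plus K_expr (Const 1)), Str (True # enc_nat 0 @ [False])]"

context
  assumes below: "below 1 H" "below 1 W" and wf: "\<forall>r \<in> set rs. wf_rule r"
begin

lemma below_exprs: "1 \<le> n \<Longrightarrow> below n H" "1 \<le> n \<Longrightarrow> below n W" "1 \<le> n \<Longrightarrow> below n G_expr"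
  "1 \<le> n \<Longrightarrow> below n m_expr" "1 \<le> n \<Longrightarrow> below n N_expr" "1 \<le> n \<Longrightarrow> below n K_expr"
  "3 \<le> n \<Longrightarrow> below n (tag_expr f)"
  using below below_mono[of 1 _ n] by (auto simp: G_expr_def m_expr_def N_expr_def K_expr_def tag_expr_def)

lemma wf_gens: "wf_gen 1 inst_gen" "wf_gen 1 vec_gen"
proof -
  have "wf_gen 1 (rule_gen f)" if "f < length rs" for f
  proof -
    have r: "wf_rule (rs ! f)" using wf that by simp
    obtain b r c cs where rs: "rs ! f = (b, r, c, cs)" by (metis surj_pair)
    have "below 3 (cell_expr cl)" if "cl \<in> set (cells (rs ! f))" for cl
      using r that below_exprs(2)[of 3] by (auto simp: wf_rule_def cell_expr_def)
    moreover have "below 1 r" "below 1 c" using r by (auto simp: wf_rule_def rs)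
    moreover have "below 2 c" using below_mono[OF \<open>below 1 c\<close>] by simp
    ultimately show ?thesis
      using below_exprs(7)[of 3]
      by (cases b) (auto simp: rule_gen_def Let_def rs numeral_2_eq_2 numeral_3_eq_3)
  qed
  then show "wf_gen 1 inst_gen"
    using below_exprs[of 1] by (auto simp: inst_gen_def group_gen_def)
  then show "wf_gen 1 vec_gen"
    using below_exprs[of 1] by (auto simp: vec_gen_def)
qed

context
  fixes x :: "bool list" and h w :: nat
  assumes h: "val H (input_env x) = h" and w: "val W (input_env x) = w"
begin

abbreviation "out_G \<equiv> num_vars k h w"
abbreviation "out_m \<equiv> num_tags rs h w"
abbreviation "out_classes \<equiv> csp_of k Z rs x h w"
abbreviation "out_inst \<equiv> inst_of k Z rs x h w"

lemma val_exprs: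
  assumes "\<And>i. i < 1 \<Longrightarrow> R i = input_env x i"
  shows "val W R = w" "val G_expr R = out_G" "val N_expr R = out_G * Z + out_m" "val K_expr R = out_G + out_m"
proof -
  have "val H R = h" "val W R = w"
    using val_cong[OF below(1) assms] val_cong[OF below(2) assms] h w by auto
  then show "val W R = w" "val G_expr R = out_G" "val N_expr R = out_G * Z + out_m"
    "val K_expr R = out_G + out_m"
    by (simp_all add: G_expr_def N_expr_def K_expr_def m_expr_def num_vars_def num_tags_def)
qed

lemma gen_word_rule:
  assumes "f < length rs"
  shows "gen_word 1 (rule_gen f) x (input_env x) =
    concat (map (\<lambda>s. True # enc_class ((out_G * Z + tag w (length rs) f s) #
      map (addr w k Z \<circ> cell_at x s) (cells (rs ! f)), length (cells (rs ! f)))) (sites x (rs ! f)))"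
proof -
  define g where "g = class_gen (tag_expr f # map cell_expr (cells (rs ! f))) (length (cells (rs ! f)))"
  have r: "wf_rule (rs ! f)" using wf assms by simp
  obtain b r c cs where rs: "rs ! f = (b, r, c, cs)" by (metis surj_pair)
  define word where "word s = True # enc_class ((out_G * Z + tag w (length rs) f s) #
      map (addr w k Z \<circ> cell_at x s) (cells (rs ! f)), length (cells (rs ! f)))" for s
  have g: "gen_word 3 g x ((input_env x)(1 := t, 2 := i)) = word (t, i)" for t i
  proof -
    have e: "(input_env x)(1 := t, 2 := i) = site_env x (t, i)" by (simp add: site_env_def)
    have v: "val W (site_env x (t, i)) = w" "val G_expr (site_env x (t, i)) = out_G"
      using val_exprs[of "site_env x (t, i)"] by (auto simp: site_env_def)
    have "val (tag_expr f) (site_env x (t, i)) = out_G * Z + tag w (length rs) f (t, i)"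
      by (simp add: tag_expr_def tag_def v)
    moreover have "val (cell_expr cl) (site_env x (t, i)) = (addr w k Z \<circ> cell_at x (t, i)) cl" for cl
      by (simp add: cell_expr_def addr_def var_index_def cell_at_def v split: prod.split)
    ultimately show ?thesis
      unfolding g_def gen_word_class e word_def by (simp add: o_def)
  qed
  have "gen_word 1 (rule_gen f) x (input_env x) = concat (map word (sites x (rs ! f)))"
  proof (cases b)
    case None
    have "below 1 c" using r by (simp add: wf_rule_def rs)
    then have c: "val c ((input_env x)(1 := t)) = val c (input_env x)" for t
      by (rule val_cong) auto
    have "gen_word 1 (For r (For c g)) x (input_env x) =
      concat (map (\<lambda>t. concat (map (\<lambda>i. word (t, i)) (rev [0..<val c (input_env x)])))
        (rev [0..<val r (input_env x)]))"
      using g c by (simp add: numeral_2_eq_2 numeral_3_eq_3)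
    also have "\<dots> = concat (map word (sites x (rs ! f)))"
      by (simp add: rs None concat_map_product)
    finally show ?thesis
      unfolding rule_gen_def Let_def g_def[symmetric] by (simp only: rs None prod.case option.case)
  next
    case (Some b')
    have "gen_word 1 (For (Const 1) (if b' then ForIn (Str []) g else ForIn g (Str []))) x (input_env x) =
      concat (map (\<lambda>i. if x ! i = b' then word (0, i) else []) [0..<length x])"
      using g[of 0] by (cases b') (auto intro!: arg_cong[where f = concat] simp: numeral_2_eq_2 numeral_3_eq_3)
    also have "\<dots> = concat (map word (sites x (rs ! f)))"
      by (simp add: rs Some o_def concat_map_filter)
    finally show ?thesis
      unfolding rule_gen_def Let_def g_def[symmetric] by (simp only: rs Some prod.case option.case)
  qed
  then show ?thesis unfolding word_def .
qed

lemma gen_word_inst: "gen_word 1 inst_gen x (input_env x) = enc_inst out_inst"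
proof -
  define N K where "N = out_G * Z + out_m" and "K = out_G + out_m"
  have v: "val N_expr (input_env x) = N" "val K_expr (input_env x) = K" "val G_expr (input_env x) = out_G"
    using val_exprs[of "input_env x"] by (simp_all add: N_def K_def)
  define groups where "groups = map (\<lambda>g. ([g * Z..<g * Z + Z], 1 :: nat)) (rev [0..<out_G])"
  define nogoods where "nogoods = map (\<lambda>(d, ns). ((out_G * Z + d) # ns, length ns)) (constraints x w k Z rs)"
  have applicants: "gen_word 1 (For N_expr (Str (True # enc_applicant chooser))) x (input_env x) @
      concat (replicate 3 (True # enc_applicant probe)) @ [False] =
      enc_list enc_applicant (replicate N chooser @ replicate 3 probe)"
    by (simp add: enc_list_concat v map_replicate_const)
  have three: "gen_word 1 (class_gen [N_expr, Plus N_expr (Const 1), Plus N_expr (Const 2)] 1) x (input_env x)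
      = True # enc_class ([N, N + 1, N + 2], 1)"
    by (simp add: gen_word_class v)
  have "gen_word 1 group_gen x (input_env x) = concat (map (\<lambda>C. True # enc_class C) groups)"
  proof -
    have "map (\<lambda>v. g * Z + v) [0..<Z] = [g * Z..<g * Z + Z]" for g
      using map_add_upt[of "g * Z" Z] by (simp add: add.commute)
    then show ?thesis by (simp add: group_gen_def gen_word_class v groups_def o_def)
  qed
  moreover have "concat (map (\<lambda>f. gen_word 1 (rule_gen f) x (input_env x)) [0..<length rs]) =
      concat (map (\<lambda>C. True # enc_class C) nogoods)"
  proof -
    have "concat (map (\<lambda>f. gen_word 1 (rule_gen f) x (input_env x)) [0..<length rs]) =
      concat (map (\<lambda>f. concat (map (\<lambda>s. True # enc_class ((out_G * Z + tag w (length rs) f s) #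
        map (addr w k Z \<circ> cell_at x s) (cells (rs ! f)), length (cells (rs ! f)))) (sites x (rs ! f))))
        [0..<length rs])"
      using gen_word_rule by (intro arg_cong[of _ _ concat] map_cong) auto
    also have "\<dots> = concat (map (\<lambda>C. True # enc_class C) nogoods)"
      by (simp add: nogoods_def constraints_def concat_concat_map o_def split_beta)
    finally show ?thesis .
  qed
  ultimately have classes: "gen_word 1 group_gen x (input_env x) @
      concat (map (\<lambda>f. gen_word 1 (rule_gen f) x (input_env x)) [0..<length rs]) @ [False] =
      enc_list enc_class out_classes"
    unfolding csp_of_def csp_classes_def enc_list_concat groups_def nogoods_def by simp
  have "gen_word 1 inst_gen x (input_env x) =
      enc_list enc_applicant (replicate N chooser @ replicate 3 probe) @ True # enc_nat K @
      (True # enc_class ([N, N + 1, N + 2], 1)) @ enc_list enc_class out_classes @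
      True # enc_post \<lparr>post_quota = 1, post_classes = []\<rparr> @ [False]"
    unfolding applicants[symmetric] classes[symmetric] three[symmetric]
    by (simp add: inst_gen_def v o_def)
  also have "\<dots> = enc_inst out_inst"
    by (simp add: enc_inst_def inst_of_def choice_inst_def enc_post_def N_def K_def)
  finally show ?thesis .
qed

lemma gen_word_vec: "gen_word 1 vec_gen x (input_env x) = enc_inst_vec (out_inst, [out_G + out_m + 1, 0])"
  using val_exprs[of "input_env x"] by (simp add: vec_gen_def gen_word_inst[unfolded One_nat_def] enc_inst_vec_def)

lemma csp_of_valid:
  assumes "Z > 0" "\<forall>r \<in> set rs. fits h w k Z x r"
  shows "\<forall>(C, q) \<in> set out_classes. distinct C \<and> set C \<subseteq> {..<out_G * Z + out_m}"
    "distinct (map (set \<circ> fst) out_classes)"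
    "solvable (out_G * Z + out_m) (out_G + out_m) out_classes \<longleftrightarrow>
      (\<exists>A. (\<forall>t i j. j \<le> k \<longrightarrow> A t i j < Z) \<and> (\<forall>r \<in> set rs. obeys A x r))"
proof -
  have gs: "distinct (rev [0..<out_G])" "set (rev [0..<out_G]) = {..<out_G}" by auto
  have L: "\<forall>(d, ns) \<in> set (constraints x w k Z rs). d < out_m \<and> distinct ns \<and> set ns \<subseteq> {..<out_G * Z}"
    unfolding num_tags_def num_vars_def by (rule constraints_wf[OF assms(2)])
  note csp = gs L distinct_tags[OF assms(2)]
  show "\<forall>(C, q) \<in> set out_classes. distinct C \<and> set C \<subseteq> {..<out_G * Z + out_m}"
    "distinct (map (set \<circ> fst) out_classes)"
    unfolding csp_of_def by (rule csp_classes_valid[OF assms(1) csp])+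
  show "solvable (out_G * Z + out_m) (out_G + out_m) out_classes \<longleftrightarrow>
      (\<exists>A. (\<forall>t i j. j \<le> k \<longrightarrow> A t i j < Z) \<and> (\<forall>r \<in> set rs. obeys A x r))"
    unfolding csp_of_def solvable_csp[OF assms(1) csp]
    unfolding num_vars_def by (rule constraints_satisfiable[OF assms(2,1)])
qed

end

end

end

section \<open>Assembling the reduction\<close>

lemma exists_poly_expr: "\<exists>e. below 1 e \<and> (\<forall>R. val e R = poly p (R 0))" for p :: "nat poly"
proof (induction p)
  case 0
  show ?case by (rule exI[of _ "Const 0"]) simp
next
  case (pCons a p)
  then obtain e where e: "below 1 e" "\<And>R. val e R = poly p (R 0)" by blast
  \<comment> \<open>Horner's rule.\<close>
  then show ?case by (intro exI[of _ "Plus (Const a) (Mult (Var 0) e)"]) simp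
qed

text \<open>One instance answers both questions, so it is built once, with two generators for its
  two codes.\<close>

lemma reduction:
  assumes "L \<in> NP"
  shows "\<exists>g g' I K. wf_gen 1 g \<and> wf_gen 1 g' \<and> (\<forall>x. valid_inst (I x) \<and> strict_prefs (I x) \<and>
    only_posts_classified (I x) \<and> unit_app_quotas (I x) \<and> max_rank (I x) = 2 \<and>
    gen_word 1 g x (input_env x) = enc_inst_vec (I x, [K x + 1, 0]) \<and>
    gen_word 1 g' x (input_env x) = enc_inst (I x) \<and>
    (x \<in> L \<longleftrightarrow> CRMM (I x, [K x + 1, 0])) \<and> (x \<in> L \<longleftrightarrow> CPM (I x)))"
proof -
  obtain M p where wf: "wf_tm M"
    and bound: "\<And>x n c. (tm_step M ^^ n) (tm_init M x) c \<Longrightarrow> n \<le> poly p (length x)"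
    and acc: "\<And>x. x \<in> L \<longleftrightarrow> (\<exists>c. (tm_step M)\<^sup>*\<^sup>* (tm_init M x) c \<and> tm_halted M c \<and> fst c = tm_accept M)"
    using assms unfolding NP_def by blast
  let ?k = "tm_tapes M"
  obtain PE where PE: "below 1 PE" "\<And>R. val PE R = poly p (R 0)"
    using exists_poly_expr by blast
  obtain ts where ts: "set ts = transitions M" using finite_list[OF finite_transitions[OF wf]] by blast
  \<comment> \<open>Stands for surplus numbers. Its source \<open>tm_states M\<close> is not a
    state, so it can neither start a computation nor follow a transition; displacement 0 makes its
    \<open>shift\<close> equal to 1.\<close>
  define none :: trans where "none = (tm_states M, [], 0, replicate ?k (0, 0))"
  define tr where "tr v = (if v < length ts then ts ! v else none)" for v
  \<comment> \<open>A common domain for tape symbols and transition numbers.\<close>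
  define Z where "Z = max (tm_symbols M) (length ts)"
  have k: "?k \<ge> 1" using wf by (simp add: wf_tm_def)
  have Z: "Z > 0" "tm_symbols M \<le> Z" using wf by (auto simp: wf_tm_def Z_def)
  have tr: "\<forall>v. tr v \<in> transitions M \<or> src (tr v) = tm_states M"
    using ts nth_mem[of _ ts] by (auto simp: tr_def none_def)
  have tr_surj: "\<forall>\<tau> \<in> transitions M. \<exists>v<Z. tr v = \<tau>"
  proof
    fix \<tau> assume \<tau>: "\<tau> \<in> transitions M"
    obtain v where "v < length ts" "ts ! v = \<tau>" using \<tau> ts by (metis in_set_conv_nth)
    then show "\<exists>v<Z. tr v = \<tau>" by (intro exI[of _ v]) (simp add: tr_def Z_def)
  qed
  have "shift (tr v) j \<le> 2" if "j < ?k" for v j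
  proof (cases "v < length ts")
    case True
    then have "tr v \<in> transitions M" using ts nth_mem[of v ts] by (simp add: tr_def)
    note b = transitions_bounds[OF wf this]
    have "acts (tr v) ! j \<in> set (acts (tr v))" using b(2) that by simp
    from bspec[OF b(3) this] show ?thesis by (auto simp: shift_def)
  next
    case False
    then show ?thesis using that by (simp add: tr_def none_def shift_def)
  qed
  then have shift: "\<forall>v. \<forall>j < ?k. shift (tr v) j \<le> 2" by blast
  define rs where "rs = rules M tr Z PE"
  have wfr: "\<forall>r \<in> set rs. wf_rule r"
    using wf_rules[OF PE(1) k shift] unfolding rs_def by blast
  \<comment> \<open>Rows 0 to \<open>T\<close> and the width of the window, where \<open>T\<close>
    is the length of the input plus the time bound. Adding the length ensures that the whole input
    lies inside the window.\<close>
  define H W where "H = Plus (Plus (Var 0) PE) (Const 1)"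
    and "W = Plus (Plus (Plus (Var 0) PE) (Plus (Var 0) PE)) (Const 3)"
  have below: "below 1 H" "below 1 W" using PE(1) by (simp_all add: H_def W_def)
  define T where "T x = length x + val PE (input_env x)" for x
  have HW: "val H (input_env x) = T x + 1" "val W (input_env x) = 2 * T x + 3" for x
    by (simp_all add: H_def W_def T_def)
  have fit: "\<forall>r \<in> set rs. fits (T x + 1) (2 * T x + 3) ?k Z x r" for x
    using fits_rules[OF PE(1) k shift T_def] unfolding rs_def by blast
  define K where "K x = num_vars ?k (T x + 1) (2 * T x + 3) + num_tags rs (T x + 1) (2 * T x + 3)" for x
  define I where "I x = inst_of ?k Z rs x (T x + 1) (2 * T x + 3)" for x
  have "valid_inst (I x) \<and> strict_prefs (I x) \<and> only_posts_classified (I x) \<and> unit_app_quotas (I x) \<and>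
    max_rank (I x) = 2 \<and> (x \<in> L \<longleftrightarrow> CRMM (I x, [K x + 1, 0])) \<and> (x \<in> L \<longleftrightarrow> CPM (I x))" for x
  proof -
    note cs = csp_of_valid[OF below wfr HW Z(1) fit]
    note inst = cs(1,2)[of x]
    define P where "P = val PE (input_env x)"
    have "x \<in> L \<longleftrightarrow> (\<exists>c. (tm_step M)\<^sup>*\<^sup>* (tm_init M x) c \<and> accepting M c)"
      by (simp add: acc accepting_def)
    also have "\<dots> \<longleftrightarrow> (\<exists>C. C 0 = tm_init M x \<and> (\<forall>t<length x + P. idle_step M (C t) (C (Suc t))) \<and>
        accepting M (C (length x + P)))"
      by (rule accepting_padded) (use bound[of _ x] PE(2) in \<open>fastforce simp: P_def\<close>)
    also have "\<dots> \<longleftrightarrow> (\<exists>A. (\<forall>t i j. j \<le> ?k \<longrightarrow> A t i j < Z) \<and> tableau M tr P x A)"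
      by (rule tableau_iff[OF wf tr tr_surj Z(2), symmetric])
    also have "\<dots> \<longleftrightarrow> (\<exists>A. (\<forall>t i j. j \<le> ?k \<longrightarrow> A t i j < Z) \<and> (\<forall>r \<in> set rs. obeys A x r))"
    proof (intro ex_cong1 conj_cong refl)
      fix A :: "nat \<Rightarrow> nat \<Rightarrow> nat \<Rightarrow> nat"
      assume A: "\<forall>t i j. j \<le> ?k \<longrightarrow> A t i j < Z"
      show "tableau M tr P x A \<longleftrightarrow> (\<forall>r \<in> set rs. obeys A x r)"
        unfolding rs_def by (rule obeys_rules[OF PE(1) k shift _ P_def, symmetric]) (use A in blast)
    qed
    finally have L: "x \<in> L \<longleftrightarrow> solvable (num_vars ?k (T x + 1) (2 * T x + 3) * Z +
        num_tags rs (T x + 1) (2 * T x + 3)) (K x) (csp_of ?k Z rs x (T x + 1) (2 * T x + 3))"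
      unfolding K_def cs(3)[of x] .
    show ?thesis
      unfolding L I_def inst_of_def K_def[symmetric]
      by (intro conjI valid_choice_inst[OF inst] restrictions_choice_inst[OF inst]
          max_rank_choice_inst[OF inst] CRMM_choice_inst[OF inst, symmetric]
          CPM_choice_inst[OF inst, symmetric])
  qed
  moreover have "gen_word 1 (inst_gen H W ?k Z rs) x (input_env x) = enc_inst (I x)"
    "gen_word 1 (vec_gen H W ?k Z rs) x (input_env x) = enc_inst_vec (I x, [K x + 1, 0])" for x
    unfolding I_def K_def
    by (rule gen_word_inst[OF below wfr HW], rule gen_word_vec[OF below wfr HW])
  moreover have "wf_gen 1 (inst_gen H W ?k Z rs)" "wf_gen 1 (vec_gen H W ?k Z rs)"
    by (rule wf_gens[OF below wfr])+
  ultimately show ?thesis by blast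
qed

theorem theorem3:
  shows "NP_hard enc_inst_vec
           {(I, \<sigma>) \<in> CRMM_instances. strict_prefs I \<and> only_posts_classified I \<and> unit_app_quotas I}
           CRMM \<and>
         NP_hard enc_inst
           {I \<in> CPM_instances. strict_prefs I \<and> only_posts_classified I \<and> unit_app_quotas I}
           CPM"
  unfolding NP_hard_def
proof (intro conjI ballI)
  fix L assume "L \<in> NP"
  from reduction[OF this] obtain g g' I K where g: "wf_gen 1 g" "wf_gen 1 g'"
    and x: "\<And>x. valid_inst (I x) \<and> strict_prefs (I x) \<and>
      only_posts_classified (I x) \<and> unit_app_quotas (I x) \<and> max_rank (I x) = 2 \<and>
      gen_word 1 g x (input_env x) = enc_inst_vec (I x, [K x + 1, 0]) \<and>
      gen_word 1 g' x (input_env x) = enc_inst (I x) \<and>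
      (x \<in> L \<longleftrightarrow> CRMM (I x, [K x + 1, 0])) \<and> (x \<in> L \<longleftrightarrow> CPM (I x))"
    by blast
  show "\<exists>f. polytime_computable f \<and> (\<forall>x. \<exists>i \<in> {(I, \<sigma>) \<in> CRMM_instances. strict_prefs I \<and>
    only_posts_classified I \<and> unit_app_quotas I}. f x = enc_inst_vec i \<and> (x \<in> L \<longleftrightarrow> CRMM i))"
  proof (intro exI conjI allI)
    show "polytime_computable (\<lambda>x. gen_word 1 g x (input_env x))"
      unfolding input_env_def by (rule polytime_gen_word[OF g(1)])
    fix y show "\<exists>i \<in> {(I, \<sigma>) \<in> CRMM_instances. strict_prefs I \<and>
      only_posts_classified I \<and> unit_app_quotas I}. gen_word 1 g y (input_env y) = enc_inst_vec i \<and>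
      (y \<in> L \<longleftrightarrow> CRMM i)"
      by (rule bexI[of _ "(I y, [K y + 1, 0])"]) (use x[of y] in \<open>auto simp: CRMM_instances_def simp del: One_nat_def Suc_eq_plus1\<close>)
  qed
  show "\<exists>f. polytime_computable f \<and> (\<forall>x. \<exists>i \<in> {I \<in> CPM_instances. strict_prefs I \<and>
    only_posts_classified I \<and> unit_app_quotas I}. f x = enc_inst i \<and> (x \<in> L \<longleftrightarrow> CPM i))"
  proof (intro exI conjI allI)
    show "polytime_computable (\<lambda>x. gen_word 1 g' x (input_env x))"
      unfolding input_env_def by (rule polytime_gen_word[OF g(2)])
    fix y show "\<exists>i \<in> {I \<in> CPM_instances. strict_prefs I \<and>
      only_posts_classified I \<and> unit_app_quotas I}. gen_word 1 g' y (input_env y) = enc_inst i \<and>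
      (y \<in> L \<longleftrightarrow> CPM i)"
      by (rule bexI[of _ "I y"]) (use x[of y] in \<open>auto simp: CPM_instances_def\<close>)
  qed
qed

end
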